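(* Let $p\ge 1$, $\beta^\star\in\mathbb{R}^p$ and $\tau>0$ be fixed, let the data follow the Gaussian linear model with parameters $(\beta^\star,\tau)$ described in the context, and assume $\|\beta^\star\|_0<p$, where $\|\beta^\star\|_0$ is the number of nonzero entries of $\beta^\star$. Let $(\lambda_n)$ and $(\delta_n)$ be deterministic sequences of positive numbers with $\lambda_n=O(\sqrt n)$, $\lambda_n=\omega(1)$, and $\delta_n=\Theta(1)$. Let $\hat\beta_{\lambda_n}$ and $\hat\beta_{\lambda_n+\delta_n}$ be the soft-thresholding estimators with parameters $\lambda_n$ and $\lambda_n+\delta_n$, both computed from the training set $\mathbf{Z}$ of size $n$, and define $$h_n^{\mathrm{diff}}(Z_0,\mathbf{Z})=(Y_0-X_0^\top\hat\beta_{\lambda_n})^2-(Y_0-X_0^\top\hat\beta_{\lambda_n+\delta_n})^2 .$$ Then, as $n\to\infty$, $$\frac{n^2}{\delta_n^2}\,\sigma^2(h_n^{\mathrm{diff}})\to 4\tau^2\|\beta^\star\|_0\qquad\text{and}\qquad \gamma(h_n^{\mathrm{diff}})=\Omega\Big(\frac{1}{n^2\sqrt n}\Big),$$ and consequently $r(h_n^{\mathrm{diff}})=\Omega(\sqrt n)$; in particular $r(h_n^{\mathrm{diff}})\neq o(1)$.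
   Context: Linear model: $Z_i=(X_i,Y_i)$, $i\ge 0$, are i.i.d. with $Y_i=X_i^\top\beta^\star+\varepsilon_i$, $X_i\sim\mathcal N(0,\mathbf I)$ in $\mathbb{R}^p$, $\varepsilon_i\sim\mathcal N(0,\tau^2)$, $\varepsilon_i$ independent of $X_i$. The training set is $\mathbf Z=(Z_1,\dots,Z_n)$ with $n\ge p$, $\mathbf X=(X_1,\dots,X_n)^\top\in\mathbb{R}^{n\times p}$, $\mathbf Y=(Y_1,\dots,Y_n)$; $Z_0$ is an independent test point. $\mathbf X^\top\mathbf X$ is almost surely invertible. Soft-thresholding (ST): with $\hat\beta_{\mathrm{OLS}}=(\mathbf X^\top\mathbf X)^{-1}\mathbf X^\top\mathbf Y$, the ST estimator with parameter $\lambda$ is $\hat\beta_{\lambda,i}=\mathrm{sign}(\hat\beta_{\mathrm{OLS},i})\,(|\hat\beta_{\mathrm{OLS},i}|-\lambda/n)_+$ for $i=1,\dots,p$, where $x_+=\max(x,0)$. Stability: let $Z_1'$ be an i.i.d. copy of $Z_1$, independent of everything else, and $\mathbf Z'=(Z_1',Z_2,\dots,Z_n)$. For a function $h_n(Z_0,\mathbf Z)$ that is invariant to the order of the $n$ elements of its second argument, - loss stability: $\gamma(h_n)=\mathbb E\big[\big(h_n(Z_0,\mathbf Z)-\mathbb E[h_n(Z_0,\mathbf Z)\mid\mathbf Z]-(h_n(Z_0,\mathbf Z')-\mathbb E[h_n(Z_0,\mathbf Z')\mid\mathbf Z'])\big)^2\big]$; - $\sigma^2(h_n)=\mathrm{Var}(\mathbb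 E[h_n(Z_0,\mathbf Z)\mid Z_0])$; - relative loss stability: $r(h_n)=n\,\gamma(h_n)/\sigma^2(h_n)$. Asymptotic notation ($n\to\infty$): $f_n=O(g_n)$ if $f_n/g_n$ is asymptotically bounded, $f_n=o(g_n)$ if $f_n/g_n\to0$, $f_n=\omega(g_n)$ if $g_n=o(f_n)$, $f_n=\Omega(g_n)$ if $g_n=O(f_n)$, $f_n=\Theta(g_n)$ if both $f_n=O(g_n)$ and $f_n=\Omega(g_n)$. *)

theory Defs
  imports "HOL-Probability.Probability" "HOL-Library.Landau_Symbols"
begin

section \<open>Stability of a function of a test point and a training set\<close>

definition training_set :: "nat \<Rightarrow> (nat \<Rightarrow> 'w \<Rightarrow> 'z) \<Rightarrow> 'w \<Rightarrow> (nat \<Rightarrow> 'z)" where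
  "training_set n Z w = (\<lambda>i\<in>{1..n}. Z i w)"

definition cond_exp_test ::
    "'w measure \<Rightarrow> (nat \<Rightarrow> 'w \<Rightarrow> 'z::topological_space) \<Rightarrow> nat \<Rightarrow> ('z \<Rightarrow> (nat \<Rightarrow> 'z) \<Rightarrow> real) \<Rightarrow> 'w \<Rightarrow> real" where
  "cond_exp_test M Z n h =
     real_cond_exp M (vimage_algebra (space M) (Z 0) borel) (\<lambda>w. h (Z 0 w) (training_set n Z w))"

definition cond_exp_train ::
    "'w measure \<Rightarrow> (nat \<Rightarrow> 'w \<Rightarrow> 'z::topological_space) \<Rightarrow> nat \<Rightarrow> ('z \<Rightarrow> (nat \<Rightarrow> 'z) \<Rightarrow> real) \<Rightarrow> 'w \<Rightarrow> real" where
  "cond_exp_train M Z n h =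
     real_cond_exp M (vimage_algebra (space M) (training_set n Z) (\<Pi>\<^sub>M i\<in>{1..n}. borel))
       (\<lambda>w. h (Z 0 w) (training_set n Z w))"

text \<open>The sequence \<open>Z\<close> consists of the test point \<open>Z 0\<close> and the training points \<open>Z 1, Z 2, \<dots>\<close>;
  \<open>Zc\<close> is the independent copy of \<open>Z 1\<close>, so that \<open>training_set n (Z(1 := Zc))\<close> is the
  perturbed training set.\<close>

definition loss_stability ::
    "'w measure \<Rightarrow> (nat \<Rightarrow> 'w \<Rightarrow> 'z::topological_space) \<Rightarrow> ('w \<Rightarrow> 'z) \<Rightarrow> nat
      \<Rightarrow> ('z \<Rightarrow> (nat \<Rightarrow> 'z) \<Rightarrow> real) \<Rightarrow> real" where
  "loss_stability M Z Zc n h =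
     (let Z' = Z(1 := Zc) in
      \<integral>w. (h (Z 0 w) (training_set n Z w) - cond_exp_train M Z n h w
           - (h (Z 0 w) (training_set n Z' w) - cond_exp_train M Z' n h w))\<^sup>2 \<partial>M)"

definition sigma_sq ::
    "'w measure \<Rightarrow> (nat \<Rightarrow> 'w \<Rightarrow> 'z::topological_space) \<Rightarrow> nat
      \<Rightarrow> ('z \<Rightarrow> (nat \<Rightarrow> 'z) \<Rightarrow> real) \<Rightarrow> real" where
  "sigma_sq M Z n h = prob_space.variance M (cond_exp_test M Z n h)"

definition rel_loss_stability ::
    "'w measure \<Rightarrow> (nat \<Rightarrow> 'w \<Rightarrow> 'z::topological_space) \<Rightarrow> ('w \<Rightarrow> 'z) \<Rightarrow> nat
      \<Rightarrow> ('z \<Rightarrow> (nat \<Rightarrow> 'z) \<Rightarrow> real) \<Rightarrow> real" where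
  "rel_loss_stability M Z Zc n h = real n * loss_stability M Z Zc n h / sigma_sq M Z n h"


section \<open>The Gaussian linear model\<close>

text \<open>Density of the standard normal distribution on a Euclidean space.\<close>

definition std_gaussian_density :: "'a::euclidean_space \<Rightarrow> real" where
  "std_gaussian_density x = (2 * pi) powr (- real DIM('a) / 2) * exp (- (norm x)\<^sup>2 / 2)"

text \<open>In \<open>case_option Zc Z\<close> the index \<open>None\<close> carries the extra copy \<open>Zc\<close>, so that \<open>indep_all\<close>
  states the joint independence of \<open>Zc, Z 0, Z 1, \<dots>\<close>. Independence of \<open>X i\<close> and \<open>noise i\<close>
  is stated through the generated \<open>\<sigma>\<close>-algebras because \<open>indep_var\<close> requires both variables
  to have the same type.\<close>

locale gaussian_linear_model = prob_space M
  for M :: "'w measure" +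
  fixes X :: "nat \<Rightarrow> 'w \<Rightarrow> real ^ 'p"
    and Y :: "nat \<Rightarrow> 'w \<Rightarrow> real"
    and noise :: "nat \<Rightarrow> 'w \<Rightarrow> real"
    and Z :: "nat \<Rightarrow> 'w \<Rightarrow> (real ^ 'p) \<times> real"
    and Zc :: "'w \<Rightarrow> (real ^ 'p) \<times> real"
    and \<beta> :: "real ^ 'p"
    and \<tau> :: real
  assumes Z_eq: "\<And>i w. Z i w = (X i w, Y i w)"
    and Y_eq: "\<And>i w. w \<in> space M \<Longrightarrow> Y i w = X i w \<bullet> \<beta> + noise i w"
    and X_distributed: "\<And>i. distributed M lborel (X i) (\<lambda>x. ennreal (std_gaussian_density x))"
    and noise_distributed:
      "\<And>i. distributed M lborel (noise i) (\<lambda>e. ennreal (normal_density 0 \<tau> e))"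
    and noise_indep: "\<And>i. indep_set (sets (vimage_algebra (space M) (X i) borel))
                            (sets (vimage_algebra (space M) (noise i) borel))"
    and copy_distr: "distr M borel Zc = distr M borel (Z 1)"
    and indep_all: "indep_vars (\<lambda>_. borel) (case_option Zc Z) UNIV"


section \<open>Soft thresholding\<close>

text \<open>A data set \<open>D\<close> of size \<open>n\<close> consists of the points \<open>D 1, \<dots>, D n\<close>. As \<open>n\<close> varies, the
  \<open>n \<times> p\<close> design matrix has no type of its own; \<open>gram n D\<close> is the \<open>p \<times> p\<close> matrix
  \<open>X\<^sup>T X\<close> and \<open>cross n D\<close> the vector \<open>X\<^sup>T Y\<close>, written entrywise.\<close>

definition gram :: "nat \<Rightarrow> (nat \<Rightarrow> (real ^ 'p) \<times> real) \<Rightarrow> real ^ 'p ^ 'p" where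
  "gram n D = (\<chi> j k. \<Sum>i=1..n. fst (D i) $ j * fst (D i) $ k)"

definition cross :: "nat \<Rightarrow> (nat \<Rightarrow> (real ^ 'p) \<times> real) \<Rightarrow> real ^ 'p" where
  "cross n D = (\<chi> j. \<Sum>i=1..n. fst (D i) $ j * snd (D i))"

definition ols :: "nat \<Rightarrow> (nat \<Rightarrow> (real ^ 'p) \<times> real) \<Rightarrow> real ^ 'p" where
  "ols n D = matrix_inv (gram n D) *v cross n D"

definition soft_threshold :: "nat \<Rightarrow> real \<Rightarrow> (nat \<Rightarrow> (real ^ 'p) \<times> real) \<Rightarrow> real ^ 'p" where
  "soft_threshold n l D = (\<chi> j. sgn (ols n D $ j) * max (\<bar>ols n D $ j\<bar> - l / real n) 0)"

definition h_diff ::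
    "nat \<Rightarrow> real \<Rightarrow> real \<Rightarrow> (real ^ 'p) \<times> real \<Rightarrow> (nat \<Rightarrow> (real ^ 'p) \<times> real) \<Rightarrow> real" where
  "h_diff n l d z0 D =
     (snd z0 - fst z0 \<bullet> soft_threshold n l D)\<^sup>2
     - (snd z0 - fst z0 \<bullet> soft_threshold n (l + d) D)\<^sup>2"

text \<open>\<open>h_diff\<close> does not depend on the order of the training points.\<close>

lemma h_diff_permute:
  assumes "\<pi> permutes {1..n}"
  shows "h_diff n l d z0 (D \<circ> \<pi>) = h_diff n l d z0 D"
proof -
  have "gram n (D \<circ> \<pi>) = gram n D"
    unfolding gram_def vec_eq_iff
    using sum.permute[OF assms, of "\<lambda>i. fst (D i) $ j * fst (D i) $ k" for j k]
    by (simp add: o_def)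
  moreover have "cross n (D \<circ> \<pi>) = cross n D"
    unfolding cross_def vec_eq_iff
    using sum.permute[OF assms, of "\<lambda>i. fst (D i) $ j * snd (D i)" for j]
    by (simp add: o_def)
  ultimately show ?thesis
    by (simp add: h_diff_def soft_threshold_def ols_def)
qed

definition l0_norm :: "real ^ 'p \<Rightarrow> nat" where
  "l0_norm b = card {j. b $ j \<noteq> 0}"

end

theory Submission
  imports Defs "HOL-Real_Asymp.Real_Asymp"
begin

text \<open>
  Write \<open>d\<close> for the difference of the two soft-thresholding estimators. Each coordinate of
  \<open>d\<close> lies in \<open>[-\<delta> n / n, \<delta> n / n]\<close>; it equals minus the sign of the OLS coordinate times
  \<open>\<delta> n / n\<close> beyond the larger threshold and vanishes below the smaller one. Since OLS is consistent, and a
  null coordinate of it is symmetric, \<open>n / \<delta> n\<close> times the expectation of the loss difference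
  given \<open>Z 0\<close> converges to \<open>-2 \<epsilon>\<^sub>0 (X\<^sub>0 \<bullet> sgn \<beta>)\<close> in mean square; this gives the limit of the
  variance.

  For the loss stability, independence of noise and covariate at the test point gives
  \<open>\<gamma> \<ge> 4 \<tau>\<^sup>2 E |d - d'|\<^sup>2\<close>. A null coordinate of the OLS estimator without the first training
  point is conditionally normal with standard deviation of order \<open>1 / sqrt n\<close>, so it falls within
  \<open>1 / n\<close> of the threshold with probability of order \<open>1 / sqrt n\<close>. The points \<open>Z 1\<close> and \<open>Zc\<close>
  move it by a multiple of \<open>1 / n\<close>, and with a probability bounded away from zero they move it to opposite sides
  of the transition zone, so that \<open>|d - d'| \<ge> \<delta> n / n\<close>.

  Finite moments of OLS come from bounding the diagonal of the inverse Gram matrix by a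
  product of powers of the inverse norms of four independent square blocks.
\<close>

section \<open>Gram matrices and least squares\<close>

text \<open>If \<open>\<beta> = 0\<close>, the limit of the normalised variance is 0 and does not
  exclude that \<open>sigma_sq\<close> vanishes; a zero denominator would make
  \<open>rel_loss_stability\<close> equal to 0. So eventual positivity of the variance is proved
  separately in this case, through a quadratic form in the test covariate.

  Moments are the other obstacle: the random Gram matrix can be nearly singular, yet the conditional
  expectations need an integrable loss difference, and the limit needs a mean square error of order
  1/n. Well-conditioned designs give this order directly. By Chebyshev the other designs have
  probability O(1/n), and on them the blocks taken from the first 4p observations bound the inverse
  by a variable of finite expectation. Conditioning is tested on the later observations only, so the
  two factors are independent and their product is again O(1/n).

  The rate 1/sqrt n of the separating event relies on \<open>lam n\<close> being O(sqrt n): the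
  threshold \<open>lam n / n\<close> then stays within boundedly many standard deviations of a null
  coordinate, where the Gaussian density is of order sqrt n.\<close>

definition gramx :: "'i set \<Rightarrow> ('i \<Rightarrow> real ^ 'p) \<Rightarrow> real ^ 'p ^ 'p" where
  "gramx S x = (\<chi> j k. \<Sum>i\<in>S. x i $ j * x i $ k)"

definition olsx :: "'i set \<Rightarrow> ('i \<Rightarrow> real ^ 'p) \<Rightarrow> ('i \<Rightarrow> real) \<Rightarrow> real ^ 'p" where
  "olsx S x y = matrix_inv (gramx S x) *v (\<Sum>i\<in>S. y i *\<^sub>R x i)"

text \<open>Column \<open>j\<close> of the inverse Gram matrix. Its entry \<open>j\<close>, times
  \<open>\<tau>\<^sup>2\<close>, is the variance of coordinate \<open>j\<close> of least squares for
  a fixed invertible design.\<close>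

definition gcol :: "'i set \<Rightarrow> ('i \<Rightarrow> real ^ 'p) \<Rightarrow> 'p \<Rightarrow> real ^ 'p" where
  "gcol S x j = matrix_inv (gramx S x) *v axis j 1"

text \<open>The condition is entrywise, so that Chebyshev's inequality and a union bound apply. The
  factor 4 p^2 is chosen so that, after summing over rows and columns, the Gram matrix differs from
  N times the identity by at most N/4 in operator norm, N being the number of observations.\<close>

definition well_conditioned :: "'i set \<Rightarrow> ('i \<Rightarrow> real ^ 'p) \<Rightarrow> bool" where
  "well_conditioned S x \<longleftrightarrow>
     (\<forall>j k. \<bar>gramx S x $ j $ k - (if j = k then real (card S) else 0)\<bar>
        \<le> real (card S) / (4 * (real CARD('p))\<^sup>2))"

lemma ols_eq_olsx: "ols n D = olsx {1..n} (\<lambda>i. fst (D i)) (\<lambda>i. snd (D i))"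
proof -
  have "cross n D = (\<Sum>i\<in>{1..n}. snd (D i) *\<^sub>R fst (D i))"
    by (simp add: cross_def vec_eq_iff mult.commute)
  then show ?thesis by (simp add: ols_def olsx_def gram_def gramx_def)
qed

lemma gramx_mult: "gramx S x *v y = (\<Sum>i\<in>S. (x i \<bullet> y) *\<^sub>R x i)"
proof -
  have "(\<Sum>k\<in>UNIV. (\<Sum>i\<in>S. x i $ j * x i $ k) * y $ k) = (\<Sum>i\<in>S. (\<Sum>k\<in>UNIV. x i $ k * y $ k) * x i $ j)" for j
    by (simp add: sum_distrib_right sum_distrib_left sum.swap[of _ S] mult_ac)
  then show ?thesis
    by (simp add: vec_eq_iff matrix_vector_mult_def gramx_def inner_vec_def)
qed

lemma inner_gramx: "y \<bullet> (gramx S x *v y) = (\<Sum>i\<in>S. (x i \<bullet> y)\<^sup>2)"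
  by (simp add: gramx_mult inner_sum_right power2_eq_square inner_commute)

lemma gramx_sym: "u \<bullet> (gramx S x *v v) = (gramx S x *v u) \<bullet> v"
  by (simp add: gramx_mult inner_sum_right inner_sum_left mult_ac inner_commute)

lemma invertible_gramx_iff:
  assumes "finite S"
  shows "invertible (gramx S x) \<longleftrightarrow> (\<forall>y. (\<forall>i\<in>S. x i \<bullet> y = 0) \<longrightarrow> y = 0)"
proof -
  have "gramx S x *v y = 0 \<longleftrightarrow> (\<forall>i\<in>S. x i \<bullet> y = 0)" for y
  proof
    assume "gramx S x *v y = 0"
    then have "(\<Sum>i\<in>S. (x i \<bullet> y)\<^sup>2) = 0" using inner_gramx[of y S x] by simp
    then show "\<forall>i\<in>S. x i \<bullet> y = 0" using assms by (simp add: sum_nonneg_eq_0_iff)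
  qed (simp add: gramx_mult)
  then show ?thesis by (simp add: invertible_left_inverse matrix_left_invertible_ker)
qed

lemma invertible_gramx_mono:
  assumes "finite T" "S \<subseteq> T" "invertible (gramx S x)"
  shows "invertible (gramx T x)"
  using assms by (simp add: invertible_gramx_iff finite_subset) blast

lemma matrix_inv_mult_vec:
  fixes A :: "real ^ 'n ^ 'n"
  assumes "invertible A"
  shows "A *v (matrix_inv A *v v) = v" "matrix_inv A *v (A *v v) = v"
proof -
  have "A ** matrix_inv A = mat 1 \<and> matrix_inv A ** A = mat 1"
    using assms unfolding matrix_inv_def invertible_def by (rule someI_ex)
  then show "A *v (matrix_inv A *v v) = v" "matrix_inv A *v (A *v v) = v"
    by (simp_all add: matrix_vector_mul_assoc)
qed

lemma gramx_inv_component: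
  assumes "invertible (gramx S x)"
  shows "(matrix_inv (gramx S x) *v v) $ j = v \<bullet> gcol S x j"
proof -
  let ?G = "gramx S x"
  have "(matrix_inv ?G *v v) $ j = (matrix_inv ?G *v v) \<bullet> (?G *v gcol S x j)"
    using matrix_inv_mult_vec(1)[OF assms, of "axis j 1"]
    by (simp add: gcol_def inner_axis)
  also have "\<dots> = v \<bullet> gcol S x j"
    by (simp add: gramx_sym matrix_inv_mult_vec(1)[OF assms])
  finally show ?thesis .
qed

text \<open>Both sides equal g . G g, where G is the Gram matrix and G g is the unit vector. The
  left side arises as the variance of a noise combination; the right side is the quantity that can
  be bounded.\<close>

lemma sum_gcol_square:
  assumes "invertible (gramx S x)"
  shows "(\<Sum>i\<in>S. (x i \<bullet> gcol S x j)\<^sup>2) = gcol S x j $ j"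
  using inner_gramx[of "gcol S x j" S x] matrix_inv_mult_vec(1)[OF assms, of "axis j 1"]
  by (simp add: gcol_def inner_axis)

text \<open>The weights of the noise depend on the covariates alone. Freezing the design therefore
  turns each coordinate into a linear combination of independent residuals.\<close>

lemma olsx_linear_model:
  assumes "invertible (gramx S x)" and y: "\<And>i. i \<in> S \<Longrightarrow> y i = x i \<bullet> b + e i"
  shows "olsx S x y $ j = b $ j + (\<Sum>i\<in>S. e i * (x i \<bullet> gcol S x j))"
proof -
  have "(\<Sum>i\<in>S. y i *\<^sub>R x i) = gramx S x *v b + (\<Sum>i\<in>S. e i *\<^sub>R x i)"
    by (simp add: gramx_mult y scaleR_add_left sum.distrib)
  then have "olsx S x y = b + matrix_inv (gramx S x) *v (\<Sum>i\<in>S. e i *\<^sub>R x i)"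
    by (simp add: olsx_def matrix_vector_right_distrib matrix_inv_mult_vec[OF assms(1)])
  then show ?thesis
    by (simp add: gramx_inv_component[OF assms(1)] inner_sum_left)
qed

text \<open>The Sherman-Morrison rank-one update: a new observation moves the estimate along
  \<open>z\<close> by its prediction error divided by \<open>1 + x a \<bullet> z\<close>. The proof
  checks that the new value solves the enlarged normal equations.\<close>

lemma olsx_insert:
  assumes S: "finite S" "a \<notin> S" and inv: "invertible (gramx S x)"
  defines "z \<equiv> matrix_inv (gramx S x) *v x a"
  shows "olsx (insert a S) x y = olsx S x y + ((y a - x a \<bullet> olsx S x y) / (1 + x a \<bullet> z)) *\<^sub>R z"
    and "x a \<bullet> z \<ge> 0"
proof -
  let ?G = "gramx S x" and ?H = "gramx (insert a S) x"
  have Gz: "?G *v z = x a" by (simp add: z_def matrix_inv_mult_vec[OF inv])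
  have "x a \<bullet> z = z \<bullet> (?G *v z)" by (simp add: Gz inner_commute)
  then show nn: "x a \<bullet> z \<ge> 0" by (simp add: inner_gramx sum_nonneg)
  have invH: "invertible ?H" by (rule invertible_gramx_mono[OF _ _ inv]) (use S in auto)
  have H: "?H *v v = ?G *v v + (x a \<bullet> v) *\<^sub>R x a" for v
    using S by (simp add: gramx_mult add.commute)
  define t where "t = olsx S x y"
  define c where "c = (y a - x a \<bullet> t) / (1 + x a \<bullet> z)"
  have c: "c * (1 + x a \<bullet> z) = y a - x a \<bullet> t" using nn by (simp add: c_def)
  have Gt: "?G *v t = (\<Sum>i\<in>S. y i *\<^sub>R x i)"
    by (simp add: t_def olsx_def matrix_inv_mult_vec[OF inv])
  have "?H *v (t + c *\<^sub>R z) = (\<Sum>i\<in>S. y i *\<^sub>R x i) + c *\<^sub>R x a + (x a \<bullet> t + c * (x a \<bullet> z)) *\<^sub>R x a"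
    by (simp add: H matrix_vector_right_distrib matrix_vector_mult_scaleR Gz Gt inner_add_right
          scaleR_add_left scaleR_add_right add_ac)
  also have "\<dots> = (\<Sum>i\<in>S. y i *\<^sub>R x i) + (c * (1 + x a \<bullet> z) + x a \<bullet> t) *\<^sub>R x a"
    by (simp add: algebra_simps scaleR_add_left)
  also have "\<dots> = (\<Sum>i\<in>insert a S. y i *\<^sub>R x i)"
    using S by (simp add: c)
  finally have "matrix_inv ?H *v (?H *v (t + c *\<^sub>R z)) = olsx (insert a S) x y"
    by (simp add: olsx_def)
  then show "olsx (insert a S) x y = olsx S x y + ((y a - x a \<bullet> olsx S x y) / (1 + x a \<bullet> z)) *\<^sub>R z"
    by (simp add: matrix_inv_mult_vec[OF invH] t_def c_def)
qed

section \<open>Well-conditioned designs\<close>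

lemma well_conditioned_norm:
  fixes x :: "'i \<Rightarrow> real ^ 'p"
  assumes "well_conditioned S x"
  shows "norm (gramx S x *v y - real (card S) *\<^sub>R y) \<le> real (card S) * norm y / 4"
proof -
  let ?N = "real (card S)" and ?p = "real CARD('p)"
  let ?\<eta> = "?N / (4 * ?p\<^sup>2)"
  have "\<bar>(gramx S x *v y - ?N *\<^sub>R y) $ j\<bar> \<le> ?N / (4 * ?p) * norm y" for j
  proof -
    have "(gramx S x $ j $ k - (if j = k then ?N else 0)) * y $ k =
        gramx S x $ j $ k * y $ k - (if j = k then ?N * y $ k else 0)" for k
      by (simp add: left_diff_distrib)
    then have "(gramx S x *v y - ?N *\<^sub>R y) $ j =
        (\<Sum>k\<in>UNIV. (gramx S x $ j $ k - (if j = k then ?N else 0)) * y $ k)"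
      by (simp add: matrix_vector_mult_def sum_subtractf)
    also have "\<bar>\<dots>\<bar> \<le> (\<Sum>k\<in>UNIV. \<bar>(gramx S x $ j $ k - (if j = k then ?N else 0)) * y $ k\<bar>)"
      by (rule sum_abs)
    also have "\<dots> \<le> (\<Sum>k\<in>(UNIV::'p set). ?\<eta> * norm y)"
      unfolding abs_mult
      by (intro sum_mono mult_mono) (use assms in \<open>auto simp: well_conditioned_def component_le_norm_cart\<close>)
    also have "\<dots> = ?N / (4 * ?p) * norm y"
      by (simp add: power2_eq_square)
    finally show ?thesis .
  qed
  then have "norm (gramx S x *v y - ?N *\<^sub>R y) \<le> (\<Sum>j\<in>(UNIV::'p set). ?N / (4 * ?p) * norm y)"
    by (intro order_trans[OF norm_le_l1_cart] sum_mono)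
  then show ?thesis by simp
qed

lemma well_conditioned_quad:
  assumes "well_conditioned S x"
  shows "(\<Sum>i\<in>S. (x i \<bullet> y)\<^sup>2) \<ge> 3/4 * real (card S) * (norm y)\<^sup>2"
proof -
  let ?N = "real (card S)" and ?w = "gramx S x *v y - real (card S) *\<^sub>R y"
  have "\<bar>y \<bullet> ?w\<bar> \<le> norm y * (?N * norm y / 4)"
    by (intro order_trans[OF Cauchy_Schwarz_ineq2] mult_left_mono well_conditioned_norm assms) auto
  moreover have "y \<bullet> ?w = (\<Sum>i\<in>S. (x i \<bullet> y)\<^sup>2) - ?N * (norm y)\<^sup>2"
    by (simp add: inner_diff_right inner_gramx power2_norm_eq_inner)
  moreover have "norm y * (?N * norm y / 4) = ?N * (norm y)\<^sup>2 / 4"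
    by (simp add: power2_eq_square)
  ultimately show ?thesis by linarith
qed

lemma well_conditioned_invertible:
  assumes "well_conditioned S x" "card S > 0"
  shows "invertible (gramx S x)"
proof -
  have "y = 0" if "\<forall>i\<in>S. x i \<bullet> y = 0" for y
  proof -
    have "3/4 * real (card S) * (norm y)\<^sup>2 \<le> 0"
      using well_conditioned_quad[OF assms(1), of y] that by simp
    then show ?thesis using assms(2) by (simp add: mult_le_0_iff)
  qed
  moreover have "finite S" using assms(2) card_gt_0_iff by blast
  ultimately show ?thesis by (simp add: invertible_gramx_iff)
qed

lemma component_square_le_norm:
  fixes y :: "real ^ 'n"
  shows "(y $ j)\<^sup>2 \<le> (norm y)\<^sup>2"
  using power_mono[OF component_le_norm_cart[of y j], of 2] by simp

text \<open>More observations only enlarge the quadratic form, so a well-conditioned part of the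
  data suffices. With g the column of the inverse, (3/4) |T| g_j^2 is at most g . G g = g_j, and one
  factor g_j cancels.\<close>

lemma gcol_le_subset:
  assumes wc: "well_conditioned T x" "card T > 0" and T: "T \<subseteq> S" "finite S"
  shows "gcol S x j $ j \<le> 4 / (3 * real (card T))"
proof -
  let ?y = "gcol S x j"
  have inv: "invertible (gramx S x)"
    by (rule invertible_gramx_mono[OF T(2,1) well_conditioned_invertible[OF wc]])
  have "3/4 * real (card T) * (?y $ j)\<^sup>2 \<le> 3/4 * real (card T) * (norm ?y)\<^sup>2"
    by (intro mult_left_mono component_square_le_norm) simp
  also have "\<dots> \<le> (\<Sum>i\<in>T. (x i \<bullet> ?y)\<^sup>2)" by (rule well_conditioned_quad[OF wc(1)])
  also have "\<dots> \<le> (\<Sum>i\<in>S. (x i \<bullet> ?y)\<^sup>2)" using T by (intro sum_mono2) auto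
  also have "\<dots> = ?y $ j" by (rule sum_gcol_square[OF inv])
  finally have *: "3/4 * real (card T) * (?y $ j)\<^sup>2 \<le> ?y $ j" .
  show ?thesis
  proof (cases "?y $ j > 0")
    case True
    have "(3/4 * real (card T) * ?y $ j) * ?y $ j \<le> 1 * ?y $ j"
      using * by (simp add: power2_eq_square mult.assoc)
    then have "3/4 * real (card T) * ?y $ j \<le> 1"
      using True by (rule mult_right_le_imp_le)
    then have "?y $ j * (3 * real (card T)) \<le> 4" by argo
    then show ?thesis using wc(2) by (intro mult_imp_le_div_pos) auto
  next
    case False
    then show ?thesis by (simp add: order.trans[of _ 0])
  qed
qed

text \<open>A perturbation of N times the identity by at most N/4 gives the constants: 4/3 = 1/(1 -
  1/4), 4/5 = 1/(1 + 1/4), and 1/3 = (1/4)(4/3).\<close>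

lemma well_conditioned_inverse:
  fixes v :: "real ^ 'p"
  assumes wc: "well_conditioned S x" and pos: "card S > 0"
  defines "z \<equiv> matrix_inv (gramx S x) *v v"
  shows "real (card S) * norm z \<le> 4/3 * norm v"
    and "real (card S) * norm z \<ge> 4/5 * norm v"
    and "norm (real (card S) *\<^sub>R z - v) \<le> norm v / 3"
proof -
  let ?N = "real (card S)"
  have Gz: "gramx S x *v z = v"
    by (simp add: z_def matrix_inv_mult_vec[OF well_conditioned_invertible[OF wc pos]])
  have *: "norm (v - ?N *\<^sub>R z) \<le> ?N * norm z / 4"
    using well_conditioned_norm[OF wc, of z] by (simp add: Gz)
  have "?N * norm z = norm (?N *\<^sub>R z)" by simp
  moreover have "norm (?N *\<^sub>R z) \<le> norm v + norm (v - ?N *\<^sub>R z)"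
    using norm_triangle_ineq4[of v "v - ?N *\<^sub>R z"] by simp
  moreover have "norm v \<le> norm (?N *\<^sub>R z) + norm (v - ?N *\<^sub>R z)"
    using norm_triangle_ineq[of "?N *\<^sub>R z" "v - ?N *\<^sub>R z"] by simp
  ultimately show "?N * norm z \<le> 4/3 * norm v" "?N * norm z \<ge> 4/5 * norm v"
    using * by linarith+
  then show "norm (?N *\<^sub>R z - v) \<le> norm v / 3"
    using * by (simp add: norm_minus_commute)
qed

section \<open>Inverse Gram matrices and square blocks\<close>

text \<open>The vector of cofactors of row \<open>i\<close>: its inner product with x is the
  determinant of \<open>A\<close> with row \<open>i\<close> replaced by x. It does not depend on row
  \<open>i\<close> itself, which later makes it independent of that row.\<close>

definition cofactor_vec :: "'p \<Rightarrow> real ^ 'p ^ 'p \<Rightarrow> real ^ 'p" where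
  "cofactor_vec i A = (\<chi> k. det (\<chi> l. if l = i then axis k 1 else A $ l))"

text \<open>For invertible \<open>A\<close> this is the sum of the norms of the columns of the
  inverse, hence a bound for the operator norm of the inverse. Each quotient has a denominator
  linear in one row and a numerator free of that row.\<close>

definition inv_size :: "real ^ 'p ^ 'p \<Rightarrow> real" where
  "inv_size A = (\<Sum>i\<in>UNIV. norm (cofactor_vec i A) / \<bar>det A\<bar>)"

lemma inner_cofactor_vec:
  "x \<bullet> cofactor_vec i A = det (\<chi> l. if l = i then x else A $ l)"
proof -
  have "det (\<chi> l. if l = i then x else A $ l) =
      det (\<chi> l. if l = i then (\<Sum>k\<in>UNIV. x $ k *s axis k 1) else A $ l)"
    by (simp only: basis_expansion)
  also have "\<dots> = (\<Sum>k\<in>UNIV. det (\<chi> l. if l = i then x $ k *s axis k 1 else A $ l))"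
    by (rule det_linear_row_sum) simp
  also have "\<dots> = (\<Sum>k\<in>UNIV. x $ k * det (\<chi> l. if l = i then axis k 1 else A $ l))"
    by (intro sum.cong refl, subst det_row_mul) simp
  finally show ?thesis by (simp add: cofactor_vec_def inner_vec_def)
qed

lemma norm_le_inv_size:
  assumes "det A \<noteq> 0"
  shows "norm y \<le> norm (A *v y) * inv_size A"
proof -
  let ?t = "A *v y"
  \<comment> \<open>The \<open>q i\<close> are the columns of the inverse: the basis dual to the
    rows of \<open>A\<close>.\<close>
  define q where "q i = (1 / det A) *\<^sub>R cofactor_vec i A" for i
  have q: "A $ l \<bullet> q i = (if l = i then 1 else 0)" for l i
  proof (cases "l = i")
    case True
    have "(\<chi> k. if k = i then A $ i else A $ k) = A" by (simp add: vec_eq_iff)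
    then show ?thesis using True assms by (simp add: q_def inner_cofactor_vec)
  next
    case False
    have "det (\<chi> k. if k = i then A $ l else A $ k) = 0"
      by (rule det_identical_rows[OF False]) (use False in \<open>simp add: row_def vec_eq_iff\<close>)
    then show ?thesis using False by (simp add: q_def inner_cofactor_vec)
  qed
  have "A *v (\<Sum>i\<in>UNIV. ?t $ i *\<^sub>R q i) = ?t"
    by (simp add: vec_eq_iff matrix_vector_mul_component[of A "sum _ _"] inner_sum_right q
        if_distrib cong: if_cong)
  moreover have "inj ((*v) A)"
    using assms by (simp add: invertible_det_nz[symmetric] invertible_left_inverse matrix_left_invertible_injective)
  ultimately have y: "y = (\<Sum>i\<in>UNIV. ?t $ i *\<^sub>R q i)" by (metis injD)
  have "norm y \<le> (\<Sum>i\<in>UNIV. norm (?t $ i *\<^sub>R q i))"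
    by (subst y) (rule norm_sum)
  also have "\<dots> \<le> (\<Sum>i\<in>UNIV. norm ?t * (norm (cofactor_vec i A) / \<bar>det A\<bar>))"
    by (intro sum_mono) (auto simp: q_def component_le_norm_cart intro!: mult_mono divide_right_mono)
  finally show ?thesis by (simp add: inv_size_def sum_distrib_left)
qed

lemma inv_size_nonneg: "inv_size A \<ge> 0"
  by (simp add: inv_size_def sum_nonneg)

lemma invertible_gramx_block:
  assumes S: "finite S" "range f \<subseteq> S" and det: "det (\<chi> l. x (f l)) \<noteq> 0"
  shows "invertible (gramx S x)"
proof -
  have "y = 0" if "\<forall>i\<in>S. x i \<bullet> y = 0" for y
  proof -
    have "(\<chi> l. x (f l)) *v y = 0"
      using that S(2) by (auto simp: vec_eq_iff matrix_vector_mul_component)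
    then show ?thesis using norm_le_inv_size[OF det, of y] by simp
  qed
  then show ?thesis using S(1) by (simp add: invertible_gramx_iff)
qed

text \<open>This bound needs only one nonsingular square block and is meant for ill-conditioned
  designs. With g the column and A the block, |A g|^2 is at most g . G g = g_j, while g_j^2 is at
  most |A g|^2 times the squared \<open>inv_size\<close>; one factor g_j cancels.\<close>

lemma gcol_le_block:
  fixes f :: "'p::finite \<Rightarrow> 'i"
  assumes S: "finite S" "range f \<subseteq> S" "inj f" and det: "det (\<chi> l. x (f l)) \<noteq> 0"
  shows "gcol S x j $ j \<le> (inv_size (\<chi> l. x (f l)))\<^sup>2"
proof -
  let ?A = "(\<chi> l. x (f l)) :: real ^ 'p ^ 'p" and ?y = "gcol S x j"
  have inv: "invertible (gramx S x)" by (rule invertible_gramx_block[OF S(1,2) det])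
  have "(norm (?A *v ?y))\<^sup>2 = (\<Sum>l\<in>UNIV. (x (f l) \<bullet> ?y)\<^sup>2)"
    by (simp add: norm_vec_def L2_set_def sum_nonneg matrix_vector_mul_component)
  also have "\<dots> = (\<Sum>i\<in>range f. (x i \<bullet> ?y)\<^sup>2)" by (simp add: sum.reindex S(3))
  also have "\<dots> \<le> (\<Sum>i\<in>S. (x i \<bullet> ?y)\<^sup>2)" using S by (intro sum_mono2) auto
  also have "\<dots> = ?y $ j" by (rule sum_gcol_square[OF inv])
  finally have *: "(norm (?A *v ?y))\<^sup>2 \<le> ?y $ j" .
  then have nn: "?y $ j \<ge> 0" by (meson order_trans zero_le_power2)
  have "(?y $ j)\<^sup>2 \<le> (norm ?y)\<^sup>2"
    by (rule component_square_le_norm)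
  also have "\<dots> \<le> (norm (?A *v ?y) * inv_size ?A)\<^sup>2"
    by (intro power_mono norm_le_inv_size det) auto
  also have "\<dots> \<le> ?y $ j * (inv_size ?A)\<^sup>2"
    using * by (simp add: power_mult_distrib mult_right_mono)
  finally have "?y $ j * ?y $ j \<le> ?y $ j * (inv_size ?A)\<^sup>2" by (simp add: power2_eq_square)
  then show ?thesis using nn by (cases "?y $ j = 0") (auto simp: mult_le_cancel_left)
qed

text \<open>Four blocks bring the exponent of \<open>inv_size\<close> down to \<open>1 / 2\<close>, for which it has a finite
  expectation.\<close>

lemma gcol_le_prod_blocks:
  fixes f :: "nat \<Rightarrow> 'p::finite \<Rightarrow> 'i"
  assumes S: "finite S" "\<And>k. k < 4 \<Longrightarrow> range (f k) \<subseteq> S" "\<And>k. k < 4 \<Longrightarrow> inj (f k)"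
    and det: "\<And>k. k < 4 \<Longrightarrow> det (\<chi> l. x (f k l)) \<noteq> 0"
  shows "gcol S x j $ j \<le> (\<Prod>k<4. sqrt (inv_size (\<chi> l. x (f k l))))"
\<comment> \<open>Fourth powers are compared, the exponent being \<open>Suc 3\<close>: each of the
  four blocks bounds the same diagonal entry, so the fourth power of the entry is at most the
  product of the four bounds.\<close>
proof (rule power_le_imp_le_base[where n = 3])
  let ?s = "\<lambda>k. inv_size (\<chi> l. x (f k l))"
  have nn: "gcol S x j $ j \<ge> 0"
  proof -
    have "invertible (gramx S x)" by (rule invertible_gramx_block[OF S(1) S(2)[of 0] det[of 0]]) auto
    from sum_gcol_square[OF this, of j] show ?thesis by (metis sum_nonneg zero_le_power2)
  qed
  have "(gcol S x j $ j) ^ 4 = (\<Prod>k<(4::nat). gcol S x j $ j)" by simp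
  also have "\<dots> \<le> (\<Prod>k<4. (?s k)\<^sup>2)"
    by (intro prod_mono conjI nn gcol_le_block S det) auto
  also have "\<dots> = (\<Prod>k<4. sqrt (?s k) ^ 4)"
  proof (intro prod.cong refl)
    fix k show "(?s k)\<^sup>2 = sqrt (?s k) ^ 4"
      using real_sqrt_pow2[OF inv_size_nonneg, of "\<chi> l. x (f k l)"]
      by (metis power_mult[of "sqrt (?s k)" 2 2] mult_2 numeral_Bit0)
  qed
  also have "\<dots> = (\<Prod>k<4. sqrt (?s k)) ^ 4"
    by (rule prod_power_distrib[symmetric])
  finally show "(gcol S x j $ j) ^ Suc 3 \<le> (\<Prod>k<4. sqrt (?s k)) ^ Suc 3" by simp
  show "0 \<le> (\<Prod>k<4. sqrt (?s k))" by (intro prod_nonneg) (simp add: inv_size_nonneg)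
qed

section \<open>Independent random variables of different types\<close>

lemma borel_measurable_vec_nth [measurable (raw)]:
  fixes f :: "'a \<Rightarrow> real ^ 'n"
  assumes "f \<in> borel_measurable M"
  shows "(\<lambda>w. f w $ j) \<in> borel_measurable M"
proof -
  have "(\<lambda>w. f w \<bullet> axis j 1) \<in> borel_measurable M" using assms by measurable
  then show ?thesis by (simp add: inner_axis)
qed

context prob_space
begin

definition indep_rv :: "'b measure \<Rightarrow> ('a \<Rightarrow> 'b) \<Rightarrow> 'c measure \<Rightarrow> ('a \<Rightarrow> 'c) \<Rightarrow> bool" where
  "indep_rv S U T V \<longleftrightarrow> U \<in> measurable M S \<and> V \<in> measurable M T \<and>
     (\<forall>A\<in>sets S. \<forall>B\<in>sets T.
        prob ((U -` A \<inter> space M) \<inter> (V -` B \<inter> space M)) = prob (U -` A \<inter> space M) * prob (V -` B \<inter> space M))"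

lemma indep_rv_measurable:
  assumes "indep_rv S U T V"
  shows "U \<in> measurable M S" "V \<in> measurable M T"
  using assms by (auto simp: indep_rv_def)

lemma indep_rv_commute: "indep_rv S U T V \<Longrightarrow> indep_rv T V S U"
  unfolding indep_rv_def by (simp add: Int_commute mult.commute)

lemma indep_rv_compose:
  assumes "indep_rv S U T V" and f: "f \<in> measurable S S'" and g: "g \<in> measurable T T'"
  shows "indep_rv S' (\<lambda>w. f (U w)) T' (\<lambda>w. g (V w))"
proof -
  note [measurable] = indep_rv_measurable[OF assms(1)] f g
  have "prob (((\<lambda>w. f (U w)) -` A \<inter> space M) \<inter> ((\<lambda>w. g (V w)) -` B \<inter> space M)) =
      prob ((\<lambda>w. f (U w)) -` A \<inter> space M) * prob ((\<lambda>w. g (V w)) -` B \<inter> space M)"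
    if "A \<in> sets S'" "B \<in> sets T'" for A B
  proof -
    have U: "(\<lambda>w. f (U w)) -` A \<inter> space M = U -` (f -` A \<inter> space S) \<inter> space M"
      using measurable_space[OF indep_rv_measurable(1)[OF assms(1)]] by auto
    have V: "(\<lambda>w. g (V w)) -` B \<inter> space M = V -` (g -` B \<inter> space T) \<inter> space M"
      using measurable_space[OF indep_rv_measurable(2)[OF assms(1)]] by auto
    show ?thesis
      unfolding U V using assms(1) measurable_sets[OF f that(1)] measurable_sets[OF g that(2)]
      unfolding indep_rv_def by blast
  qed
  moreover have "(\<lambda>w. f (U w)) \<in> measurable M S'" "(\<lambda>w. g (V w)) \<in> measurable M T'"
    by measurable
  ultimately show ?thesis unfolding indep_rv_def by blast
qed

lemma indep_rv_restrict:
  assumes "indep_vars N Z I" "A \<inter> B = {}" "A \<subseteq> I" "B \<subseteq> I"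
  shows "indep_rv (PiM A N) (\<lambda>w. \<lambda>i\<in>A. Z i w) (PiM B N) (\<lambda>w. \<lambda>i\<in>B. Z i w)"
proof -
  from indep_var_restrict[OF assms]
  have "indep_var (PiM A N) (\<lambda>w. \<lambda>i\<in>A. Z i w) (PiM B N) (\<lambda>w. \<lambda>i\<in>B. Z i w)" .
  then show ?thesis unfolding indep_var_eq indep_rv_def by (auto intro!: indep_setD)
qed

lemma indep_rv_distr:
  assumes "indep_rv S U T V"
  shows "distr M (S \<Otimes>\<^sub>M T) (\<lambda>w. (U w, V w)) = distr M S U \<Otimes>\<^sub>M distr M T V"
proof -
  note [measurable] = indep_rv_measurable[OF assms]
  interpret U: prob_space "distr M S U" by (rule prob_space_distr) measurable
  interpret V: prob_space "distr M T V" by (rule prob_space_distr) measurable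
  show ?thesis
  proof (rule pair_measure_eqI[symmetric])
    fix A B assume "A \<in> sets (distr M S U)" "B \<in> sets (distr M T V)"
    then have [measurable]: "A \<in> sets S" "B \<in> sets T" by auto
    have eq: "(\<lambda>w. (U w, V w)) -` (A \<times> B) \<inter> space M = (U -` A \<inter> space M) \<inter> (V -` B \<inter> space M)"
      by auto
    show "emeasure (distr M S U) A * emeasure (distr M T V) B =
        emeasure (distr M (S \<Otimes>\<^sub>M T) (\<lambda>w. (U w, V w))) (A \<times> B)"
      using assms
      by (simp add: emeasure_distr eq emeasure_eq_measure ennreal_mult[symmetric] indep_rv_def)
  qed (auto intro: U.sigma_finite_measure_axioms V.sigma_finite_measure_axioms
        simp: sets_pair_measure_cong[OF sets_distr sets_distr])
qed

text \<open>Fubini for the product law, with the second variable resampled at an independent point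
  \<open>w'\<close> of the same space. The inner integral plays the role of the conditional
  expectation given \<open>U\<close>, without conditional distributions.\<close>

lemma nn_integral_indep_rv:
  assumes ind: "indep_rv S U T V" and [measurable]: "f \<in> borel_measurable (S \<Otimes>\<^sub>M T)"
  shows "(\<integral>\<^sup>+w. f (U w, V w) \<partial>M) = (\<integral>\<^sup>+w. \<integral>\<^sup>+w'. f (U w, V w') \<partial>M \<partial>M)"
proof -
  note [measurable] = indep_rv_measurable[OF ind]
  interpret V: prob_space "distr M T V" by (rule prob_space_distr) measurable
  have "(\<integral>\<^sup>+w. f (U w, V w) \<partial>M) = (\<integral>\<^sup>+z. f z \<partial>distr M (S \<Otimes>\<^sub>M T) (\<lambda>w. (U w, V w)))"
    by (simp add: nn_integral_distr)
  also have "\<dots> = (\<integral>\<^sup>+u. \<integral>\<^sup>+v. f (u, v) \<partial>distr M T V \<partial>distr M S U)"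
    unfolding indep_rv_distr[OF ind]
    by (rule V.nn_integral_fst[symmetric])
      (simp add: measurable_cong_sets[OF sets_pair_measure_cong[OF sets_distr sets_distr] refl])
  also have "\<dots> = (\<integral>\<^sup>+w. \<integral>\<^sup>+v. f (U w, v) \<partial>distr M T V \<partial>M)"
    by (subst nn_integral_distr) (auto intro!: V.borel_measurable_nn_integral simp: split_def)
  also have "\<dots> = (\<integral>\<^sup>+w. \<integral>\<^sup>+w'. f (U w, V w') \<partial>M \<partial>M)"
    by (intro nn_integral_cong, subst nn_integral_distr)
      (auto intro!: measurable_Pair2[of f] simp: measurable_space[OF indep_rv_measurable(1)[OF ind]])
  finally show ?thesis .
qed

lemma
  fixes f :: "'b \<times> 'c \<Rightarrow> real"
  assumes ind: "indep_rv S U T V" and f [measurable]: "f \<in> borel_measurable (S \<Otimes>\<^sub>M T)"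
    and int: "integrable M (\<lambda>w. f (U w, V w))"
  shows integrable_indep_rv: "integrable M (\<lambda>w. \<integral>w'. f (U w, V w') \<partial>M)"
    and integral_indep_rv: "(\<integral>w. \<integral>w'. f (U w, V w') \<partial>M \<partial>M) = (\<integral>w. f (U w, V w) \<partial>M)"
proof -
  note [measurable] = indep_rv_measurable[OF ind]
  interpret U: prob_space "distr M S U" by (rule prob_space_distr) measurable
  interpret V: prob_space "distr M T V" by (rule prob_space_distr) measurable
  interpret UV: pair_sigma_finite "distr M S U" "distr M T V" ..
  have "integrable (distr M (S \<Otimes>\<^sub>M T) (\<lambda>w. (U w, V w))) f"
    using int by (simp add: integrable_distr_eq)
  then have i: "integrable (distr M S U \<Otimes>\<^sub>M distr M T V) (\<lambda>(u, v). f (u, v))"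
    by (simp add: indep_rv_distr[OF ind])
  have inner: "(\<integral>v. f (U w, v) \<partial>distr M T V) = (\<integral>w'. f (U w, V w') \<partial>M)" if "w \<in> space M" for w
    using measurable_space[OF indep_rv_measurable(1)[OF ind] that]
    by (subst integral_distr) (auto intro!: measurable_Pair2[of f])
  have [measurable]: "(\<lambda>u. \<integral>v. f (u, v) \<partial>distr M T V) \<in> borel_measurable S"
    by (rule V.borel_measurable_lebesgue_integral) (simp add: split_def)
  have "integrable (distr M S U) (\<lambda>u. \<integral>v. f (u, v) \<partial>distr M T V)"
    using UV.integrable_fst[OF i] .
  then have "integrable M (\<lambda>w. \<integral>v. f (U w, v) \<partial>distr M T V)"
    by (simp add: integrable_distr_eq)
  then show "integrable M (\<lambda>w. \<integral>w'. f (U w, V w') \<partial>M)"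
    by (rule Bochner_Integration.integrable_cong[THEN iffD1, rotated -1]) (auto simp: inner)
  have "(\<integral>w. f (U w, V w) \<partial>M) = (\<integral>z. f z \<partial>distr M (S \<Otimes>\<^sub>M T) (\<lambda>w. (U w, V w)))"
    by (simp add: integral_distr)
  also have "\<dots> = (\<integral>u. \<integral>v. f (u, v) \<partial>distr M T V \<partial>distr M S U)"
    unfolding indep_rv_distr[OF ind] using UV.integral_fst'[of f] i by simp
  also have "\<dots> = (\<integral>w. \<integral>v. f (U w, v) \<partial>distr M T V \<partial>M)"
    by (subst integral_distr) auto
  also have "\<dots> = (\<integral>w. \<integral>w'. f (U w, V w') \<partial>M \<partial>M)"
    by (intro Bochner_Integration.integral_cong) (auto simp: inner)
  finally show "(\<integral>w. \<integral>w'. f (U w, V w') \<partial>M \<partial>M) = (\<integral>w. f (U w, V w) \<partial>M)" ..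
qed

text \<open>The freezing principle. A set of the generated algebra has an indicator that is a
  function of \<open>U\<close>, so multiplying \<open>f\<close> by it gives another function of the
  pair, to which the Fubini formula applies; this is the defining property of the conditional
  expectation.\<close>

lemma real_cond_exp_indep_rv:
  fixes f :: "'b \<times> 'c \<Rightarrow> real"
  assumes ind: "indep_rv S U T V" and f [measurable]: "f \<in> borel_measurable (S \<Otimes>\<^sub>M T)"
    and int: "integrable M (\<lambda>w. f (U w, V w))"
  shows "AE w in M. real_cond_exp M (vimage_algebra (space M) U S) (\<lambda>w. f (U w, V w)) w
           = (\<integral>w'. f (U w, V w') \<partial>M)"
proof -
  note [measurable] = indep_rv_measurable[OF ind]
  let ?F = "vimage_algebra (space M) U S"
  have UF [measurable]: "U \<in> measurable ?F S"
    by (rule measurable_vimage_algebra1) (use measurable_space[OF indep_rv_measurable(1)[OF ind]] in auto)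
  have sub: "subalgebra M ?F"
    unfolding subalgebra_def by (auto simp: sets_vimage_algebra2 measurable_space[OF indep_rv_measurable(1)[OF ind]])
  interpret finite_measure_subalgebra M ?F
    by unfold_locales (rule sub)
  interpret V: prob_space "distr M T V" by (rule prob_space_distr) measurable
  have "(\<lambda>w. \<integral>v. f (U w, v) \<partial>distr M T V) \<in> borel_measurable ?F"
    by (rule V.borel_measurable_lebesgue_integral) (simp add: split_def)
  moreover have "(\<integral>v. f (U w, v) \<partial>distr M T V) = (\<integral>w'. f (U w, V w') \<partial>M)" if "w \<in> space M" for w
    using measurable_space[OF indep_rv_measurable(1)[OF ind] that]
    by (subst integral_distr) (auto intro!: measurable_Pair2[of f])
  ultimately have meas: "(\<lambda>w. \<integral>w'. f (U w, V w') \<partial>M) \<in> borel_measurable ?F"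
    by (subst measurable_cong[where g = "\<lambda>w. \<integral>v. f (U w, v) \<partial>distr M T V"]) auto
  show ?thesis
  proof (rule real_cond_exp_charact[OF _ int integrable_indep_rv[OF ind f int] meas])
    fix A assume "A \<in> sets ?F"
    then obtain B where B [measurable]: "B \<in> sets S" and A: "A = U -` B \<inter> space M"
      by (subst (asm) sets_vimage_algebra2) (auto simp: measurable_space[OF indep_rv_measurable(1)[OF ind]])
    let ?g = "\<lambda>z. indicator B (fst z) * f z"
    have Am: "A \<in> sets M" unfolding A by measurable
    have ind_eq: "indicator A w = (indicator B (U w) :: real)" if "w \<in> space M" for w
      using that by (auto simp: A indicator_def)
    have "integrable M (\<lambda>w. indicator A w * f (U w, V w))"
      using integrable_mult_indicator[OF Am int] by simp
    then have "integrable M (\<lambda>w. ?g (U w, V w))"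
      by (rule Bochner_Integration.integrable_cong[THEN iffD1, rotated -1]) (auto simp: ind_eq)
    from integral_indep_rv[OF ind _ this]
    have "(\<integral>w. \<integral>w'. ?g (U w, V w') \<partial>M \<partial>M) = (\<integral>w. ?g (U w, V w) \<partial>M)" by simp
    then show "(\<integral>w\<in>A. f (U w, V w) \<partial>M) = (\<integral>w\<in>A. (\<integral>w'. f (U w, V w') \<partial>M) \<partial>M)"
      unfolding set_lebesgue_integral_def
      by (simp add: ind_eq cong: Bochner_Integration.integral_cong)
  qed
qed

lemma nn_integral_mult_indep_rv:
  assumes ind: "indep_rv S U T V"
    and [measurable]: "f \<in> borel_measurable S" "g \<in> borel_measurable T"
  shows "(\<integral>\<^sup>+w. f (U w) * g (V w) \<partial>M) = (\<integral>\<^sup>+w. f (U w) \<partial>M) * (\<integral>\<^sup>+w. g (V w) \<partial>M)"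
proof -
  note [measurable] = indep_rv_measurable[OF ind]
  have "(\<integral>\<^sup>+w. f (U w) * g (V w) \<partial>M) = (\<integral>\<^sup>+w. \<integral>\<^sup>+w'. f (U w) * g (V w') \<partial>M \<partial>M)"
    using nn_integral_indep_rv[OF ind, of "\<lambda>z. f (fst z) * g (snd z)"] by simp
  then show ?thesis by (simp add: nn_integral_cmult nn_integral_multc)
qed

lemma
  fixes f :: "'b \<Rightarrow> real" and g :: "'c \<Rightarrow> real"
  assumes ind: "indep_rv S U T V"
    and [measurable]: "f \<in> borel_measurable S" "g \<in> borel_measurable T"
    and int: "integrable M (\<lambda>w. f (U w))" "integrable M (\<lambda>w. g (V w))"
  shows integrable_mult_indep_rv: "integrable M (\<lambda>w. f (U w) * g (V w))"
    and integral_mult_indep_rv: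
      "(\<integral>w. f (U w) * g (V w) \<partial>M) = (\<integral>w. f (U w) \<partial>M) * (\<integral>w. g (V w) \<partial>M)"
proof -
  have "indep_rv borel (\<lambda>w. f (U w)) borel (\<lambda>w. g (V w))"
    by (rule indep_rv_compose[OF ind]) measurable
  then have "indep_var borel (\<lambda>w. f (U w)) borel (\<lambda>w. g (V w))"
    unfolding indep_var_distribution_eq using indep_rv_distr indep_rv_measurable by metis
  from indep_var_integrable[OF this int] indep_var_lebesgue_integral[OF this int]
  show "integrable M (\<lambda>w. f (U w) * g (V w))"
    "(\<integral>w. f (U w) * g (V w) \<partial>M) = (\<integral>w. f (U w) \<partial>M) * (\<integral>w. g (V w) \<partial>M)" by auto
qed

lemma distributed_normal_sum:
  fixes X :: "'i \<Rightarrow> 'a \<Rightarrow> real"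
  assumes I: "finite I" and ind: "indep_vars (\<lambda>_. borel) X I" and s: "s > 0"
    and X: "\<And>i. i \<in> I \<Longrightarrow> distributed M lborel (X i) (normal_density 0 s)"
    and c: "\<exists>i\<in>I. c i \<noteq> 0"
  shows "distributed M lborel (\<lambda>w. \<Sum>i\<in>I. c i * X i w) (normal_density 0 (s * sqrt (\<Sum>i\<in>I. (c i)\<^sup>2)))"
proof -
  \<comment> \<open>Zero coefficients are removed first, because a constant summand has no normal
    density of positive deviation.\<close>
  let ?J = "{i\<in>I. c i \<noteq> 0}"
  have "distributed M lborel (\<lambda>w. \<Sum>i\<in>?J. c i * X i w)
      (normal_density (\<Sum>i\<in>?J. 0) (sqrt (\<Sum>i\<in>?J. (s * \<bar>c i\<bar>)\<^sup>2)))"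
  proof (rule sum_indep_normal)
    show "indep_vars (\<lambda>i. borel) (\<lambda>i w. c i * X i w) ?J"
      by (rule indep_vars_compose2[OF indep_vars_subset[OF ind]]) auto
    show "distributed M lborel (\<lambda>w. c i * X i w) (normal_density 0 (s * \<bar>c i\<bar>))" if "i \<in> ?J" for i
      using normal_density_affine[OF X[of i] s, of "c i" 0] that by (simp add: mult.commute)
  qed (use I c s in auto)
  moreover have "(\<Sum>i\<in>?J. c i * X i w) = (\<Sum>i\<in>I. c i * X i w)" for w
    using I by (intro sum.mono_neutral_left) auto
  moreover have "sqrt (\<Sum>i\<in>?J. (s * \<bar>c i\<bar>)\<^sup>2) = s * sqrt (\<Sum>i\<in>I. (c i)\<^sup>2)"
  proof -
    have "(\<Sum>i\<in>?J. (s * \<bar>c i\<bar>)\<^sup>2) = (\<Sum>i\<in>I. (s * \<bar>c i\<bar>)\<^sup>2)"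
      using I by (intro sum.mono_neutral_left) auto
    also have "\<dots> = s\<^sup>2 * (\<Sum>i\<in>I. (c i)\<^sup>2)" by (simp add: power_mult_distrib sum_distrib_left)
    finally show ?thesis using s by (simp add: real_sqrt_mult)
  qed
  ultimately show ?thesis by simp
qed

subsection \<open>Standard Gaussian vectors\<close>

lemma std_gaussian_density_prod:
  fixes x :: "real ^ 'p"
  shows "std_gaussian_density x = (\<Prod>b\<in>Basis. std_normal_density (x \<bullet> b))"
proof -
  have "(\<Prod>b\<in>(Basis :: (real ^ 'p) set). std_normal_density (x \<bullet> b)) =
      (1 / sqrt (2 * pi)) ^ DIM(real ^ 'p) * exp (\<Sum>b\<in>Basis. - (x \<bullet> b)\<^sup>2 / 2)"
    by (simp add: std_normal_density_def prod_dividef exp_sum power_one_over)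
  also have "(\<Sum>b\<in>Basis. - (x \<bullet> b)\<^sup>2 / 2) = - (norm x)\<^sup>2 / 2"
    unfolding power2_norm_eq_inner
    by (subst euclidean_inner) (simp add: power2_eq_square sum_negf sum_divide_distrib)
  also have "(1 / sqrt (2 * pi)) ^ DIM(real ^ 'p) = (2 * pi) powr (- real DIM(real ^ 'p) / 2)"
    by (simp add: powr_realpow[symmetric] powr_minus_divide powr_half_sqrt[symmetric] powr_powr
        powr_divide del: DIM_cart)
  finally show ?thesis by (simp add: std_gaussian_density_def)
qed

lemma prob_gaussian_box:
  fixes U :: "'a \<Rightarrow> real ^ 'p"
  assumes U: "distributed M lborel U (\<lambda>x. ennreal (std_gaussian_density x))"
    and A: "\<And>j. A j \<in> sets borel"
  shows "emeasure M {w\<in>space M. \<forall>j. U w $ j \<in> A j} =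
    (\<Prod>j\<in>UNIV. \<integral>\<^sup>+t. ennreal (std_normal_density t) * indicator (A j) t \<partial>lborel)"
proof -
  \<comment> \<open>The box is re-indexed by basis vectors, over which the product formula for
    integrals on a Euclidean space ranges.\<close>
  define B where "B b = A (THE j. b = axis j 1)" for b :: "real ^ 'p"
  have [measurable]: "U \<in> borel_measurable M"
    using distributed_measurable[OF U] by simp
  have Bax: "B (axis j 1) = A j" for j
    by (simp add: B_def axis_eq_axis)
  have BM [measurable]: "B b \<in> sets borel" for b using A by (simp add: B_def)
  let ?Q = "{x :: real ^ 'p. \<forall>b\<in>Basis. x \<bullet> b \<in> B b}"
  have Q: "?Q \<in> sets borel"
  proof -
    have "?Q = (\<Inter>b\<in>Basis. (\<lambda>x. x \<bullet> b) -` B b)" by auto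
    also have "\<dots> \<in> sets borel"
    proof (intro sets.finite_INT)
      fix b :: "real ^ 'p"
      have "(\<lambda>x. x \<bullet> b) -` B b \<inter> space borel \<in> sets borel"
        by (rule measurable_sets[OF _ BM]) simp
      then show "(\<lambda>x. x \<bullet> b) -` B b \<in> sets borel" by simp
    qed auto
    finally show ?thesis .
  qed
  have iff: "x \<in> ?Q \<longleftrightarrow> (\<forall>j. x $ j \<in> A j)" for x
    by (auto simp: Basis_vec_def Bax inner_axis)
  have "{w\<in>space M. \<forall>j. U w $ j \<in> A j} = U -` ?Q \<inter> space M" using iff by auto
  then have "emeasure M {w\<in>space M. \<forall>j. U w $ j \<in> A j} = (\<integral>\<^sup>+x. ennreal (std_gaussian_density x) * indicator ?Q x \<partial>lborel)"
    using distributed_emeasure[OF U, of ?Q] Q by simp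
  also have "\<dots> = (\<integral>\<^sup>+x. (\<Prod>b\<in>Basis. ennreal (std_normal_density (x \<bullet> b)) * indicator (B b) (x \<bullet> b)) \<partial>lborel)"
  proof (intro nn_integral_cong)
    fix x :: "real ^ 'p"
    have "indicator ?Q x = (\<Prod>b\<in>Basis. indicator (B b) (x \<bullet> b) :: ennreal)"
      by (auto simp: indicator_def)
    then show "ennreal (std_gaussian_density x) * indicator ?Q x =
        (\<Prod>b\<in>Basis. ennreal (std_normal_density (x \<bullet> b)) * indicator (B b) (x \<bullet> b))"
      by (simp add: std_gaussian_density_prod prod.distrib prod_ennreal)
  qed
  also have "\<dots> = (\<Prod>b\<in>Basis. \<integral>\<^sup>+t. ennreal (std_normal_density t) * indicator (B b) t \<partial>lborel)"
    by (rule nn_integral_lborel_prod) measurable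
  also have "\<dots> = (\<Prod>j\<in>UNIV. \<integral>\<^sup>+t. ennreal (std_normal_density t) * indicator (A j) t \<partial>lborel)"
  proof -
    have "(Basis :: (real ^ 'p) set) = range (\<lambda>j. axis j 1)" by (auto simp: Basis_vec_def)
    moreover have "inj (\<lambda>j::'p. axis j (1::real))" by (auto intro!: injI simp: axis_eq_axis)
    ultimately show ?thesis
      by (intro prod.reindex_cong[of "\<lambda>j. axis j 1"]) (auto simp: Bax)
  qed
  finally show ?thesis .
qed

lemma
  fixes U :: "'a \<Rightarrow> real ^ 'p"
  assumes U: "distributed M lborel U (\<lambda>x. ennreal (std_gaussian_density x))"
  shows gaussian_component: "distributed M lborel (\<lambda>w. U w $ j) std_normal_density"
    and gaussian_components_indep: "indep_vars (\<lambda>_. borel) (\<lambda>j w. U w $ j) UNIV"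
proof -
  have [measurable]: "U \<in> borel_measurable M"
    using distributed_measurable[OF U] by simp
  have one: "(\<integral>\<^sup>+t. ennreal (std_normal_density t) \<partial>lborel) = 1"
    using prob_space.emeasure_space_1[OF prob_space_normal_density[of 1 0]] by (simp add: emeasure_density)
  have marg: "emeasure M {w\<in>space M. U w $ j \<in> C} =
      (\<integral>\<^sup>+t. ennreal (std_normal_density t) * indicator C t \<partial>lborel)"
    if C: "C \<in> sets borel" for j C
  proof -
    define A where "A i = (if i = j then C else UNIV)" for i
    have "{w\<in>space M. U w $ j \<in> C} = {w\<in>space M. \<forall>i. U w $ i \<in> A i}"
      by (auto simp: A_def)
    also have "emeasure M \<dots> = (\<Prod>i\<in>UNIV. \<integral>\<^sup>+t. ennreal (std_normal_density t) * indicator (A i) t \<partial>lborel)"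
      by (rule prob_gaussian_box[OF U]) (simp add: A_def C)
    also have "\<dots> = (\<Prod>i\<in>UNIV. if i = j then \<integral>\<^sup>+t. ennreal (std_normal_density t) * indicator C t \<partial>lborel else 1)"
      by (intro prod.cong refl) (simp add: A_def one)
    finally show ?thesis by simp
  qed
  show "distributed M lborel (\<lambda>w. U w $ j) std_normal_density"
    unfolding distributed_def
  proof (intro conjI measure_eqI)
    fix C assume "C \<in> sets (distr M lborel (\<lambda>w. U w $ j))"
    then have C: "C \<in> sets borel" by simp
    have "(\<lambda>w. U w $ j) -` C \<inter> space M = {w\<in>space M. U w $ j \<in> C}" by auto
    then show "emeasure (distr M lborel (\<lambda>w. U w $ j)) C = emeasure (density lborel std_normal_density) C"
      using C by (simp add: emeasure_distr emeasure_density marg)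
  qed auto
  show "indep_vars (\<lambda>_. borel) (\<lambda>j w. U w $ j) UNIV"
  \<comment> \<open>Goal 3 asks for a generator of the Borel sets, here all of them; goal 8 is the
    product rule, which is the box probability compared with its marginals.\<close>
  proof (subst indep_vars_finite[where E = "\<lambda>_. sets borel"], goal_cases)
    case 3 show ?case by (rule sets.sigma_sets_eq[symmetric])
  next
    case 8
    show ?case
    proof
      fix A :: "'p \<Rightarrow> real set" assume A: "A \<in> (\<Pi> i\<in>UNIV. sets borel)"
      have "(\<Inter>j\<in>UNIV. (\<lambda>w. U w $ j) -` A j \<inter> space M) = {w\<in>space M. \<forall>j. U w $ j \<in> A j}"
        by auto
      moreover have "(\<lambda>w. U w $ j) -` A j \<inter> space M = {w\<in>space M. U w $ j \<in> A j}" for j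
        by auto
      moreover have "emeasure M {w\<in>space M. \<forall>j. U w $ j \<in> A j} = (\<Prod>j\<in>UNIV. emeasure M {w\<in>space M. U w $ j \<in> A j})"
        using A by (subst prob_gaussian_box[OF U]) (auto simp: marg Pi_def)
      ultimately show "prob (\<Inter>j\<in>UNIV. (\<lambda>w. U w $ j) -` A j \<inter> space M) =
          (\<Prod>j\<in>UNIV. prob ((\<lambda>w. U w $ j) -` A j \<inter> space M))"
        by (simp add: emeasure_eq_measure prod_ennreal prod_nonneg)
    qed
  qed (auto simp: Int_stable_def)
qed

lemma gaussian_inner:
  fixes U :: "'a \<Rightarrow> real ^ 'p"
  assumes U: "distributed M lborel U (\<lambda>x. ennreal (std_gaussian_density x))" and v: "v \<noteq> 0"
  shows "distributed M lborel (\<lambda>w. U w \<bullet> v) (normal_density 0 (norm v))"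
proof -
  have "distributed M lborel (\<lambda>w. \<Sum>j\<in>UNIV. v $ j * U w $ j)
      (normal_density 0 (1 * sqrt (\<Sum>j\<in>UNIV. (v $ j)\<^sup>2)))"
    by (rule distributed_normal_sum[OF _ gaussian_components_indep[OF U] _ gaussian_component[OF U]])
      (use v in \<open>auto simp: vec_eq_iff\<close>)
  then show ?thesis by (simp add: inner_vec_def norm_vec_def L2_set_def mult.commute)
qed

end

subsection \<open>Measurability\<close>

lemma borel_measurable_vecI:
  fixes f :: "'a \<Rightarrow> real ^ 'n"
  assumes "\<And>j. (\<lambda>w. f w $ j) \<in> borel_measurable M"
  shows "f \<in> borel_measurable M"
  using assms by (subst borel_measurable_euclidean_space) (auto simp: Basis_vec_def inner_axis)

lemma borel_measurable_det:
  fixes A :: "'a \<Rightarrow> real ^ 'n ^ 'n"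
  assumes [measurable]: "\<And>j k. (\<lambda>w. A w $ j $ k) \<in> borel_measurable M"
  shows "(\<lambda>w. det (A w)) \<in> borel_measurable M"
  unfolding det_def by measurable

text \<open>Off the set of singular matrices Cramer's rule writes every coordinate as a quotient of
  determinants, which are polynomials in the entries. On the singular set \<open>matrix_inv\<close>
  is constant.\<close>

lemma borel_measurable_matrix_inv_mult:
  fixes A :: "'a \<Rightarrow> real ^ 'n ^ 'n" and b :: "'a \<Rightarrow> real ^ 'n"
  assumes A [measurable]: "\<And>j k. (\<lambda>w. A w $ j $ k) \<in> borel_measurable M"
    and b [measurable]: "b \<in> borel_measurable M"
  shows "(\<lambda>w. matrix_inv (A w) *v b w) \<in> borel_measurable M"
proof (rule borel_measurable_vecI)
  fix j
  let ?B = "\<lambda>w. \<chi> i k. if k = j then b w $ i else A w $ i $ k"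
  \<comment> \<open>At a singular matrix the predicate under the choice operator in
    \<open>matrix_inv\<close> is identically false, so all of them share this one value.\<close>
  define c :: "real ^ 'n ^ 'n" where "c = (SOME A'. False)"
  have [measurable]: "(\<lambda>w. det (A w)) \<in> borel_measurable M" "(\<lambda>w. det (?B w)) \<in> borel_measurable M"
    by (intro borel_measurable_det, simp)+
  have "(\<lambda>w. matrix_inv (A w) *v b w) = (\<lambda>w. if det (A w) = 0 then c *v b w
      else (\<chi> k. det (\<chi> i l. if l = k then b w $ i else A w $ i $ l) / det (A w)))"
  proof
    fix w
    show "matrix_inv (A w) *v b w = (if det (A w) = 0 then c *v b w
      else (\<chi> k. det (\<chi> i l. if l = k then b w $ i else A w $ i $ l) / det (A w)))"
    proof (cases "det (A w) = 0")
      case True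
      then have "\<not> (\<exists>A'. A w ** A' = mat 1 \<and> A' ** A w = mat 1)"
        using invertible_det_nz[of "A w"] by (simp add: invertible_def)
      then have "(\<lambda>A'. A w ** A' = mat 1 \<and> A' ** A w = mat 1) = (\<lambda>_. False)" by blast
      then have "matrix_inv (A w) = c" unfolding matrix_inv_def c_def by (rule arg_cong)
      then show ?thesis using True by simp
    next
      case False
      then have "A w *v (matrix_inv (A w) *v b w) = b w"
        by (intro matrix_inv_mult_vec) (simp add: invertible_det_nz)
      then show ?thesis using False cramer[of "A w"] by simp
    qed
  qed
  then have "(\<lambda>w. (matrix_inv (A w) *v b w) $ j) =
      (\<lambda>w. if det (A w) = 0 then (\<Sum>k\<in>UNIV. c $ j $ k * b w $ k) else det (?B w) / det (A w))"
    by (auto simp: fun_eq_iff matrix_vector_mult_def)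
  then show "(\<lambda>w. (matrix_inv (A w) *v b w) $ j) \<in> borel_measurable M"
    by simp
qed

lemma borel_measurable_gramx [measurable (raw)]:
  assumes [measurable]: "\<And>i. i \<in> S \<Longrightarrow> (\<lambda>w. x w i) \<in> borel_measurable M"
  shows "(\<lambda>w. gramx S (x w) $ j $ k) \<in> borel_measurable M"
  unfolding gramx_def by simp

lemma borel_measurable_olsx [measurable (raw)]:
  assumes [measurable]: "\<And>i. i \<in> S \<Longrightarrow> (\<lambda>w. x w i) \<in> borel_measurable M"
    "\<And>i. i \<in> S \<Longrightarrow> (\<lambda>w. y w i) \<in> borel_measurable M"
  shows "(\<lambda>w. olsx S (x w) (y w)) \<in> borel_measurable M"
  unfolding olsx_def by (intro borel_measurable_matrix_inv_mult) measurable

lemma borel_measurable_gcol [measurable (raw)]: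
  assumes [measurable]: "\<And>i. i \<in> S \<Longrightarrow> (\<lambda>w. x w i) \<in> borel_measurable M"
  shows "(\<lambda>w. gcol S (x w) j) \<in> borel_measurable M"
  unfolding gcol_def by (intro borel_measurable_matrix_inv_mult) measurable

lemma pred_well_conditioned [measurable (raw)]:
  fixes x :: "'w \<Rightarrow> 'i \<Rightarrow> real ^ 'p"
  assumes [measurable]: "\<And>i. i \<in> S \<Longrightarrow> (\<lambda>w. x w i) \<in> borel_measurable M"
  shows "Measurable.pred M (\<lambda>w. well_conditioned S (x w))"
  unfolding well_conditioned_def by measurable

lemma borel_measurable_cofactor_vec [measurable (raw)]:
  fixes A :: "'a \<Rightarrow> real ^ 'n ^ 'n"
  assumes [measurable]: "\<And>j k. (\<lambda>w. A w $ j $ k) \<in> borel_measurable M"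
  shows "(\<lambda>w. cofactor_vec i (A w)) \<in> borel_measurable M"
proof (rule borel_measurable_vecI)
  fix k
  have "(\<lambda>w. (\<chi> l. if l = i then axis k 1 else A w $ l) $ j $ m) \<in> borel_measurable M" for j m
    by (cases "j = i") auto
  then show "(\<lambda>w. cofactor_vec i (A w) $ k) \<in> borel_measurable M"
    by (simp add: cofactor_vec_def borel_measurable_det)
qed

lemma borel_measurable_inv_size [measurable (raw)]:
  fixes A :: "'a \<Rightarrow> real ^ 'n ^ 'n"
  assumes [measurable]: "\<And>j k. (\<lambda>w. A w $ j $ k) \<in> borel_measurable M"
  shows "(\<lambda>w. inv_size (A w)) \<in> borel_measurable M"
proof -
  have [measurable]: "(\<lambda>w. det (A w)) \<in> borel_measurable M" by (rule borel_measurable_det) simp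
  show ?thesis unfolding inv_size_def by measurable
qed

subsection \<open>Independence of covariates and noise\<close>

locale glm = gaussian_linear_model M X Y noise Z Zc \<beta> \<tau>
  for M :: "'w measure" and X :: "nat \<Rightarrow> 'w \<Rightarrow> real ^ 'p" and Y noise Z Zc \<beta> \<tau> +
  assumes tau_pos: "\<tau> > 0"
begin

definition point :: "nat option \<Rightarrow> 'w \<Rightarrow> (real ^ 'p) \<times> real" where
  "point = case_option Zc Z"

definition cov :: "nat option \<Rightarrow> 'w \<Rightarrow> real ^ 'p" where
  "cov i w = fst (point i w)"

text \<open>Recovered from the data point instead of taken from \<open>noise\<close>, since the copy
  \<open>Zc\<close> comes without a noise variable. For the original points it agrees with
  \<open>noise\<close> on the sample space.\<close>

definition res :: "nat option \<Rightarrow> 'w \<Rightarrow> real" where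
  "res i w = snd (point i w) - fst (point i w) \<bullet> \<beta>"

lemma point_eq: "point i w = (cov i w, cov i w \<bullet> \<beta> + res i w)"
  by (simp add: cov_def res_def)

lemma point_indep: "indep_vars (\<lambda>_. borel) point UNIV"
  using indep_all by (simp add: point_def)

lemma point_measurable [measurable]: "point i \<in> borel_measurable M"
  using point_indep by (auto simp: indep_vars_def)

lemma fst_snd_measurable [measurable]:
  "fst \<in> borel_measurable (borel :: ((real ^ 'p) \<times> real) measure)"
  "snd \<in> borel_measurable (borel :: ((real ^ 'p) \<times> real) measure)"
  by (intro borel_measurable_continuous_onI continuous_intros)+

lemma cov_measurable [measurable]: "cov i \<in> borel_measurable M"
  unfolding cov_def by measurable

lemma res_measurable [measurable]: "res i \<in> borel_measurable M"
  unfolding res_def by measurable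

lemma cov_Some: "cov (Some i) = X i"
  by (auto simp: cov_def point_def Z_eq)

lemma res_Some: "w \<in> space M \<Longrightarrow> res (Some i) w = noise i w"
  by (simp add: res_def point_def Z_eq Y_eq)

lemma distr_point_None:
  assumes [measurable]: "f \<in> measurable borel N"
  shows "distr M N (\<lambda>w. f (point None w)) = distr M N (\<lambda>w. f (point (Some 1) w))"
proof -
  have "distr M N (\<lambda>w. f (point None w)) = distr (distr M borel (point None)) N f"
    by (subst distr_distr) (auto simp: comp_def)
  also have "distr M borel (point None) = distr M borel (point (Some 1))"
    using copy_distr by (simp add: point_def)
  also have "distr \<dots> N f = distr M N (\<lambda>w. f (point (Some 1) w))"
    by (subst distr_distr) (auto simp: comp_def)
  finally show ?thesis .
qed

lemma cov_distributed: "distributed M lborel (cov i) (\<lambda>x. ennreal (std_gaussian_density x))"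
proof (cases i)
  case (Some k) then show ?thesis using X_distributed[of k] by (simp add: cov_Some)
next
  case None
  have "distr M lborel (cov None) = distr M lborel (cov (Some 1))"
    unfolding cov_def by (rule distr_point_None) (simp add: fst_snd_measurable)
  then show ?thesis using X_distributed[of 1] unfolding None
    by (simp add: distributed_def cov_Some)
qed

lemma res_distributed: "distributed M lborel (res i) (normal_density 0 \<tau>)"
proof -
  have Some: "distributed M lborel (res (Some k)) (normal_density 0 \<tau>)" for k
    using noise_distributed[of k] unfolding distributed_def
    by (simp add: res_Some cong: distr_cong measurable_cong)
  have "distr M lborel (res None) = distr M lborel (res (Some 1))"
    unfolding res_def by (rule distr_point_None) (subst measurable_cong_sets[OF refl sets_lborel], measurable)
  then show ?thesis using Some[of 1] Some by (cases i) (auto simp: distributed_def)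
qed

text \<open>The model grants this for the original points. For the copy it holds because it is a
  property of the law of the pair, which the copy shares with the first point.\<close>

lemma prob_cov_res:
  assumes [measurable]: "A \<in> sets borel" "B \<in> sets borel"
  shows "prob (cov i -` A \<inter> space M \<inter> (res i -` B \<inter> space M)) =
    prob (cov i -` A \<inter> space M) * prob (res i -` B \<inter> space M)"
proof -
  have Some: "prob (cov (Some k) -` A \<inter> space M \<inter> (res (Some k) -` B \<inter> space M)) =
    prob (cov (Some k) -` A \<inter> space M) * prob (res (Some k) -` B \<inter> space M)" for k
  proof -
    have "res (Some k) -` B \<inter> space M = noise k -` B \<inter> space M" by (auto simp: res_Some)
    then show ?thesis unfolding cov_Some
      using indep_setD[OF noise_indep, of "X k -` A \<inter> space M" k "noise k -` B \<inter> space M"]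
      by (auto simp: in_vimage_algebra)
  qed
  show ?thesis
  proof (cases i)
    case None
    have eq: "prob {w\<in>space M. P (point None w)} = prob {w\<in>space M. P (point (Some 1) w)}"
      if [measurable]: "Measurable.pred borel P" for P
    proof -
      have "prob {w\<in>space M. P (point k w)} = measure (distr M borel (\<lambda>w. point k w)) {z. P z}" for k
        by (subst measure_distr) (auto simp: vimage_def Int_def conj_commute)
      then show ?thesis using distr_point_None[of "\<lambda>z. z" borel] by simp
    qed
    have *: "cov k -` A \<inter> space M = {w\<in>space M. fst (point k w) \<in> A}"
      "res k -` B \<inter> space M = {w\<in>space M. snd (point k w) - fst (point k w) \<bullet> \<beta> \<in> B}" for k
      by (auto simp: cov_def res_def)
    have conj: "{w\<in>space M. P w} \<inter> {w\<in>space M. Q w} = {w\<in>space M. P w \<and> Q w}" for P Q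
      by auto
    show ?thesis using Some[of 1] unfolding None * conj
      by (subst (1 2 3) eq) auto
  qed (simp add: Some)
qed

text \<open>Padding with zeros puts covariates and residuals into one type, so that
  \<open>indep_vars\<close> can express the joint independence of all of them.\<close>

definition split_var :: "nat option \<times> bool \<Rightarrow> 'w \<Rightarrow> (real ^ 'p) \<times> real" where
  "split_var = (\<lambda>(i, b) w. if b then (cov i w, 0) else (0, res i w))"

text \<open>Independence across points and independence of the two parts within each point combine:
  events are grouped by point, factored over points first and then inside each point.\<close>

lemma split_var_indep: "indep_vars (\<lambda>_. borel) split_var UNIV"
  unfolding indep_vars_def2
proof (intro conjI ballI)
  show rv: "random_variable borel (split_var ib)" for ib
  proof -
    have "split_var ib = (\<lambda>w. (if snd ib then cov (fst ib) w else 0, if snd ib then 0 else res (fst ib) w))"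
      by (auto simp: split_var_def fun_eq_iff split: prod.split)
    also have "\<dots> \<in> borel_measurable M" by (intro borel_measurable_Pair) (cases "snd ib"; simp)+
    finally show ?thesis .
  qed
  show "indep_sets (\<lambda>i. {split_var i -` A \<inter> space M |A. A \<in> sets borel}) UNIV"
  proof (rule indep_setsI)
    show "{split_var i -` A \<inter> space M |A. A \<in> sets borel} \<subseteq> events" for i
      using measurable_sets[OF rv] by blast
    fix A and J :: "(nat option \<times> bool) set"
    assume J: "J \<noteq> {}" "finite J" and A: "\<forall>j\<in>J. A j \<in> {split_var j -` A \<inter> space M |A. A \<in> sets borel}"
    define K where "K = fst ` J"
    have K: "finite K" "K \<noteq> {}" using J by (auto simp: K_def)
    from A have "\<forall>j\<in>J. \<exists>C. C \<in> sets borel \<and> A j = split_var j -` C \<inter> space M" by blast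
    then obtain C where C: "\<And>j. j \<in> J \<Longrightarrow> C j \<in> sets borel"
      "\<And>j. j \<in> J \<Longrightarrow> A j = split_var j -` C j \<inter> space M"
      by metis
    \<comment> \<open>A part of a point that does not occur in \<open>J\<close> receives the trivial
      condition \<open>UNIV\<close>, so that every point in \<open>K\<close> has exactly two
      factors.\<close>
    define E where "E i = (if (i, True) \<in> J then (\<lambda>x. (x, 0)) -` C (i, True) else UNIV)" for i
    define F where "F i = (if (i, False) \<in> J then (\<lambda>e. (0, e)) -` C (i, False) else UNIV)" for i
    have emb: "(\<lambda>x::real ^ 'p. (x, 0::real)) \<in> borel_measurable borel"
      "(\<lambda>e. (0::real ^ 'p, e::real)) \<in> borel_measurable borel"
      by (intro borel_measurable_continuous_onI continuous_intros)+
    have EF [measurable]: "E i \<in> sets borel" "F i \<in> sets borel" for i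
      using measurable_sets[OF emb(1) C(1)[of "(i, True)"]] measurable_sets[OF emb(2) C(1)[of "(i, False)"]]
      by (simp_all add: E_def F_def)
    have AT: "A (i, True) = cov i -` E i \<inter> space M" if "(i, True) \<in> J" for i
      using C(2)[OF that] that by (auto simp: split_var_def E_def)
    have AF: "A (i, False) = res i -` F i \<inter> space M" if "(i, False) \<in> J" for i
      using C(2)[OF that] that by (auto simp: split_var_def F_def)
    let ?D = "\<lambda>i. cov i -` E i \<inter> space M \<inter> (res i -` F i \<inter> space M)"
    have "(\<Inter>j\<in>J. A j) = (\<Inter>i\<in>K. ?D i)"
    proof (rule set_eqI)
      fix w
      have "w \<in> (\<Inter>j\<in>J. A j) \<longleftrightarrow> (\<forall>i. ((i, True) \<in> J \<longrightarrow> w \<in> A (i, True)) \<and> ((i, False) \<in> J \<longrightarrow> w \<in> A (i, False)))"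
        by (auto simp: all_bool_eq) (metis (full_types) surj_pair)
      also have "\<dots> \<longleftrightarrow> (\<forall>i\<in>K. w \<in> ?D i)"
      proof (intro iffI allI ballI)
        fix i assume *: "\<forall>i. ((i, True) \<in> J \<longrightarrow> w \<in> A (i, True)) \<and> ((i, False) \<in> J \<longrightarrow> w \<in> A (i, False))"
          and i: "i \<in> K"
        have "w \<in> space M"
          using i * AT[of i] AF[of i] by (auto simp: K_def) (metis (full_types) IntD2)
        then show "w \<in> ?D i" using * AT[of i] AF[of i] by (auto simp: E_def F_def)
      next
        fix i assume *: "\<forall>i\<in>K. w \<in> ?D i"
        show "((i, True) \<in> J \<longrightarrow> w \<in> A (i, True)) \<and> ((i, False) \<in> J \<longrightarrow> w \<in> A (i, False))"
          using * AT[of i] AF[of i] by (auto simp: K_def image_iff)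
      qed
      finally show "w \<in> (\<Inter>j\<in>J. A j) \<longleftrightarrow> w \<in> (\<Inter>i\<in>K. ?D i)" by simp
    qed
    moreover have "prob (\<Inter>i\<in>K. ?D i) = (\<Prod>i\<in>K. prob (?D i))"
    proof (rule indep_setsD[OF _ _ K(2) K(1)])
      show "indep_sets (\<lambda>i. {point i -` A \<inter> space M |A. A \<in> sets borel}) UNIV"
        using point_indep by (simp add: indep_vars_def2)
      show "\<forall>i\<in>K. ?D i \<in> {point i -` A \<inter> space M |A. A \<in> sets borel}"
      proof
        fix i
        let ?S = "{z. fst z \<in> E i \<and> snd z - fst z \<bullet> \<beta> \<in> F i}"
        have "?D i = point i -` ?S \<inter> space M" by (auto simp: cov_def res_def)
        moreover have "?S \<in> sets borel" by measurable
        ultimately show "?D i \<in> {point i -` A \<inter> space M |A. A \<in> sets borel}" by blast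
      qed
    qed simp
    moreover have "(\<Prod>j\<in>J. prob (A j)) = (\<Prod>i\<in>K. prob (?D i))"
    proof -
      let ?g = "\<lambda>j. if snd j then prob (cov (fst j) -` E (fst j) \<inter> space M)
        else prob (res (fst j) -` F (fst j) \<inter> space M)"
      have "(\<Prod>j\<in>J. prob (A j)) = (\<Prod>j\<in>J. ?g j)"
        by (rule prod.cong) (auto simp: AT AF)
      \<comment> \<open>The factors added here belong to trivial conditions and equal 1.\<close>
      also have "\<dots> = (\<Prod>j\<in>K \<times> UNIV. ?g j)"
        using K by (intro prod.mono_neutral_left) (auto simp: K_def E_def F_def prob_space image_iff, force+)
      also have "\<dots> = (\<Prod>i\<in>K. \<Prod>b\<in>UNIV. ?g (i, b))"
        by (subst prod.cartesian_product) (auto intro!: prod.cong)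
      also have "\<dots> = (\<Prod>i\<in>K. prob (?D i))"
        by (intro prod.cong refl) (simp add: prob_cov_res UNIV_bool)
      finally show ?thesis .
    qed
    ultimately show "prob (\<Inter>j\<in>J. A j) = (\<Prod>j\<in>J. prob (A j))" by simp
  qed
qed

lemma cov_indep: "indep_vars (\<lambda>_. borel) cov UNIV"
  unfolding cov_def[abs_def] by (rule indep_vars_compose2[OF point_indep]) measurable

lemma res_indep: "indep_vars (\<lambda>_. borel) res UNIV"
  unfolding res_def[abs_def] by (rule indep_vars_compose2[OF point_indep]) measurable

lemma cov_res_indep:
  "indep_rv (PiM A (\<lambda>_. borel)) (\<lambda>w. \<lambda>i\<in>A. cov i w) (PiM B (\<lambda>_. borel)) (\<lambda>w. \<lambda>i\<in>B. res i w)"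
proof -
  have "indep_rv (PiM (A \<times> {True}) (\<lambda>_. borel)) (\<lambda>w. \<lambda>j\<in>A \<times> {True}. split_var j w)
      (PiM (B \<times> {False}) (\<lambda>_. borel)) (\<lambda>w. \<lambda>j\<in>B \<times> {False}. split_var j w)"
    by (rule indep_rv_restrict[OF split_var_indep]) auto
  then have "indep_rv (PiM A (\<lambda>_. borel)) (\<lambda>w. \<lambda>i\<in>A. fst ((\<lambda>j\<in>A \<times> {True}. split_var j w) (i, True)))
      (PiM B (\<lambda>_. borel)) (\<lambda>w. \<lambda>i\<in>B. snd ((\<lambda>j\<in>B \<times> {False}. split_var j w) (i, False)))"
    by (rule indep_rv_compose) measurable
  moreover have "(\<lambda>i\<in>A. fst ((\<lambda>j\<in>A \<times> {True}. split_var j w) (i, True))) = (\<lambda>i\<in>A. cov i w)" for w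
    by (auto simp: split_var_def)
  moreover have "(\<lambda>i\<in>B. snd ((\<lambda>j\<in>B \<times> {False}. split_var j w) (i, False))) = (\<lambda>i\<in>B. res i w)" for w
    by (auto simp: split_var_def)
  ultimately show ?thesis by simp
qed

lemma cov_res_single_indep: "indep_rv borel (cov i) borel (res i)"
  unfolding indep_rv_def using prob_cov_res by auto

end

section \<open>Moments of the least squares estimator\<close>

text \<open>The singularity of 1/|t| becomes integrable after the square root; each half of the
  interval contributes 2. At 0 the integrand is 0 because division by zero gives 0.\<close>

lemma nn_integral_sqrt_inverse_unit:
  "(\<integral>\<^sup>+t. ennreal (sqrt (1 / \<bar>t\<bar>)) * indicator {-1..1} t \<partial>lborel) \<le> 4"
proof -
  let ?h = "\<lambda>t::real. ennreal (t powr - (1/2)) * indicator {0..1} t"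
  have h: "(\<integral>\<^sup>+t. ?h t \<partial>lborel) = 2"
    using nn_integral_has_integral_lebesgue'[OF _ has_integral_powr_from_0[of "-1/2" 1]] by simp
  have hm: "(\<integral>\<^sup>+t. ?h (- t) \<partial>lborel) = 2"
    using nn_integral_real_affine[of ?h "-1" 0] h by simp
  have "(\<integral>\<^sup>+t. ennreal (sqrt (1 / \<bar>t\<bar>)) * indicator {-1..1} t \<partial>lborel) \<le>
      (\<integral>\<^sup>+t. ?h t + ?h (- t) \<partial>lborel)"
  proof (rule nn_integral_mono)
    fix t :: real
    have s: "sqrt (1 / u) = u powr - (1/2)" if "u > 0" for u :: real
      using that by (simp add: powr_minus_divide powr_half_sqrt real_sqrt_divide)
    consider "t = 0" | "t > 0" | "t < 0" by linarith
    then show "ennreal (sqrt (1 / \<bar>t\<bar>)) * indicator {-1..1} t \<le> ?h t + ?h (- t)"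
      using s[of t] s[of "- t"] by cases (auto simp: indicator_def)
  qed
  also have "\<dots> = 4" by (subst nn_integral_add) (simp_all add: h hm)
  finally show ?thesis .
qed

context prob_space
begin

lemma
  assumes N: "distributed M lborel N (normal_density 0 s)" and s: "s > 0"
  shows integrable_normal_power: "integrable M (\<lambda>w. N w ^ k)"
    and normal_expectation: "expectation N = 0"
    and normal_second_moment: "expectation (\<lambda>w. (N w)\<^sup>2) = s\<^sup>2"
proof -
  show "integrable M (\<lambda>w. N w ^ k)"
    using distributed_integrable[OF N, of "\<lambda>x. x ^ k"] integrable_normal_moment[OF s, of 0 k] by simp
  show "expectation N = 0"
    using distributed_integral[OF N, of "\<lambda>x. x"] normal_moment_odd[OF s, of 0 0]
    by (simp add: has_bochner_integral_iff)
  show "expectation (\<lambda>w. (N w)\<^sup>2) = s\<^sup>2"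
    using distributed_integral[OF N, of "\<lambda>x. x\<^sup>2"] normal_moment_even[OF s, of 0 1]
    by (simp add: has_bochner_integral_iff fact_2)
qed

text \<open>5 = 1 + 4: for |t| > 1 the integrand is at most the density, and for |t| at most 1 the
  density is at most 1.\<close>

lemma std_normal_sqrt_inverse:
  assumes N: "distributed M lborel N std_normal_density"
  shows "(\<integral>\<^sup>+w. ennreal (sqrt (1 / \<bar>N w\<bar>)) \<partial>M) \<le> 5"
proof -
  have one: "(\<integral>\<^sup>+t. ennreal (std_normal_density t) \<partial>lborel) = 1"
    using prob_space.emeasure_space_1[OF prob_space_normal_density[of 1 0]] by (simp add: emeasure_density)
  have le1: "std_normal_density t \<le> 1" for t
  proof -
    have "1 / sqrt (2 * pi) * exp (- t\<^sup>2 / 2) \<le> 1 * 1"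
      using pi_gt3 by (intro mult_mono) auto
    then show ?thesis by (simp add: std_normal_density_def)
  qed
  have "(\<integral>\<^sup>+w. ennreal (sqrt (1 / \<bar>N w\<bar>)) \<partial>M) =
      (\<integral>\<^sup>+t. ennreal (std_normal_density t) * ennreal (sqrt (1 / \<bar>t\<bar>)) \<partial>lborel)"
    by (rule distributed_nn_integral[OF N, symmetric]) simp
  also have "\<dots> \<le> (\<integral>\<^sup>+t. ennreal (std_normal_density t) + ennreal (sqrt (1 / \<bar>t\<bar>)) * indicator {-1..1} t \<partial>lborel)"
  proof (rule nn_integral_mono)
    fix t :: real
    show "ennreal (std_normal_density t) * ennreal (sqrt (1 / \<bar>t\<bar>)) \<le>
        ennreal (std_normal_density t) + ennreal (sqrt (1 / \<bar>t\<bar>)) * indicator {-1..1} t"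
    proof (cases "\<bar>t\<bar> \<le> 1")
      case True
      have "ennreal (std_normal_density t) * ennreal (sqrt (1 / \<bar>t\<bar>)) \<le> 1 * ennreal (sqrt (1 / \<bar>t\<bar>))"
        by (intro mult_right_mono) (use le1 in auto)
      then show ?thesis using True by (auto simp: indicator_def abs_le_iff intro: add_increasing)
    next
      case False
      then have "sqrt (1 / \<bar>t\<bar>) \<le> 1" by simp
      then have "ennreal (std_normal_density t) * ennreal (sqrt (1 / \<bar>t\<bar>)) \<le> ennreal (std_normal_density t) * 1"
        by (intro mult_left_mono) auto
      then show ?thesis by (auto intro: order_trans add_increasing2)
    qed
  qed
  also have "\<dots> \<le> 1 + 4"
    using add_left_mono[OF nn_integral_sqrt_inverse_unit, of 1] by (subst nn_integral_add) (simp_all add: one)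
  finally show ?thesis by simp
qed

lemma normal_nonzero:
  assumes N: "distributed M lborel N (normal_density 0 s)"
  shows "AE w in M. N w \<noteq> 0"
proof -
  have [measurable]: "N \<in> borel_measurable M" using distributed_measurable[OF N] by simp
  have "emeasure M (N -` {0} \<inter> space M) = (\<integral>\<^sup>+t. ennreal (normal_density 0 s t) * indicator {0} t \<partial>lborel)"
    by (rule distributed_emeasure[OF N]) simp
  also have "\<dots> = (\<integral>\<^sup>+(t::real). 0 \<partial>lborel)"
    by (intro nn_integral_cong_AE AE_I[of _ _ "{0}"]) (auto simp: indicator_def)
  finally have "emeasure M (N -` {0} \<inter> space M) = 0" by simp
  then show ?thesis
    by (intro AE_I[of _ _ "N -` {0} \<inter> space M"]) auto
qed

lemma indep_rv_pair:
  assumes "indep_vars (\<lambda>_. N) Z I" "i \<in> I" "l \<in> I" "i \<noteq> l"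
  shows "indep_rv N (Z i) N (Z l)"
proof -
  have "indep_rv (PiM {i} (\<lambda>_. N)) (\<lambda>w. \<lambda>i\<in>{i}. Z i w) (PiM {l} (\<lambda>_. N)) (\<lambda>w. \<lambda>i\<in>{l}. Z i w)"
    by (rule indep_rv_restrict[OF assms(1)]) (use assms in auto)
  then have "indep_rv N (\<lambda>w. (\<lambda>i\<in>{i}. Z i w) i) N (\<lambda>w. (\<lambda>i\<in>{l}. Z i w) l)"
    by (rule indep_rv_compose) measurable
  then show ?thesis by simp
qed

lemma indep_rv_restrict_single:
  assumes "indep_vars (\<lambda>_. N) Z I" "A \<subseteq> I" "i \<in> I" "i \<notin> A"
  shows "indep_rv (PiM A (\<lambda>_. N)) (\<lambda>w. \<lambda>l\<in>A. Z l w) N (Z i)"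
proof -
  have "indep_rv (PiM A (\<lambda>_. N)) (\<lambda>w. \<lambda>l\<in>A. Z l w) (PiM {i} (\<lambda>_. N)) (\<lambda>w. \<lambda>l\<in>{i}. Z l w)"
    by (rule indep_rv_restrict[OF assms(1)]) (use assms in auto)
  then have "indep_rv (PiM A (\<lambda>_. N)) (\<lambda>w. \<lambda>l\<in>A. Z l w) N (\<lambda>w. (\<lambda>l\<in>{i}. Z l w) i)"
    by (rule indep_rv_compose) measurable
  then show ?thesis by simp
qed

lemma expectation_square_sum:
  fixes V :: "'i \<Rightarrow> 'a \<Rightarrow> real"
  assumes "finite S" and int: "\<And>i l. i \<in> S \<Longrightarrow> l \<in> S \<Longrightarrow> integrable M (\<lambda>w. V i w * V l w)"
    and orth: "\<And>i l. i \<in> S \<Longrightarrow> l \<in> S \<Longrightarrow> i \<noteq> l \<Longrightarrow> expectation (\<lambda>w. V i w * V l w) = 0"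
  shows "integrable M (\<lambda>w. (\<Sum>i\<in>S. V i w)\<^sup>2)"
    and "expectation (\<lambda>w. (\<Sum>i\<in>S. V i w)\<^sup>2) = (\<Sum>i\<in>S. expectation (\<lambda>w. (V i w)\<^sup>2))"
proof -
  have eq: "(\<Sum>i\<in>S. V i w)\<^sup>2 = (\<Sum>i\<in>S. \<Sum>l\<in>S. V i w * V l w)" for w
    by (simp add: power2_eq_square sum_product)
  show "integrable M (\<lambda>w. (\<Sum>i\<in>S. V i w)\<^sup>2)"
    unfolding eq by (intro Bochner_Integration.integrable_sum int)
  have "expectation (\<lambda>w. (\<Sum>i\<in>S. V i w)\<^sup>2) = (\<Sum>i\<in>S. \<Sum>l\<in>S. expectation (\<lambda>w. V i w * V l w))"
    unfolding eq using int by (subst Bochner_Integration.integral_sum, force)+ (auto intro!: sum.cong Bochner_Integration.integral_sum)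
  also have "\<dots> = (\<Sum>i\<in>S. \<Sum>l\<in>S. if l = i then expectation (\<lambda>w. (V i w)\<^sup>2) else 0)"
    by (intro sum.cong refl) (auto simp: orth power2_eq_square)
  finally show "expectation (\<lambda>w. (\<Sum>i\<in>S. V i w)\<^sup>2) = (\<Sum>i\<in>S. expectation (\<lambda>w. (V i w)\<^sup>2))"
    using assms(1) by (simp add: sum.delta)
qed

end

context glm
begin

lemma res_power_integrable: "integrable M (\<lambda>w. res i w ^ k)"
  and res_expectation: "expectation (res i) = 0"
  and res_second_moment: "expectation (\<lambda>w. (res i w)\<^sup>2) = \<tau>\<^sup>2"
  using integrable_normal_power[OF res_distributed tau_pos]
    normal_expectation[OF res_distributed tau_pos] normal_second_moment[OF res_distributed tau_pos]
  by auto

lemma res_integrable: "integrable M (res i)"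
  using res_power_integrable[of i 1] by simp

lemma nn_integral_res_comb:
  assumes "finite S"
  shows "(\<integral>\<^sup>+w. ennreal ((\<Sum>i\<in>S. c i * res i w)\<^sup>2) \<partial>M) = ennreal (\<tau>\<^sup>2 * (\<Sum>i\<in>S. (c i)\<^sup>2))"
proof (cases "\<exists>i\<in>S. c i \<noteq> 0")
  case True
  then have pos: "(\<Sum>i\<in>S. (c i)\<^sup>2) > 0"
    using assms by (auto intro!: sum_pos2)
  note N = distributed_normal_sum[OF assms indep_vars_subset[OF res_indep subset_UNIV] tau_pos res_distributed True]
  have s: "\<tau> * sqrt (\<Sum>i\<in>S. (c i)\<^sup>2) > 0" using pos tau_pos by simp
  show ?thesis
    using integrable_normal_power[OF N s, of 2] normal_second_moment[OF N s] pos
    by (simp add: nn_integral_eq_integral power_mult_distrib)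
qed simp

lemma cov_component: "distributed M lborel (\<lambda>w. cov i w $ j) std_normal_density"
  by (rule gaussian_component[OF cov_distributed])

lemma cov_norm_power_integrable: "integrable M (\<lambda>w. norm (cov i w) ^ k)"
proof (rule Bochner_Integration.integrable_bound)
  let ?p = "real CARD('p)"
  show "integrable M (\<lambda>w. ?p ^ k * (\<Sum>j\<in>UNIV. 1 + (cov i w $ j) ^ (2 * k)))"
    by (intro integrable_mult_right Bochner_Integration.integrable_sum Bochner_Integration.integrable_add
        integrable_normal_power[OF cov_component]) auto
  show "AE w in M. norm (norm (cov i w) ^ k) \<le> norm (?p ^ k * (\<Sum>j\<in>UNIV. 1 + (cov i w $ j) ^ (2 * k)))"
  proof (rule AE_I2)
    fix w
    \<comment> \<open>The largest coordinate dominates the norm up to the factor p, and a^k is at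
      most 1 + a^(2k); this reduces the claim to even moments of one-dimensional Gaussians.\<close>
    obtain j where j: "\<And>l. \<bar>cov i w $ l\<bar> \<le> \<bar>cov i w $ j\<bar>"
    proof -
      have "Max (range (\<lambda>l. \<bar>cov i w $ l\<bar>)) \<in> range (\<lambda>l. \<bar>cov i w $ l\<bar>)" by (intro Max_in) auto
      then obtain j where "Max (range (\<lambda>l. \<bar>cov i w $ l\<bar>)) = \<bar>cov i w $ j\<bar>" by (rule rangeE)
      then have "\<bar>cov i w $ l\<bar> \<le> \<bar>cov i w $ j\<bar>" for l
        using Max_ge[of "range (\<lambda>l. \<bar>cov i w $ l\<bar>)" "\<bar>cov i w $ l\<bar>"] by auto
      then show ?thesis using that by blast
    qed
    have "norm (cov i w) \<le> (\<Sum>l\<in>UNIV. \<bar>cov i w $ l\<bar>)" by (rule norm_le_l1_cart)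
    also have "\<dots> \<le> (\<Sum>l\<in>(UNIV::'p set). \<bar>cov i w $ j\<bar>)" by (intro sum_mono j)
    finally have "norm (cov i w) ^ k \<le> (?p * \<bar>cov i w $ j\<bar>) ^ k" by (intro power_mono) auto
    also have "\<dots> \<le> ?p ^ k * (1 + (cov i w $ j) ^ (2 * k))"
    proof -
      have "0 \<le> (\<bar>cov i w $ j\<bar> ^ k - 1)\<^sup>2" by simp
      then have "2 * \<bar>cov i w $ j\<bar> ^ k \<le> 1 + (cov i w $ j) ^ (2 * k)"
        by (simp add: power2_diff power_mult[symmetric] mult.commute[of k 2] power_even_abs)
      then have "\<bar>cov i w $ j\<bar> ^ k \<le> 1 + (cov i w $ j) ^ (2 * k)"
        using zero_le_power[of "\<bar>cov i w $ j\<bar>" k] by linarith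
      then show ?thesis by (simp add: power_mult_distrib mult_left_mono)
    qed
    also have "\<dots> \<le> ?p ^ k * (\<Sum>l\<in>UNIV. 1 + (cov i w $ l) ^ (2 * k))"
    proof (intro mult_left_mono)
      show "1 + (cov i w $ j) ^ (2 * k) \<le> (\<Sum>l\<in>UNIV. 1 + (cov i w $ l) ^ (2 * k))"
        by (rule member_le_sum) (auto simp: power_mult)
    qed simp
    finally show "norm (norm (cov i w) ^ k) \<le> norm (?p ^ k * (\<Sum>j\<in>UNIV. 1 + (cov i w $ j) ^ (2 * k)))"
      by simp
  qed
qed measurable

lemma cov_product_integrable: "integrable M (\<lambda>w. cov i w $ j * cov i w $ k)"
proof (rule Bochner_Integration.integrable_bound[OF cov_norm_power_integrable[of i 2]])
  show "AE w in M. norm (cov i w $ j * cov i w $ k) \<le> norm ((norm (cov i w))\<^sup>2)"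
    by (auto simp: abs_mult power2_eq_square intro!: mult_mono component_le_norm_cart)
qed measurable

lemma cov_product_expectation:
  "expectation (\<lambda>w. cov i w $ j * cov i w $ k) = (if j = k then 1 else 0)"
proof (cases "j = k")
  case True
  then show ?thesis
    using normal_second_moment[OF cov_component[of i j]] by (simp add: power2_eq_square)
next
  case False
  have "expectation (\<lambda>w. cov i w $ j * cov i w $ k) =
      expectation (\<lambda>w. cov i w $ j) * expectation (\<lambda>w. cov i w $ k)"
    using integral_mult_indep_rv[OF indep_rv_pair[OF gaussian_components_indep[OF cov_distributed] UNIV_I UNIV_I False],
        of "\<lambda>x. x" "\<lambda>x. x"] integrable_normal_power[OF cov_component, where k = 1] by simp
  then show ?thesis using normal_expectation[OF cov_component] False by simp
qed

lemma cov_inner_second_moment: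
  "integrable M (\<lambda>w. (cov i w \<bullet> u)\<^sup>2)" "expectation (\<lambda>w. (cov i w \<bullet> u)\<^sup>2) = (norm u)\<^sup>2"
proof -
  have 1: "integrable M (\<lambda>w. (cov i w \<bullet> u)\<^sup>2) \<and> expectation (\<lambda>w. (cov i w \<bullet> u)\<^sup>2) = (norm u)\<^sup>2"
  proof (cases "u = 0")
    case False
    then show ?thesis
      using integrable_normal_power[OF gaussian_inner[OF cov_distributed False], where k = 2]
        normal_second_moment[OF gaussian_inner[OF cov_distributed False]] by simp
  qed simp
  then show "integrable M (\<lambda>w. (cov i w \<bullet> u)\<^sup>2)" "expectation (\<lambda>w. (cov i w \<bullet> u)\<^sup>2) = (norm u)\<^sup>2"
    by auto
qed

text \<open>The right side does not mention \<open>i\<close>, which yields moment constants uniform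
  over all points, the copy included.\<close>

lemma cov_norm_power_expectation:
  "expectation (\<lambda>w. norm (cov i w) ^ k) = (\<integral>x. std_gaussian_density x * norm (x :: real ^ 'p) ^ k \<partial>lborel)"
  by (rule distributed_integral[OF cov_distributed, symmetric]) (auto simp: std_gaussian_density_def)

text \<open>Chebyshev's inequality for each entry of the Gram matrix, whose centred summands are
  independent with bounded variance, followed by a union bound over the entries. The constant is
  uniform in \<open>S\<close>.\<close>

lemma prob_not_well_conditioned:
  "\<exists>K\<ge>0. \<forall>S. finite S \<longrightarrow> card S > 0 \<longrightarrow>
     prob {w\<in>space M. \<not> well_conditioned S (\<lambda>i. cov i w)} \<le> K / real (card S)"
proof -
  let ?p = "real CARD('p)"
  define m where "m = (\<integral>x. std_gaussian_density x * norm (x :: real ^ 'p) ^ 4 \<partial>lborel)"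
  define C where "C = 2 * m + 2"
  have m: "expectation (\<lambda>w. norm (cov i w) ^ 4) = m" for i
    by (simp add: m_def cov_norm_power_expectation)
  have "expectation (\<lambda>w. norm (cov None w) ^ 4) \<ge> 0" by simp
  then have "m \<ge> 0" by (simp only: m)
  then have C: "C \<ge> 0" by (simp add: C_def)
  define V where "V j k i w = cov i w $ j * cov i w $ k - (if j = k then 1 else 0)" for j k i w
  have V [measurable]: "V j k i \<in> borel_measurable M" for j k i unfolding V_def by measurable
  have V2le: "(V j k i w)\<^sup>2 \<le> 2 * norm (cov i w) ^ 4 + 2" for j k i w
  proof -
    let ?a = "cov i w $ j * cov i w $ k" and ?d = "if j = k then 1 else 0 :: real"
    have "(a - d)\<^sup>2 \<le> 2 * a\<^sup>2 + 2 * d\<^sup>2" for a d :: real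
      using zero_le_power2[of "a + d"] by (simp add: power2_sum power2_diff del: zero_le_power2)
    from this[of ?a ?d] have "(?a - ?d)\<^sup>2 \<le> 2 * ?a\<^sup>2 + 2 * ?d\<^sup>2" .
    moreover have "?a\<^sup>2 \<le> (norm (cov i w) * norm (cov i w))\<^sup>2"
      unfolding abs_le_square_iff[symmetric] abs_mult
      by (intro mult_mono) (auto simp: component_le_norm_cart)
    ultimately show ?thesis by (auto simp: V_def power4_eq_xxxx power2_eq_square mult_ac)
  qed
  have intC: "integrable M (\<lambda>w. 2 * norm (cov i w) ^ 4 + 2)" for i
    by (intro Bochner_Integration.integrable_add integrable_mult_right cov_norm_power_integrable) auto
  have V2i: "integrable M (\<lambda>w. (V j k i w)\<^sup>2)" for j k i
    by (rule Bochner_Integration.integrable_bound[OF intC[of i]]) (use V2le in \<open>auto intro: order_trans[OF _ abs_ge_self]\<close>)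
  have V2e: "expectation (\<lambda>w. (V j k i w)\<^sup>2) \<le> C" for j k i
  proof -
    have "expectation (\<lambda>w. (V j k i w)\<^sup>2) \<le> expectation (\<lambda>w. 2 * norm (cov i w) ^ 4 + 2)"
      by (intro integral_mono V2i intC V2le)
    also have "\<dots> = C" using cov_norm_power_integrable[of i 4] by (simp add: C_def m prob_space)
    finally show ?thesis .
  qed
  have Vi: "integrable M (V j k i)" and V0: "expectation (V j k i) = 0" for j k i
    using cov_product_integrable[of i j k] cov_product_expectation[of i j k]
    unfolding V_def by (auto simp: prob_space)
  have Vprod: "integrable M (\<lambda>w. V j k i w * V j k l w)"
    "i \<noteq> l \<Longrightarrow> expectation (\<lambda>w. V j k i w * V j k l w) = 0" for j k i l
  proof -
    define f where "f x = x $ j * x $ k - (if j = k then 1 else 0)" for x :: "real ^ 'p"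
    have f: "f \<in> borel_measurable borel" unfolding f_def by measurable
    have Vf: "V j k i = (\<lambda>w. f (cov i w))" for i by (simp add: V_def f_def fun_eq_iff)
    show "integrable M (\<lambda>w. V j k i w * V j k l w)"
    proof (cases "i = l")
      case True then show ?thesis using V2i[of j k i] by (simp add: power2_eq_square)
    next
      case False
      then show ?thesis using integrable_mult_indep_rv[OF indep_rv_pair[OF cov_indep UNIV_I UNIV_I False] f f]
          Vi[of j k] unfolding Vf by blast
    qed
    show "expectation (\<lambda>w. V j k i w * V j k l w) = 0" if "i \<noteq> l"
      using integral_mult_indep_rv[OF indep_rv_pair[OF cov_indep UNIV_I UNIV_I that] f f]
        Vi[of j k] V0[of j k] unfolding Vf by simp
  qed
  have entry: "prob {w\<in>space M. \<bar>\<Sum>i\<in>S. V j k i w\<bar> \<ge> real (card S) / (4 * ?p\<^sup>2)} \<le> C * (4 * ?p\<^sup>2)\<^sup>2 / real (card S)"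
    if S: "finite S" "card S > 0" for j k S
  proof -
    have "prob {w\<in>space M. \<bar>\<Sum>i\<in>S. V j k i w\<bar> \<ge> real (card S) / (4 * ?p\<^sup>2)}
        \<le> expectation (\<lambda>w. (\<Sum>i\<in>S. V j k i w)\<^sup>2) / (real (card S) / (4 * ?p\<^sup>2))\<^sup>2"
      by (rule second_moment_method) (use S expectation_square_sum(1)[OF S(1) Vprod] in auto)
    also have "expectation (\<lambda>w. (\<Sum>i\<in>S. V j k i w)\<^sup>2) = (\<Sum>i\<in>S. expectation (\<lambda>w. (V j k i w)\<^sup>2))"
      by (rule expectation_square_sum(2)[OF S(1) Vprod])
    also have "\<dots> / (real (card S) / (4 * ?p\<^sup>2))\<^sup>2 \<le> (real (card S) * C) / (real (card S) / (4 * ?p\<^sup>2))\<^sup>2"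
      by (intro divide_right_mono) (use sum_bounded_above[of S _ C] V2e in auto)
    also have "\<dots> = C * (4 * ?p\<^sup>2)\<^sup>2 / real (card S)"
      using S(2) by (simp add: power_divide power2_eq_square)
    finally show ?thesis .
  qed
  show ?thesis
  proof (intro exI conjI allI impI)
    show "0 \<le> ?p * (?p * (C * (4 * ?p\<^sup>2)\<^sup>2))" using C by simp
    fix S :: "nat option set" assume S: "finite S" "card S > 0"
    let ?E = "\<lambda>j k. {w\<in>space M. \<bar>\<Sum>i\<in>S. V j k i w\<bar> \<ge> real (card S) / (4 * ?p\<^sup>2)}"
    have "gramx S (\<lambda>i. cov i w) $ j $ k - (if j = k then real (card S) else 0) = (\<Sum>i\<in>S. V j k i w)" for j k w
      by (simp add: gramx_def V_def sum_subtractf)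
    then have "{w\<in>space M. \<not> well_conditioned S (\<lambda>i. cov i w)} \<subseteq> (\<Union>j. \<Union>k. ?E j k)"
      by (auto simp: well_conditioned_def not_le) (blast intro: less_imp_le)
    then have "prob {w\<in>space M. \<not> well_conditioned S (\<lambda>i. cov i w)} \<le> prob (\<Union>j. \<Union>k. ?E j k)"
      by (intro finite_measure_mono) measurable
    also have "\<dots> \<le> (\<Sum>j\<in>UNIV. prob (\<Union>k. ?E j k))"
      by (intro finite_measure_subadditive_finite) auto
    also have "\<dots> \<le> (\<Sum>j\<in>UNIV. \<Sum>k\<in>UNIV. prob (?E j k))"
      by (intro sum_mono finite_measure_subadditive_finite) auto
    also have "\<dots> \<le> (\<Sum>j\<in>(UNIV :: 'p set). \<Sum>k\<in>(UNIV :: 'p set). C * (4 * ?p\<^sup>2)\<^sup>2 / real (card S))"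
      by (intro sum_mono entry S)
    finally show "prob {w\<in>space M. \<not> well_conditioned S (\<lambda>i. cov i w)} \<le> ?p * (?p * (C * (4 * ?p\<^sup>2)\<^sup>2)) / real (card S)"
      by simp
  qed
qed

text \<open>The rows of the identity are replaced by Gaussian rows one at a time. The new
  determinant is the inner product of the new row with a cofactor vector independent of it. That
  vector is nonzero, since its coordinate \<open>i\<close> is the previous determinant, and a
  Gaussian vector avoids its orthogonal hyperplane almost surely.\<close>

lemma det_block_nonzero:
  fixes f :: "'p \<Rightarrow> nat option"
  assumes f: "inj f"
  shows "AE w in M. det (\<chi> l. cov (f l) w) \<noteq> 0"
proof -
  have "AE w in M. det (\<chi> l. if l \<in> R then cov (f l) w else axis l 1) \<noteq> 0" for R :: "'p set"
    using finite[of R]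
  proof (induction R rule: finite_induct)
    case empty
    have "(\<chi> l. axis l 1) = (mat 1 :: real ^ 'p ^ 'p)"
      by (auto simp: vec_eq_iff mat_def axis_def)
    then show ?case by simp
  next
    case (insert i R)
    define B :: "(nat option \<Rightarrow> real ^ 'p) \<Rightarrow> real ^ 'p ^ 'p"
      where "B g = (\<chi> l. if l \<in> R then g (f l) else axis l 1)" for g
    let ?P = "PiM (f ` R) (\<lambda>_. borel :: (real ^ 'p) measure)"
    let ?g = "\<lambda>w. \<lambda>i\<in>f ` R. cov i w"
    define c where "c g = cofactor_vec i (B g)" for g
    have ind: "indep_rv ?P ?g borel (cov (f i))"
      by (rule indep_rv_restrict_single[OF cov_indep]) (use insert f in \<open>auto dest: injD\<close>)
    have [measurable]: "(\<lambda>g. B g $ j $ k) \<in> borel_measurable ?P" for j k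
      by (cases "j \<in> R") (auto simp: B_def)
    have cm [measurable]: "c \<in> borel_measurable ?P" unfolding c_def by measurable
    have B1: "det (B (?g w)) = axis i 1 \<bullet> c (?g w)" for w
    proof -
      have "(\<chi> l. if l = i then axis i 1 else B (?g w) $ l) = B (?g w)"
        using insert by (simp add: vec_eq_iff B_def)
      then show ?thesis by (simp add: c_def inner_cofactor_vec)
    qed
    have B2: "det (\<chi> l. if l \<in> insert i R then cov (f l) w else axis l 1) = cov (f i) w \<bullet> c (?g w)" for w
    proof -
      have "(\<chi> l. if l = i then cov (f i) w else B (?g w) $ l) =
          (\<chi> l. if l \<in> insert i R then cov (f l) w else axis l 1)"
        using insert by (simp add: vec_eq_iff B_def)
      then show ?thesis by (simp add: c_def inner_cofactor_vec)
    qed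
    have "AE w in M. c (?g w) \<noteq> 0"
    proof -
      have "B (?g w) = (\<chi> l. if l \<in> R then cov (f l) w else axis l 1)" for w
        by (simp add: B_def vec_eq_iff)
      then show ?thesis using insert.IH B1 by (auto elim!: eventually_mono)
    qed
    moreover have "AE w in M. \<not> (c (?g w) \<noteq> 0 \<and> cov (f i) w \<bullet> c (?g w) = 0)"
    proof -
      let ?F = "\<lambda>z. indicator {z. c (fst z) \<noteq> 0 \<and> snd z \<bullet> c (fst z) = 0} z :: ennreal"
      have F: "?F \<in> borel_measurable (?P \<Otimes>\<^sub>M borel)" by measurable
      have gm [measurable]: "?g \<in> measurable M ?P" by measurable
      have "(\<integral>\<^sup>+w. ?F (?g w, cov (f i) w) \<partial>M) = (\<integral>\<^sup>+w. \<integral>\<^sup>+w'. ?F (?g w, cov (f i) w') \<partial>M \<partial>M)"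
        by (rule nn_integral_indep_rv[OF ind F])
      also have "\<dots> = (\<integral>\<^sup>+w. 0 \<partial>M)"
      proof (rule nn_integral_cong)
        fix w
        have "AE w' in M. \<not> (c (?g w) \<noteq> 0 \<and> cov (f i) w' \<bullet> c (?g w) = 0)"
        proof (cases "c (?g w) = 0")
          case False
          then show ?thesis using normal_nonzero[OF gaussian_inner[OF cov_distributed False]] by auto
        qed simp
        then have "(\<integral>\<^sup>+w'. ?F (?g w, cov (f i) w') \<partial>M) = (\<integral>\<^sup>+w'. 0 \<partial>M)"
          by (intro nn_integral_cong_AE) (auto elim!: eventually_mono simp: indicator_def)
        then show "(\<integral>\<^sup>+w'. ?F (?g w, cov (f i) w') \<partial>M) = 0" by simp
      qed
      finally have "(\<integral>\<^sup>+w. ?F (?g w, cov (f i) w) \<partial>M) = 0" by simp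
      moreover have "(\<lambda>w. ?F (?g w, cov (f i) w)) \<in> borel_measurable M"
        by (rule measurable_compose[OF _ F]) measurable
      ultimately have "AE w in M. ?F (?g w, cov (f i) w) = 0"
        by (simp only: nn_integral_0_iff_AE)
      then show ?thesis by (auto simp: indicator_def elim!: eventually_mono split: if_splits)
    qed
    ultimately show ?case unfolding B2 by eventually_elim auto
  qed
  from this[of UNIV] show ?thesis by simp
qed

text \<open>The square root is subadditive, so the columns of the inverse can be treated separately.
  In each quotient the row is independent of the cofactor vector; normalising the latter leaves
  1/|N| with N standard normal, whence 5 per column.\<close>

lemma nn_integral_sqrt_inv_size:
  fixes f :: "'p \<Rightarrow> nat option"
  assumes f: "inj f"
  shows "(\<integral>\<^sup>+w. ennreal (sqrt (inv_size (\<chi> l. cov (f l) w))) \<partial>M) \<le> ennreal (5 * real CARD('p))"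
proof -
  define A where "A w = (\<chi> l. cov (f l) w)" for w
  let ?q = "\<lambda>i w. sqrt (norm (cofactor_vec i (A w)) / \<bar>det (A w)\<bar>)"
  have sqrt_sum: "sqrt (\<Sum>i\<in>I. a i) \<le> (\<Sum>i\<in>I. sqrt (a i))" if "finite I" "\<And>i. a i \<ge> 0"
    for a :: "'p \<Rightarrow> real" and I
    using that(1)
  proof induction
    case (insert i I)
    have "sqrt (a i + sum a I) \<le> sqrt (a i) + sqrt (sum a I)"
      by (rule sqrt_add_le_add_sqrt) (use that(2) in \<open>auto intro: sum_nonneg\<close>)
    then show ?case using insert by simp
  qed simp
  have [measurable]: "(\<lambda>w. A w $ j $ k) \<in> borel_measurable M" for j k
    by (simp add: A_def)
  then have [measurable]: "(\<lambda>w. det (A w)) \<in> borel_measurable M"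
    by (rule borel_measurable_det)
  have [measurable]: "(\<lambda>w. ?q i w) \<in> borel_measurable M" for i
    by measurable
  have one: "(\<integral>\<^sup>+w. ennreal (?q i w) \<partial>M) \<le> 5" for i
  proof -
    let ?S = "f ` (UNIV - {i})"
    let ?P = "PiM ?S (\<lambda>_. borel :: (real ^ 'p) measure)"
    let ?g = "\<lambda>w. \<lambda>i\<in>?S. cov i w"
    \<comment> \<open>Row \<open>i\<close> is erased to exhibit the cofactor vector as a function of
      the remaining rows only.\<close>
    define B :: "(nat option \<Rightarrow> real ^ 'p) \<Rightarrow> real ^ 'p ^ 'p"
      where "B g = (\<chi> l. if l = i then 0 else g (f l))" for g
    define c where "c g = cofactor_vec i (B g)" for g
    have [measurable]: "(\<lambda>g. B g $ j $ k) \<in> borel_measurable ?P" for j k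
      by (cases "j = i") (auto simp: B_def)
    have [measurable]: "c \<in> borel_measurable ?P" unfolding c_def by measurable
    have ind: "indep_rv ?P ?g borel (cov (f i))"
      by (rule indep_rv_restrict_single[OF cov_indep]) (use f in \<open>auto dest: injD\<close>)
    have c: "cofactor_vec i (A w) = c (?g w)" for w
    proof -
      have "(\<chi> l. if l = i then axis k 1 else A w $ l) =
          (\<chi> l. if l = i then axis k 1 else B (?g w) $ l)" for k
        by (simp add: vec_eq_iff A_def B_def)
      then show ?thesis by (simp add: c_def cofactor_vec_def)
    qed
    have d: "det (A w) = cov (f i) w \<bullet> c (?g w)" for w
    proof -
      have "(\<chi> l. if l = i then cov (f i) w else A w $ l) = A w" by (simp add: vec_eq_iff A_def)
      then show ?thesis using inner_cofactor_vec[of "cov (f i) w" i "A w"] by (simp add: c)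
    qed
    have "(\<integral>\<^sup>+w. ennreal (?q i w) \<partial>M) =
        (\<integral>\<^sup>+w. \<integral>\<^sup>+w'. ennreal (sqrt (norm (c (?g w)) / \<bar>cov (f i) w' \<bullet> c (?g w)\<bar>)) \<partial>M \<partial>M)"
      unfolding c d
      using nn_integral_indep_rv[OF ind, of "\<lambda>z. ennreal (sqrt (norm (c (fst z)) / \<bar>snd z \<bullet> c (fst z)\<bar>))"]
      by simp
    also have "\<dots> \<le> (\<integral>\<^sup>+w. 5 \<partial>M)"
    proof (rule nn_integral_mono)
      fix w
      show "(\<integral>\<^sup>+w'. ennreal (sqrt (norm (c (?g w)) / \<bar>cov (f i) w' \<bullet> c (?g w)\<bar>)) \<partial>M) \<le> 5"
      proof (cases "c (?g w) = 0")
        case False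
        let ?v = "c (?g w) /\<^sub>R norm (c (?g w))"
        have "distributed M lborel (\<lambda>w'. cov (f i) w' \<bullet> ?v) (normal_density 0 (norm ?v))"
          by (rule gaussian_inner[OF cov_distributed]) (use False in simp)
        then have "distributed M lborel (\<lambda>w'. cov (f i) w' \<bullet> ?v) std_normal_density"
          using False by simp
        from std_normal_sqrt_inverse[OF this] show ?thesis
          using False by (simp add: abs_mult divide_simps)
      qed simp
    qed
    also have "\<dots> = 5" by (simp add: emeasure_space_1)
    finally show ?thesis .
  qed
  have "(\<integral>\<^sup>+w. ennreal (sqrt (inv_size (A w))) \<partial>M) \<le> (\<integral>\<^sup>+w. (\<Sum>i\<in>UNIV. ennreal (?q i w)) \<partial>M)"
  proof (rule nn_integral_mono)
    fix w
    have "sqrt (inv_size (A w)) \<le> (\<Sum>i\<in>UNIV. ?q i w)"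
      unfolding inv_size_def by (rule sqrt_sum) auto
    then show "ennreal (sqrt (inv_size (A w))) \<le> (\<Sum>i\<in>UNIV. ennreal (?q i w))"
      by (simp add: sum_ennreal ennreal_leI)
  qed
  also have "\<dots> = (\<Sum>i\<in>UNIV. \<integral>\<^sup>+w. ennreal (?q i w) \<partial>M)"
    by (rule nn_integral_sum) measurable
  also have "\<dots> \<le> (\<Sum>i\<in>(UNIV :: 'p set). 5)" by (intro sum_mono one)
  also have "\<dots> = ennreal (5 * real CARD('p))"
    by (simp add: ennreal_of_nat_eq_real_of_nat ennreal_mult' mult.commute)
  finally show ?thesis by (simp add: A_def)
qed

end

lemma ex_disjoint_blocks:
  "\<exists>f :: nat \<Rightarrow> 'p::finite \<Rightarrow> nat. (\<forall>k. inj (f k)) \<and> (\<forall>k<4. range (f k) \<subseteq> {1..4 * CARD('p)}) \<and>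
     (\<forall>k k'. k \<noteq> k' \<longrightarrow> range (f k) \<inter> range (f k') = {})"
proof -
  obtain h :: "'p \<Rightarrow> nat" where h: "bij_betw h UNIV {0..<CARD('p)}"
    using ex_bij_betw_finite_nat[of "UNIV :: 'p set"] by auto
  have hl: "h l < CARD('p)" for l using bij_betwE[OF h] by auto
  have hi: "inj h" using h by (simp add: bij_betw_def)
  let ?f = "\<lambda>k l. Suc (k * CARD('p) + h l)"
  have "k = k'" if "k * CARD('p) + h l = k' * CARD('p) + h l'" for k k' l l'
  proof -
    have "(k * CARD('p) + h l) div CARD('p) = k" "(k' * CARD('p) + h l') div CARD('p) = k'"
      using hl by (simp_all add: div_mult_self3)
    then show ?thesis using that by simp
  qed
  then have disj: "range (?f k) \<inter> range (?f k') = {}" if "k \<noteq> k'" for k k'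
    using that by auto
  have ran: "range (?f k) \<subseteq> {1..4 * CARD('p)}" if "k < 4" for k
  proof
    fix i assume "i \<in> range (?f k)"
    then obtain l where i: "i = ?f k l" by auto
    have "k * CARD('p) \<le> 3 * CARD('p)" using that by (intro mult_right_mono) auto
    then have "i \<le> 4 * CARD('p)" using hl[of l] i by linarith
    then show "i \<in> {1..4 * CARD('p)}" using i by simp
  qed
  have "inj (?f k)" for k using hi by (auto simp: inj_def)
  then show ?thesis using disj ran by (intro exI[of _ ?f]) blast
qed

section \<open>Mean square error of the least squares estimator\<close>

context glm
begin

text \<open>Allowing any set of indices covers the training set, the set without the first point,
  and the perturbed set, in which \<open>None\<close> takes the place of
  \<open>Some 1\<close>.\<close>

definition est :: "nat option set \<Rightarrow> 'w \<Rightarrow> real ^ 'p" where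
  "est S w = olsx S (\<lambda>i. cov i w) (\<lambda>i. snd (point i w))"

lemma est_measurable [measurable]: "est S \<in> borel_measurable M"
  unfolding est_def by measurable

text \<open>The first 4p points form the four blocks, and conditioning is tested on the tail. A
  well-conditioned tail gives the order 1/n at once. Otherwise the block bound \<open>P\<close>
  takes over; it is independent of the tail, so its finite expectation is multiplied by the O(1/n)
  probability of a bad tail.\<close>

lemma nn_integral_gcol:
  "\<exists>K n0. K \<ge> 0 \<and> (\<forall>n\<ge>n0. (AE w in M. invertible (gramx (Some ` {1..n}) (\<lambda>i. cov i w))) \<and>
     (\<forall>j. (\<integral>\<^sup>+w. ennreal (gcol (Some ` {1..n}) (\<lambda>i. cov i w) j $ j) \<partial>M) \<le> ennreal (K / real n)))"
proof -
  let ?p = "CARD('p)"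
  obtain f0 :: "nat \<Rightarrow> 'p \<Rightarrow> nat" where f0: "\<And>k. inj (f0 k)"
    "\<And>k. k < 4 \<Longrightarrow> range (f0 k) \<subseteq> {1..4 * ?p}" "\<And>k k'. k \<noteq> k' \<Longrightarrow> range (f0 k) \<inter> range (f0 k') = {}"
    using ex_disjoint_blocks[where 'p = 'p] by metis
  define f where "f k l = Some (f0 k l)" for k l
  have finj: "inj (f k)" for k using f0(1)[of k] by (auto simp: f_def inj_def)
  let ?U = "Some ` {1..4 * ?p}"
  have fran: "range (f k) \<subseteq> ?U" if "k < 4" for k using f0(2)[OF that] by (auto simp: f_def)
  obtain K where K: "K \<ge> 0" "\<And>S. finite S \<Longrightarrow> card S > 0 \<Longrightarrow>
     prob {w\<in>space M. \<not> well_conditioned S (\<lambda>i. cov i w)} \<le> K / real (card S)"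
    using prob_not_well_conditioned by blast
  define P where "P g = (\<Prod>k<4. sqrt (inv_size (\<chi> l. g (f k l))))" for g :: "nat option \<Rightarrow> real ^ 'p"
  have Pnn: "P g \<ge> 0" for g by (simp add: P_def prod_nonneg inv_size_nonneg)
  let ?C = "(5 * real ?p) ^ 4"
  have [measurable]: "(\<lambda>w. inv_size (\<chi> l. cov (f k l) w)) \<in> borel_measurable M" for k
    by (rule borel_measurable_inv_size) simp
  have EP: "(\<integral>\<^sup>+w. ennreal (P (\<lambda>i. cov i w)) \<partial>M) \<le> ennreal ?C"
  proof -
    let ?s = "\<lambda>k w. ennreal (sqrt (inv_size (\<chi> l. cov (f k l) w)))"
    have "indep_vars (\<lambda>k. PiM (range (f k)) (\<lambda>_. borel)) (\<lambda>k w. \<lambda>i\<in>range (f k). cov i w) {..<4}"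
      by (rule indep_vars_restrict[OF cov_indep])
        (use f0(3) in \<open>auto simp: disjoint_family_on_def f_def\<close>)
    then have "indep_vars (\<lambda>_. borel)
        (\<lambda>k w. ennreal (sqrt (inv_size (\<chi> l. (\<lambda>i\<in>range (f k). cov i w) (f k l))))) {..<4}"
      by (rule indep_vars_compose2) (intro measurable_compose[OF borel_measurable_inv_size], simp_all)
    then have ind: "indep_vars (\<lambda>_. borel) ?s {..<4}" by simp
    have "(\<integral>\<^sup>+w. ennreal (P (\<lambda>i. cov i w)) \<partial>M) = (\<integral>\<^sup>+w. (\<Prod>k<4. ?s k w) \<partial>M)"
      by (simp add: P_def prod_ennreal inv_size_nonneg)
    also have "\<dots> = (\<Prod>k<4. \<integral>\<^sup>+w. ?s k w \<partial>M)"
      by (rule indep_vars_nn_integral[OF _ ind]) auto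
    also have "\<dots> \<le> (\<Prod>k<(4::nat). ennreal (5 * real ?p))"
    proof -
      have "(\<Prod>k<m. \<integral>\<^sup>+w. ?s k w \<partial>M) \<le> (\<Prod>k<m. ennreal (5 * real ?p))" for m :: nat
        by (induction m) (simp_all add: mult_mono nn_integral_sqrt_inv_size finj del: prod_constant)
      then show ?thesis .
    qed
    also have "\<dots> = ennreal ?C" by (simp add: ennreal_power)
    finally show ?thesis .
  qed
  have "AE w in M. \<forall>k\<in>{..<4}. det (\<chi> l. cov (f k l) w) \<noteq> 0"
    by (intro AE_finite_allI det_block_nonzero finj) auto
  then have det: "AE w in M. \<forall>k<4. det (\<chi> l. cov (f k l) w) \<noteq> 0"
    by eventually_elim auto
  show ?thesis
  proof (intro exI conjI allI impI)
    show "0 \<le> 2 * (?C * K + 4 / 3)" using K(1) by simp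
    \<comment> \<open>With 8p points at least half of them lie in the tail, so bounds in the size of
      the tail become bounds in \<open>n\<close> at the price of a factor 2.\<close>
    fix n assume n: "n \<ge> 8 * ?p"
    let ?S = "Some ` {1..n}" and ?T = "Some ` {4 * ?p + 1..n}"
    have p0: "?p > 0" by simp
    have cT: "card ?T = n - 4 * ?p" by (simp add: card_image)
    then have cT0: "card ?T > 0" using n p0 by linarith
    have fS: "range (f k) \<subseteq> ?S" if "k < 4" for k using fran[OF that] n by fastforce
    show "AE w in M. invertible (gramx ?S (\<lambda>i. cov i w))"
      using det
    proof eventually_elim
      case (elim w)
      show ?case
        by (rule invertible_gramx_block[of ?S "f 0"]) (use elim fS[of 0] in auto)
    qed
    fix j
    let ?bad = "\<lambda>g. indicator {g. \<not> well_conditioned ?T g} g :: ennreal"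
    have wcm: "Measurable.pred M (\<lambda>w. well_conditioned ?T (\<lambda>i. cov i w))" by measurable
    have "AE w in M. ennreal (gcol ?S (\<lambda>i. cov i w) j $ j) \<le>
        ennreal (P (\<lambda>i. cov i w)) * ?bad (\<lambda>i. cov i w) + ennreal (4 / (3 * real (card ?T)))"
      using det
    proof eventually_elim
      case (elim w)
      show ?case
      proof (cases "well_conditioned ?T (\<lambda>i. cov i w)")
        case True
        have "gcol ?S (\<lambda>i. cov i w) j $ j \<le> 4 / (3 * real (card ?T))"
          by (rule gcol_le_subset[OF True cT0]) auto
        then show ?thesis using True by (simp add: ennreal_leI)
      next
        case False
        have "gcol ?S (\<lambda>i. cov i w) j $ j \<le> P (\<lambda>i. cov i w)"
          unfolding P_def by (rule gcol_le_prod_blocks) (use elim fS finj in auto)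
        then show ?thesis using False by (auto intro: add_increasing2 ennreal_leI)
      qed
    qed
    then have "(\<integral>\<^sup>+w. ennreal (gcol ?S (\<lambda>i. cov i w) j $ j) \<partial>M) \<le>
        (\<integral>\<^sup>+w. ennreal (P (\<lambda>i. cov i w)) * ?bad (\<lambda>i. cov i w) + ennreal (4 / (3 * real (card ?T))) \<partial>M)"
      by (rule nn_integral_mono_AE)
    also have "\<dots> = (\<integral>\<^sup>+w. ennreal (P (\<lambda>i. cov i w)) * ?bad (\<lambda>i. cov i w) \<partial>M) + ennreal (4 / (3 * real (card ?T)))"
    proof (subst nn_integral_add)
      show "(\<lambda>w. ennreal (P (\<lambda>i. cov i w)) * ?bad (\<lambda>i. cov i w)) \<in> borel_measurable M"
        unfolding P_def using wcm by measurable
    qed (simp_all add: emeasure_space_1)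
    also have "(\<integral>\<^sup>+w. ennreal (P (\<lambda>i. cov i w)) * ?bad (\<lambda>i. cov i w) \<partial>M) =
        (\<integral>\<^sup>+w. ennreal (P (\<lambda>i. cov i w)) \<partial>M) * (\<integral>\<^sup>+w. ?bad (\<lambda>i. cov i w) \<partial>M)"
    proof -
      let ?r = "\<lambda>A w. \<lambda>i\<in>A. cov i w"
      have ind: "indep_rv (PiM ?U (\<lambda>_. borel)) (?r ?U) (PiM ?T (\<lambda>_. borel)) (?r ?T)"
        by (rule indep_rv_restrict[OF cov_indep]) auto
      have P: "P (?r ?U w) = P (\<lambda>i. cov i w)" for w
      proof -
        have "(\<chi> l. ?r ?U w (f k l)) = (\<chi> l. cov (f k l) w)" if "k < 4" for k
          using fran[OF that] by (auto simp: vec_eq_iff)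
        then show ?thesis by (simp add: P_def)
      qed
      have wc: "well_conditioned ?T (?r ?T w) = well_conditioned ?T (\<lambda>i. cov i w)" for w
        by (simp add: well_conditioned_def gramx_def)
      have comp: "(\<lambda>g :: nat option \<Rightarrow> real ^ 'p. g (f k l)) \<in> borel_measurable (PiM ?U (\<lambda>_. borel))" if "k < 4" for k l
        using fran[OF that] by (intro measurable_component_singleton) auto
      have "(\<lambda>g. sqrt (inv_size (\<chi> l. g (f k l)))) \<in> borel_measurable (PiM ?U (\<lambda>_. borel :: (real ^ 'p) measure))"
        if "k < 4" for k
      proof (intro measurable_compose[OF borel_measurable_inv_size, of _ _ sqrt])
        fix i j
        show "(\<lambda>g. (\<chi> l. g (f k l)) $ i $ j) \<in> borel_measurable (PiM ?U (\<lambda>_. borel :: (real ^ 'p) measure))"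
          unfolding vec_lambda_beta by (rule borel_measurable_vec_nth[OF comp[OF that]])
      qed simp
      then have m1: "(\<lambda>g. ennreal (P g)) \<in> borel_measurable (PiM ?U (\<lambda>_. borel))"
        unfolding P_def by (intro measurable_compose[OF _ measurable_ennreal] borel_measurable_prod) auto
      have m2: "?bad \<in> borel_measurable (PiM ?T (\<lambda>_. borel))"
        by measurable
      show ?thesis
        using nn_integral_mult_indep_rv[OF ind m1 m2] by (simp only: P wc indicator_def mem_Collect_eq)
    qed
    also have "(\<integral>\<^sup>+w. ?bad (\<lambda>i. cov i w) \<partial>M) = emeasure M {w\<in>space M. \<not> well_conditioned ?T (\<lambda>i. cov i w)}"
    proof -
      have "(\<integral>\<^sup>+w. ?bad (\<lambda>i. cov i w) \<partial>M) =
          (\<integral>\<^sup>+w. indicator {w\<in>space M. \<not> well_conditioned ?T (\<lambda>i. cov i w)} w \<partial>M)"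
        by (intro nn_integral_cong) (auto simp: indicator_def)
      then show ?thesis using wcm by simp
    qed
    also have "(\<integral>\<^sup>+w. ennreal (P (\<lambda>i. cov i w)) \<partial>M) * \<dots> \<le> ennreal ?C * ennreal (K / real (card ?T))"
      by (intro mult_mono EP) (use K(2)[of ?T] cT0 in \<open>auto simp: emeasure_eq_measure intro!: ennreal_leI\<close>)
    also have "ennreal ?C * ennreal (K / real (card ?T)) + ennreal (4 / (3 * real (card ?T))) =
        ennreal ((?C * K + 4 / 3) / real (card ?T))"
      using K(1) cT0 by (simp add: ennreal_mult[symmetric] ennreal_plus[symmetric] add_divide_distrib del: ennreal_plus)
    also have "\<dots> \<le> ennreal (2 * (?C * K + 4 / 3) / real n)"
    proof (rule ennreal_leI)
      have "real n \<le> 2 * real (card ?T)" unfolding cT using n by linarith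
      moreover have "real n > 0" using n p0 by (simp only: of_nat_0_less_iff)
      ultimately have "(?C * K + 4 / 3) / real (card ?T) \<le> (?C * K + 4 / 3) / (real n / 2)"
        using K(1) by (intro divide_left_mono) auto
      then show "(?C * K + 4 / 3) / real (card ?T) \<le> 2 * (?C * K + 4 / 3) / real n"
        by (simp add: mult.commute)
    qed
    finally show "(\<integral>\<^sup>+w. ennreal (gcol ?S (\<lambda>i. cov i w) j $ j) \<partial>M) \<le> ennreal (2 * (?C * K + 4 / 3) / real n)"
      by (simp add: add_right_mono)
  qed
qed

text \<open>Conditioning on the design: the covariates stay at \<open>w\<close> while the residuals
  are drawn anew at \<open>w'\<close>. The test function may also depend on the design, so that an
  event about its conditioning can be included.\<close>

lemma est_decouple:
  fixes F :: "real ^ 'p \<Rightarrow> (nat option \<Rightarrow> real ^ 'p) \<Rightarrow> ennreal"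
  assumes S: "finite S"
    and F: "(\<lambda>z. F (fst z) (snd z)) \<in> borel_measurable (borel \<Otimes>\<^sub>M PiM S (\<lambda>_. borel))"
  shows "(\<integral>\<^sup>+w. F (est S w) (\<lambda>i\<in>S. cov i w) \<partial>M) =
    (\<integral>\<^sup>+w. \<integral>\<^sup>+w'. F (olsx S (\<lambda>i. cov i w) (\<lambda>i. cov i w \<bullet> \<beta> + res i w')) (\<lambda>i\<in>S. cov i w) \<partial>M \<partial>M)"
proof -
  let ?P = "PiM S (\<lambda>_. borel :: (real ^ 'p) measure)" and ?Q = "PiM S (\<lambda>_. borel :: real measure)"
  let ?x = "\<lambda>w. \<lambda>i\<in>S. cov i w" and ?e = "\<lambda>w. \<lambda>i\<in>S. res i w"
  let ?o = "\<lambda>z. olsx S (fst z) (\<lambda>i. fst z i \<bullet> \<beta> + snd z i)"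
  have o: "?o (?x w, ?e w') = olsx S (\<lambda>i. cov i w) (\<lambda>i. cov i w \<bullet> \<beta> + res i w')" for w w'
    by (simp add: olsx_def gramx_def)
  have "?o \<in> borel_measurable (?P \<Otimes>\<^sub>M ?Q)" by measurable
  then have meas: "(\<lambda>z. F (?o z) (fst z)) \<in> borel_measurable (?P \<Otimes>\<^sub>M ?Q)"
    using measurable_compose[of "\<lambda>z. (?o z, fst z)" "?P \<Otimes>\<^sub>M ?Q", OF _ F] by simp
  have "est S w = ?o (?x w, ?e w)" for w
    unfolding o by (simp add: est_def point_eq)
  then have "(\<integral>\<^sup>+w. F (est S w) (?x w) \<partial>M) = (\<integral>\<^sup>+w. F (?o (?x w, ?e w)) (fst (?x w, ?e w)) \<partial>M)" by simp
  also have "\<dots> = (\<integral>\<^sup>+w. \<integral>\<^sup>+w'. F (?o (?x w, ?e w')) (fst (?x w, ?e w')) \<partial>M \<partial>M)"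
    by (rule nn_integral_indep_rv[OF cov_res_indep meas])
  finally show ?thesis unfolding o by simp
qed

lemma nn_integral_est_error:
  assumes S: "finite S" and inv: "AE w in M. invertible (gramx S (\<lambda>i. cov i w))"
  shows "(\<integral>\<^sup>+w. ennreal ((est S w $ j - \<beta> $ j)\<^sup>2) \<partial>M) =
    ennreal (\<tau>\<^sup>2) * (\<integral>\<^sup>+w. ennreal (gcol S (\<lambda>i. cov i w) j $ j) \<partial>M)"
proof -
  have "(\<integral>\<^sup>+w. ennreal ((est S w $ j - \<beta> $ j)\<^sup>2) \<partial>M) =
    (\<integral>\<^sup>+w. \<integral>\<^sup>+w'. ennreal ((olsx S (\<lambda>i. cov i w) (\<lambda>i. cov i w \<bullet> \<beta> + res i w') $ j - \<beta> $ j)\<^sup>2) \<partial>M \<partial>M)"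
    by (rule est_decouple[OF S, of "\<lambda>t g. ennreal ((t $ j - \<beta> $ j)\<^sup>2)"]) measurable
  also have "\<dots> = (\<integral>\<^sup>+w. ennreal (\<tau>\<^sup>2) * ennreal (gcol S (\<lambda>i. cov i w) j $ j) \<partial>M)"
  proof (rule nn_integral_cong_AE, use inv in eventually_elim)
    case (elim w)
    let ?y = "gcol S (\<lambda>i. cov i w) j"
    have "olsx S (\<lambda>i. cov i w) (\<lambda>i. cov i w \<bullet> \<beta> + res i w') $ j - \<beta> $ j = (\<Sum>i\<in>S. (cov i w \<bullet> ?y) * res i w')" for w'
      by (subst olsx_linear_model[OF elim]) (auto simp: mult.commute)
    then show ?case
      by (simp add: nn_integral_res_comb[OF S] sum_gcol_square[OF elim] ennreal_mult')
  qed
  also have "\<dots> = ennreal (\<tau>\<^sup>2) * (\<integral>\<^sup>+w. ennreal (gcol S (\<lambda>i. cov i w) j $ j) \<partial>M)"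
    by (rule nn_integral_cmult) measurable
  finally show ?thesis .
qed

text \<open>Serves two purposes: the square integrability behind all conditional expectations, and
  the rate of consistency behind the variance limit.\<close>

lemma est_second_moment:
  "\<exists>K n0. K \<ge> 0 \<and> (\<forall>n\<ge>n0. (AE w in M. invertible (gramx (Some ` {1..n}) (\<lambda>i. cov i w))) \<and>
     (\<forall>j. integrable M (\<lambda>w. (est (Some ` {1..n}) w $ j - \<beta> $ j)\<^sup>2) \<and>
       expectation (\<lambda>w. (est (Some ` {1..n}) w $ j - \<beta> $ j)\<^sup>2) \<le> K / real n))"
proof -
  obtain K n0 where K: "K \<ge> 0" and inv: "\<And>n. n \<ge> n0 \<Longrightarrow> AE w in M. invertible (gramx (Some ` {1..n}) (\<lambda>i. cov i w))"
    and le: "\<And>n j. n \<ge> n0 \<Longrightarrow> (\<integral>\<^sup>+w. ennreal (gcol (Some ` {1..n}) (\<lambda>i. cov i w) j $ j) \<partial>M) \<le> ennreal (K / real n)"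
    using nn_integral_gcol by metis
  show ?thesis
  proof (intro exI conjI allI impI)
    show "0 \<le> \<tau>\<^sup>2 * K" using K by simp
    fix n j assume n: "n \<ge> n0"
    let ?f = "\<lambda>w. (est (Some ` {1..n}) w $ j - \<beta> $ j)\<^sup>2"
    show "AE w in M. invertible (gramx (Some ` {1..n}) (\<lambda>i. cov i w))" by (rule inv[OF n])
    have "(\<integral>\<^sup>+w. ennreal (?f w) \<partial>M) \<le> ennreal (\<tau>\<^sup>2) * ennreal (K / real n)"
      by (subst nn_integral_est_error[OF _ inv[OF n]]) (use le[OF n, of j] in \<open>auto intro: mult_left_mono\<close>)
    then have nn: "(\<integral>\<^sup>+w. ennreal (?f w) \<partial>M) \<le> ennreal (\<tau>\<^sup>2 * K / real n)"
      using K by (simp add: ennreal_mult'[symmetric])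
    show int: "integrable M ?f"
      using nn by (intro integrableI_bounded) (auto intro: le_less_trans)
    have "ennreal (expectation ?f) \<le> ennreal (\<tau>\<^sup>2 * K / real n)"
      using nn by (subst (asm) nn_integral_eq_integral[OF int]) auto
    then show "expectation ?f \<le> \<tau>\<^sup>2 * K / real n"
      using K by (subst (asm) ennreal_le_iff) auto
  qed
qed

end

section \<open>Soft thresholding and the loss difference\<close>

definition shrink :: "real \<Rightarrow> real \<Rightarrow> real" where
  "shrink c t = sgn t * max (\<bar>t\<bar> - c) 0"

definition shrink_vec :: "real \<Rightarrow> real ^ 'p \<Rightarrow> real ^ 'p" where
  "shrink_vec c t = (\<chi> j. shrink c (t $ j))"

lemma shrink_measurable [measurable]: "shrink c \<in> borel_measurable borel"
  unfolding shrink_def[abs_def] by measurable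

lemma shrink_vec_measurable [measurable]: "shrink_vec c \<in> borel_measurable (borel :: (real ^ 'p) measure)"
proof (rule borel_measurable_vecI)
  fix j
  have "(\<lambda>t :: real ^ 'p. shrink c (t $ j)) \<in> borel_measurable borel" by measurable
  then show "(\<lambda>t :: real ^ 'p. shrink_vec c t $ j) \<in> borel_measurable borel" by (simp add: shrink_vec_def)
qed

lemma soft_threshold_eq: "soft_threshold n l D = shrink_vec (l / real n) (ols n D)"
  by (simp add: soft_threshold_def shrink_vec_def shrink_def)

lemma shrink_minus: "shrink c (- t) = - shrink c t"
  by (simp add: shrink_def)

lemma abs_shrink_le: "c \<ge> 0 \<Longrightarrow> \<bar>shrink c t\<bar> \<le> \<bar>t\<bar>"
  by (auto simp: shrink_def abs_mult sgn_if)

lemma abs_shrink_diff_le: "c \<ge> 0 \<Longrightarrow> \<bar>shrink c t - t\<bar> \<le> c"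
  by (auto simp: shrink_def sgn_if max_def)

lemma abs_shrink_antimono: "c \<le> c' \<Longrightarrow> \<bar>shrink c' t\<bar> \<le> \<bar>shrink c t\<bar>"
  by (auto simp: shrink_def abs_mult sgn_if)

lemma abs_shrink_shrink_le: "c \<le> c' \<Longrightarrow> \<bar>shrink c' t - shrink c t\<bar> \<le> c' - c"
  by (auto simp: shrink_def sgn_if max_def)

lemma shrink_gap_large: "c \<le> c' \<Longrightarrow> c' \<le> \<bar>t\<bar> \<Longrightarrow> t \<noteq> 0 \<Longrightarrow> shrink c' t - shrink c t = - sgn t * (c' - c)"
  by (auto simp: shrink_def sgn_if max_def)

lemma shrink_gap_nonneg: "0 \<le> c \<Longrightarrow> c \<le> c' \<Longrightarrow> t \<le> c \<Longrightarrow> shrink c' t - shrink c t \<ge> 0"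
  by (auto simp: shrink_def sgn_if max_def)

lemma norm_shrink_vec_le:
  assumes "c \<ge> 0" shows "norm (shrink_vec c t) \<le> norm t"
  by (rule norm_le_componentwise_cart) (simp add: shrink_vec_def abs_shrink_le assms)

definition loss_gap :: "real ^ 'p \<Rightarrow> real ^ 'p \<Rightarrow> (real ^ 'p) \<times> real \<Rightarrow> real" where
  "loss_gap u v z = (snd z - fst z \<bullet> u)\<^sup>2 - (snd z - fst z \<bullet> v)\<^sup>2"

lemma h_diff_eq_loss_gap:
  "h_diff n l d z D =
     loss_gap (shrink_vec (l / real n) (ols n D)) (shrink_vec ((l + d) / real n) (ols n D)) z"
  by (simp add: h_diff_def loss_gap_def soft_threshold_eq)

lemma loss_gap_factor: "loss_gap u v z = (fst z \<bullet> (v - u)) * (2 * snd z - fst z \<bullet> (u + v))"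
  by (simp add: loss_gap_def power2_eq_square inner_diff_right inner_add_right algebra_simps)

text \<open>The factor \<open>norm (v - u)\<close> is kept apart because for two soft-thresholding
  estimates it is bounded by a constant. Hence a second moment of the estimator is enough to make
  the squared loss difference integrable.\<close>

lemma loss_gap_square_le:
  "(loss_gap u v z)\<^sup>2 \<le> (norm (v - u))\<^sup>2 *
     (8 * ((norm (fst z))\<^sup>2 * (snd z)\<^sup>2) + 2 * (norm (fst z) ^ 4 * (norm (u + v))\<^sup>2))"
proof -
  have CS: "(a \<bullet> b)\<^sup>2 \<le> (norm a)\<^sup>2 * (norm b)\<^sup>2" for a b :: "real ^ 'p"
    using Cauchy_Schwarz_ineq[of a b] by (simp add: power2_norm_eq_inner)
  have *: "(2 * y - s)\<^sup>2 \<le> 8 * y\<^sup>2 + 2 * s\<^sup>2" for y s :: real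
    using zero_le_power2[of "2 * y + s"] by (simp add: power2_eq_square algebra_simps)
  have "(loss_gap u v z)\<^sup>2 = (fst z \<bullet> (v - u))\<^sup>2 * (2 * snd z - fst z \<bullet> (u + v))\<^sup>2"
    by (simp add: loss_gap_factor power_mult_distrib)
  also have "\<dots> \<le> ((norm (fst z))\<^sup>2 * (norm (v - u))\<^sup>2) * (8 * (snd z)\<^sup>2 + 2 * ((norm (fst z))\<^sup>2 * (norm (u + v))\<^sup>2))"
    by (intro mult_mono CS order_trans[OF *] add_left_mono mult_left_mono) auto
  finally show ?thesis by (simp add: algebra_simps power4_eq_xxxx power2_eq_square)
qed

context glm
begin

lemma est_eq_restrict: "est S w = olsx S (\<lambda>i. fst ((\<lambda>i\<in>S. point i w) i)) (\<lambda>i. snd ((\<lambda>i\<in>S. point i w) i))"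
  by (simp add: est_def olsx_def gramx_def cov_def)

lemma points_fst_snd_measurable [measurable]:
  assumes "i \<in> S"
  shows "(\<lambda>g. fst (g i)) \<in> borel_measurable (PiM S (\<lambda>_. borel :: ((real ^ 'p) \<times> real) measure))"
    "(\<lambda>g. snd (g i)) \<in> borel_measurable (PiM S (\<lambda>_. borel :: ((real ^ 'p) \<times> real) measure))"
proof -
  have c: "(\<lambda>g. g i) \<in> measurable (PiM S (\<lambda>_. borel :: ((real ^ 'p) \<times> real) measure)) borel"
    by (rule measurable_component_singleton[OF assms])
  show "(\<lambda>g. fst (g i)) \<in> borel_measurable (PiM S (\<lambda>_. borel :: ((real ^ 'p) \<times> real) measure))"
    "(\<lambda>g. snd (g i)) \<in> borel_measurable (PiM S (\<lambda>_. borel :: ((real ^ 'p) \<times> real) measure))"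
    by (rule measurable_compose[OF c fst_snd_measurable(1)], rule measurable_compose[OF c fst_snd_measurable(2)])
qed

lemma olsx_points_measurable_subset:
  assumes "S \<subseteq> T"
  shows "(\<lambda>g. olsx S (\<lambda>i. fst (g i)) (\<lambda>i. snd (g i))) \<in>
    borel_measurable (PiM T (\<lambda>_. borel :: ((real ^ 'p) \<times> real) measure))"
proof -
  note [measurable] = points_fst_snd_measurable[OF subsetD[OF assms]]
  show ?thesis by measurable
qed

lemma olsx_points_measurable [measurable]:
  "(\<lambda>g :: 'i \<Rightarrow> (real ^ 'p) \<times> real. olsx S (\<lambda>i. fst (g i)) (\<lambda>i. snd (g i))) \<in> borel_measurable (PiM S (\<lambda>_. borel))"
  by (rule olsx_points_measurable_subset) simp

lemma point_est_indep:
  assumes "i \<notin> S"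
  shows "indep_rv borel (point i) borel (est S)"
proof -
  have "indep_rv (PiM S (\<lambda>_. borel)) (\<lambda>w. \<lambda>l\<in>S. point l w) borel (point i)"
    by (rule indep_rv_restrict_single[OF point_indep]) (use assms in auto)
  then have "indep_rv borel (est S) borel (point i)"
    unfolding est_eq_restrict[abs_def] by (rule indep_rv_compose) measurable
  then show ?thesis by (rule indep_rv_commute)
qed

lemma loss_gap_measurable [measurable (raw)]:
  assumes [measurable]: "u \<in> borel_measurable N" "v \<in> borel_measurable N" "z \<in> borel_measurable N"
  shows "(\<lambda>w. loss_gap (u w) (v w) (z w :: (real ^ 'p) \<times> real)) \<in> borel_measurable N"
proof -
  have [measurable]: "(\<lambda>w. fst (z w)) \<in> borel_measurable N" "(\<lambda>w. snd (z w)) \<in> borel_measurable N"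
    by (auto intro: measurable_compose[OF assms(3) fst_snd_measurable(1)] measurable_compose[OF assms(3) fst_snd_measurable(2)])
  show ?thesis unfolding loss_gap_def by measurable
qed

lemma cov_res_power_integrable: "integrable M (\<lambda>w. norm (cov i w) ^ k * (res i w)\<^sup>2)"
  using integrable_mult_indep_rv[OF cov_res_single_indep, of "\<lambda>x. norm x ^ k" "\<lambda>e. e\<^sup>2"]
    cov_norm_power_integrable[of i k] res_power_integrable[of i 2] by simp

lemma cov_snd_point_integrable: "integrable M (\<lambda>w. (norm (cov i w))\<^sup>2 * (snd (point i w))\<^sup>2)"
proof (rule Bochner_Integration.integrable_bound)
  show "integrable M (\<lambda>w. 2 * (norm \<beta>)\<^sup>2 * norm (cov i w) ^ 4 + 2 * (norm (cov i w) ^ 2 * (res i w)\<^sup>2))"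
    by (intro Bochner_Integration.integrable_add integrable_mult_right cov_norm_power_integrable cov_res_power_integrable)
  show "AE w in M. norm ((norm (cov i w))\<^sup>2 * (snd (point i w))\<^sup>2) \<le>
      norm (2 * (norm \<beta>)\<^sup>2 * norm (cov i w) ^ 4 + 2 * (norm (cov i w) ^ 2 * (res i w)\<^sup>2))"
  proof (rule AE_I2)
    fix w
    have "(cov i w \<bullet> \<beta> + res i w)\<^sup>2 \<le> 2 * (cov i w \<bullet> \<beta>)\<^sup>2 + 2 * (res i w)\<^sup>2"
      using zero_le_power2[of "cov i w \<bullet> \<beta> - res i w"] by (simp add: power2_sum power2_diff del: zero_le_power2)
    also have "(cov i w \<bullet> \<beta>)\<^sup>2 \<le> (norm (cov i w))\<^sup>2 * (norm \<beta>)\<^sup>2"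
      using Cauchy_Schwarz_ineq[of "cov i w" \<beta>] by (simp add: power2_norm_eq_inner)
    finally have "(norm (cov i w))\<^sup>2 * (snd (point i w))\<^sup>2 \<le>
        (norm (cov i w))\<^sup>2 * (2 * ((norm (cov i w))\<^sup>2 * (norm \<beta>)\<^sup>2) + 2 * (res i w)\<^sup>2)"
      by (intro mult_left_mono) (auto simp: point_eq)
    also have "\<dots> = 2 * (norm \<beta>)\<^sup>2 * norm (cov i w) ^ 4 + 2 * (norm (cov i w) ^ 2 * (res i w)\<^sup>2)"
      by (simp add: algebra_simps power4_eq_xxxx power2_eq_square)
    finally show "norm ((norm (cov i w))\<^sup>2 * (snd (point i w))\<^sup>2) \<le>
      norm (2 * (norm \<beta>)\<^sup>2 * norm (cov i w) ^ 4 + 2 * (norm (cov i w) ^ 2 * (res i w)\<^sup>2))"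
      by simp
  qed
qed measurable

lemma loss_gap_square_integrable:
  assumes iS: "i \<notin> S" and est2: "integrable M (\<lambda>w. (norm (est S w))\<^sup>2)"
    and s [measurable]: "s1 \<in> borel_measurable borel" "s2 \<in> borel_measurable borel"
    and D: "\<And>t. norm (s2 t - s1 t) \<le> D" and le: "\<And>t. norm (s1 t + s2 t) \<le> 2 * norm t"
  shows "integrable M (\<lambda>w. (loss_gap (s1 (est S w)) (s2 (est S w)) (point i w))\<^sup>2)"
proof (rule Bochner_Integration.integrable_bound)
  have ind: "indep_rv borel (point i) borel (est S)" by (rule point_est_indep[OF iS])
  have "integrable M (\<lambda>w. norm (fst (point i w)) ^ 4 * (norm (est S w))\<^sup>2)"
    using integrable_mult_indep_rv[OF ind, of "\<lambda>z. norm (fst z) ^ 4" "\<lambda>t. (norm t)\<^sup>2"]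
      cov_norm_power_integrable[of i 4] est2 by (simp add: cov_def)
  then have e2: "integrable M (\<lambda>w. norm (cov i w) ^ 4 * (norm (est S w))\<^sup>2)" by (simp add: cov_def)
  show "integrable M (\<lambda>w. D\<^sup>2 * (8 * ((norm (cov i w))\<^sup>2 * (snd (point i w))\<^sup>2) + 8 * (norm (cov i w) ^ 4 * (norm (est S w))\<^sup>2)))"
    by (intro Bochner_Integration.integrable_add integrable_mult_right e2 cov_snd_point_integrable)
  show "AE w in M. norm ((loss_gap (s1 (est S w)) (s2 (est S w)) (point i w))\<^sup>2) \<le>
      norm (D\<^sup>2 * (8 * ((norm (cov i w))\<^sup>2 * (snd (point i w))\<^sup>2) + 8 * (norm (cov i w) ^ 4 * (norm (est S w))\<^sup>2)))"
  proof (rule AE_I2)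
    fix w
    let ?t = "est S w"
    have "(loss_gap (s1 ?t) (s2 ?t) (point i w))\<^sup>2 \<le> (norm (s2 ?t - s1 ?t))\<^sup>2 *
     (8 * ((norm (cov i w))\<^sup>2 * (snd (point i w))\<^sup>2) + 2 * (norm (cov i w) ^ 4 * (norm (s1 ?t + s2 ?t))\<^sup>2))"
      using loss_gap_square_le[of "s1 ?t" "s2 ?t" "point i w"] by (simp add: cov_def)
    also have "\<dots> \<le> D\<^sup>2 *
     (8 * ((norm (cov i w))\<^sup>2 * (snd (point i w))\<^sup>2) + 2 * (norm (cov i w) ^ 4 * (2 * norm ?t)\<^sup>2))"
      by (rule mult_mono) (intro power_mono D add_left_mono mult_left_mono le | simp)+
    finally show "norm ((loss_gap (s1 ?t) (s2 ?t) (point i w))\<^sup>2) \<le>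
      norm (D\<^sup>2 * (8 * ((norm (cov i w))\<^sup>2 * (snd (point i w))\<^sup>2) + 8 * (norm (cov i w) ^ 4 * (norm (est S w))\<^sup>2)))"
      by (simp add: power_mult_distrib)
  qed
qed measurable

lemma loss_gap_point: "loss_gap u v (point i w) =
    2 * (cov i w \<bullet> \<beta>) * (cov i w \<bullet> (v - u)) + 2 * (res i w * (cov i w \<bullet> (v - u)))
      - ((cov i w \<bullet> v)\<^sup>2 - (cov i w \<bullet> u)\<^sup>2)"
  by (simp add: loss_gap_factor point_eq inner_diff_right inner_add_right power2_eq_square algebra_simps)

lemma cov_inner_product: "integrable M (\<lambda>w. (cov i w \<bullet> a) * (cov i w \<bullet> b))"
  "expectation (\<lambda>w. (cov i w \<bullet> a) * (cov i w \<bullet> b)) = a \<bullet> b"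
proof -
  have eq: "(cov i w \<bullet> a) * (cov i w \<bullet> b) = ((cov i w \<bullet> (a + b))\<^sup>2 - (cov i w \<bullet> (a - b))\<^sup>2) / 4" for w
    by (simp add: inner_add_right inner_diff_right power2_eq_square algebra_simps)
  show "integrable M (\<lambda>w. (cov i w \<bullet> a) * (cov i w \<bullet> b))"
    unfolding eq by (intro integrable_divide Bochner_Integration.integrable_diff cov_inner_second_moment)
  have "expectation (\<lambda>w. (cov i w \<bullet> a) * (cov i w \<bullet> b)) = ((norm (a + b))\<^sup>2 - (norm (a - b))\<^sup>2) / 4"
    unfolding eq by (simp add: cov_inner_second_moment)
  also have "\<dots> = a \<bullet> b"
    by (simp add: power2_norm_eq_inner inner_add_left inner_add_right inner_diff_left inner_diff_right inner_commute)
  finally show "expectation (\<lambda>w. (cov i w \<bullet> a) * (cov i w \<bullet> b)) = a \<bullet> b" .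
qed

lemma res_cov_product:
  assumes [measurable]: "q \<in> borel_measurable borel" and "integrable M (\<lambda>w. q (cov i w))"
  shows "integrable M (\<lambda>w. res i w * q (cov i w))" "expectation (\<lambda>w. res i w * q (cov i w)) = 0"
  using integrable_mult_indep_rv[OF cov_res_single_indep, of q "\<lambda>e. e" i]
    integral_mult_indep_rv[OF cov_res_single_indep, of q "\<lambda>e. e" i] assms res_integrable[of i] res_expectation[of i]
  by (auto simp: mult.commute)

lemma cov_inner_integrable: "integrable M (\<lambda>w. cov i w \<bullet> a)"
proof (rule Bochner_Integration.integrable_bound)
  show "integrable M (\<lambda>w. norm a * norm (cov i w) ^ 1)"
    by (intro integrable_mult_right cov_norm_power_integrable)
  show "AE w in M. norm (cov i w \<bullet> a) \<le> norm (norm a * norm (cov i w) ^ 1)"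
  proof (rule AE_I2)
    fix w show "norm (cov i w \<bullet> a) \<le> norm (norm a * norm (cov i w) ^ 1)"
      using Cauchy_Schwarz_ineq2[of "cov i w" a] by (simp add: mult.commute)
  qed
qed measurable

lemma expectation_loss_gap:
  "expectation (\<lambda>w. loss_gap u v (point i w)) = 2 * (\<beta> \<bullet> (v - u)) - ((norm v)\<^sup>2 - (norm u)\<^sup>2)"
proof -
  have r: "integrable M (\<lambda>w. res i w * (cov i w \<bullet> (v - u)))" "expectation (\<lambda>w. res i w * (cov i w \<bullet> (v - u))) = 0"
    using res_cov_product[of "\<lambda>x. x \<bullet> (v - u)" i] cov_inner_integrable[of i "v - u"] by auto
  show ?thesis
    unfolding loss_gap_point
    using r cov_inner_product[of i \<beta> "v - u"] cov_inner_second_moment[of i u] cov_inner_second_moment[of i v]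
    by (simp add: mult.assoc)
qed

end

lemma olsx_reindex:
  assumes "inj_on f S"
  shows "olsx (f ` S) x y = olsx S (\<lambda>i. x (f i)) (\<lambda>i. y (f i))"
  using assms by (simp add: olsx_def gramx_def sum.reindex)

lemma norm_shrink_vec_gap_le:
  fixes t :: "real ^ 'p"
  assumes "c \<le> c'"
  shows "norm (shrink_vec c' t - shrink_vec c t) \<le> real CARD('p) * (c' - c)"
proof -
  have "norm (shrink_vec c' t - shrink_vec c t) \<le> (\<Sum>j\<in>(UNIV :: 'p set). c' - c)"
    by (intro order_trans[OF norm_le_l1_cart] sum_mono) (simp add: shrink_vec_def abs_shrink_shrink_le assms)
  then show ?thesis by simp
qed

lemma norm_shrink_vec_sum_le:
  assumes "0 \<le> c" "0 \<le> c'"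
  shows "norm (shrink_vec c t + shrink_vec c' t) \<le> 2 * norm t"
  using norm_triangle_ineq[of "shrink_vec c t" "shrink_vec c' t"] norm_shrink_vec_le[OF assms(1), of t]
    norm_shrink_vec_le[OF assms(2), of t] by linarith

section \<open>Variances and first absolute moments\<close>

context prob_space
begin

text \<open>For fixed square integrable variables the variance is a polynomial in the coefficients,
  so convergence of the coefficients is all that has to be checked.\<close>

lemma variance_lincomb_tendsto:
  fixes R :: "'i \<Rightarrow> 'a \<Rightarrow> real" and c :: "nat \<Rightarrow> 'i \<Rightarrow> real"
  assumes I: "finite I" and meas [measurable]: "\<And>a. a \<in> I \<Longrightarrow> R a \<in> borel_measurable M"
    and int: "\<And>a. a \<in> I \<Longrightarrow> integrable M (\<lambda>w. (R a w)\<^sup>2)"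
    and c: "\<And>a. a \<in> I \<Longrightarrow> (\<lambda>n. c n a) \<longlonglongrightarrow> c0 a"
  shows "(\<lambda>n. variance (\<lambda>w. \<Sum>a\<in>I. c n a * R a w)) \<longlonglongrightarrow> variance (\<lambda>w. \<Sum>a\<in>I. c0 a * R a w)"
proof -
  have i2: "integrable M (\<lambda>w. R a w * R b w)" if ab: "a \<in> I" "b \<in> I" for a b
  proof (rule Bochner_Integration.integrable_bound)
    show "integrable M (\<lambda>w. (R a w)\<^sup>2 + (R b w)\<^sup>2)" using ab by (intro Bochner_Integration.integrable_add int)
    show "AE w in M. norm (R a w * R b w) \<le> norm ((R a w)\<^sup>2 + (R b w)\<^sup>2)"
    proof (rule AE_I2)
      fix w
      have "2 * (\<bar>R a w\<bar> * \<bar>R b w\<bar>) \<le> (R a w)\<^sup>2 + (R b w)\<^sup>2"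
        using zero_le_power2[of "\<bar>R a w\<bar> - \<bar>R b w\<bar>"] by (simp add: power2_diff del: zero_le_power2)
      moreover have "0 \<le> \<bar>R a w\<bar> * \<bar>R b w\<bar>" by simp
      ultimately show "norm (R a w * R b w) \<le> norm ((R a w)\<^sup>2 + (R b w)\<^sup>2)"
        unfolding real_norm_def abs_mult by linarith
    qed
  qed (use ab in measurable)
  have i1: "integrable M (R a)" if "a \<in> I" for a
    by (rule square_integrable_imp_integrable) (use that int meas in auto)
  have sq: "(\<Sum>a\<in>I. k a * R a w)\<^sup>2 = (\<Sum>a\<in>I. \<Sum>b\<in>I. (k a * k b) * (R a w * R b w))" for k w
    by (simp add: power2_eq_square sum_product mult_ac)
  have var: "variance (\<lambda>w. \<Sum>a\<in>I. k a * R a w) =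
      (\<Sum>a\<in>I. \<Sum>b\<in>I. k a * k b * expectation (\<lambda>w. R a w * R b w)) - (\<Sum>a\<in>I. k a * expectation (R a))\<^sup>2" for k
  proof -
    have "variance (\<lambda>w. \<Sum>a\<in>I. k a * R a w) =
        expectation (\<lambda>w. (\<Sum>a\<in>I. k a * R a w)\<^sup>2) - (expectation (\<lambda>w. \<Sum>a\<in>I. k a * R a w))\<^sup>2"
    proof (rule variance_eq)
      show "integrable M (\<lambda>w. \<Sum>a\<in>I. k a * R a w)" using i1 by simp
      show "integrable M (\<lambda>w. (\<Sum>a\<in>I. k a * R a w)\<^sup>2)" unfolding sq using i2 by simp
    qed
    also have E1: "expectation (\<lambda>w. \<Sum>a\<in>I. k a * R a w) = (\<Sum>a\<in>I. k a * expectation (R a))"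
      using i1 by (subst Bochner_Integration.integral_sum) auto
    also have "expectation (\<lambda>w. (\<Sum>a\<in>I. k a * R a w)\<^sup>2) =
        (\<Sum>a\<in>I. \<Sum>b\<in>I. k a * k b * expectation (\<lambda>w. R a w * R b w))"
      unfolding sq using i2
      by (subst Bochner_Integration.integral_sum) (auto intro!: sum.cong simp: Bochner_Integration.integral_sum)
    finally show ?thesis unfolding E1 .
  qed
  show ?thesis unfolding var by (intro tendsto_intros c)
qed

lemma variance_cmult:
  fixes f :: "'a \<Rightarrow> real"
  shows "variance (\<lambda>w. k * f w) = k\<^sup>2 * variance f"
proof -
  have "(k * f w - k * expectation f)\<^sup>2 = k\<^sup>2 * (f w - expectation f)\<^sup>2" for w
    by (simp add: right_diff_distrib[symmetric] power_mult_distrib)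
  then show ?thesis by simp
qed

lemma variance_cong_AE:
  fixes f g :: "'a \<Rightarrow> real"
  assumes [measurable]: "f \<in> borel_measurable M" "g \<in> borel_measurable M" and eq: "AE w in M. f w = g w"
  shows "variance f = variance g"
proof -
  have "expectation f = expectation g" by (rule integral_cong_AE) (use eq in auto)
  then show ?thesis by (intro integral_cong_AE) (use eq in \<open>auto elim: eventually_mono\<close>)
qed

text \<open>A second moment of order 1/a gives a first absolute moment of order 1/sqrt a. The
  pointwise inequality \<open>pt\<close>, from (sqrt a |x| - 1)^2 >= 0, balances the two
  scales.\<close>

lemma expectation_abs_le:
  assumes [measurable]: "f \<in> borel_measurable M" and f: "integrable M (\<lambda>w. (f w)\<^sup>2)"
    and le: "expectation (\<lambda>w. (f w)\<^sup>2) \<le> K / a" and a: "a > 0"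
  shows "integrable M f" "expectation (\<lambda>w. \<bar>f w\<bar>) \<le> (K + 1) / sqrt a"
proof -
  show i: "integrable M f" by (rule square_integrable_imp_integrable) (use f in auto)
  let ?s = "sqrt a"
  have s: "?s > 0" "?s * ?s = a" using a by auto
  have pt: "\<bar>x\<bar> \<le> 1 / ?s + ?s * x\<^sup>2" for x
  proof -
    have "0 \<le> (?s * \<bar>x\<bar> - 1)\<^sup>2" by simp
    also have "(?s * \<bar>x\<bar> - 1)\<^sup>2 = a * x\<^sup>2 - 2 * (?s * \<bar>x\<bar>) + 1"
      using a by (simp add: power2_diff power_mult_distrib)
    also have "a * x\<^sup>2 = ?s * (?s * x\<^sup>2)" by (simp only: s(2) mult.assoc[symmetric])
    finally have "?s * \<bar>x\<bar> \<le> ?s * (?s * x\<^sup>2) + 1"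
      using s(1) mult_nonneg_nonneg[of ?s "\<bar>x\<bar>"] by linarith
    also have "\<dots> = ?s * (1 / ?s + ?s * x\<^sup>2)" using s(1) by (simp add: algebra_simps)
    finally show ?thesis using s(1) by (rule mult_left_le_imp_le)
  qed
  have "expectation (\<lambda>w. \<bar>f w\<bar>) \<le> expectation (\<lambda>w. 1 / ?s + ?s * (f w)\<^sup>2)"
    using i f pt by (intro integral_mono) auto
  also have "\<dots> = 1 / ?s + ?s * expectation (\<lambda>w. (f w)\<^sup>2)"
    using f by (simp add: prob_space)
  also have "\<dots> \<le> 1 / ?s + ?s * (K / a)"
    using le s(1) by (intro add_left_mono mult_left_mono) auto
  also have "?s * (K / a) = K / ?s" using s a by (simp add: field_simps)
  finally show "expectation (\<lambda>w. \<bar>f w\<bar>) \<le> (K + 1) / sqrt a" by (simp add: add_divide_distrib)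
qed

end

section \<open>Conditional expectations of the loss difference\<close>

context glm
begin

lemma Z_eq_point: "Z = (\<lambda>i. point (Some i))"
  by (simp add: point_def)

lemma Z_copy_eq_point: "Z(1 := Zc) = (\<lambda>i. point (if i = 1 then None else Some i))"
  by (auto simp: point_def fun_eq_iff)

lemma ols_training_set:
  assumes "inj_on f {1..n}"
  shows "ols n (training_set n (\<lambda>i. point (f i)) w) = est (f ` {1..n}) w"
proof -
  have "ols n (training_set n (\<lambda>i. point (f i)) w) =
      olsx {1..n} (\<lambda>i. fst (point (f i) w)) (\<lambda>i. snd (point (f i) w))"
    by (simp add: ols_eq_olsx training_set_def olsx_def gramx_def)
  then show ?thesis unfolding est_def cov_def olsx_reindex[OF assms] .
qed

lemma norm_est_square_integrable:
  assumes "\<And>j. integrable M (\<lambda>w. (est S w $ j - \<beta> $ j)\<^sup>2)"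
  shows "integrable M (\<lambda>w. (norm (est S w))\<^sup>2)"
proof (rule Bochner_Integration.integrable_bound)
  show "integrable M (\<lambda>w. \<Sum>j\<in>UNIV. 2 * (est S w $ j - \<beta> $ j)\<^sup>2 + 2 * (\<beta> $ j)\<^sup>2)"
    using assms by simp
  show "AE w in M. norm ((norm (est S w))\<^sup>2) \<le> norm (\<Sum>j\<in>UNIV. 2 * (est S w $ j - \<beta> $ j)\<^sup>2 + 2 * (\<beta> $ j)\<^sup>2)"
  proof (rule AE_I2)
    fix w
    have *: "x\<^sup>2 \<le> 2 * (x - b)\<^sup>2 + 2 * b\<^sup>2" for x b :: real
      using zero_le_power2[of "x - 2 * b"] by (simp add: power2_eq_square algebra_simps)
    have "(norm (est S w))\<^sup>2 = (\<Sum>j\<in>UNIV. (est S w $ j)\<^sup>2)"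
      by (simp add: norm_vec_def L2_set_def sum_nonneg)
    also have "\<dots> \<le> (\<Sum>j\<in>UNIV. 2 * (est S w $ j - \<beta> $ j)\<^sup>2 + 2 * (\<beta> $ j)\<^sup>2)"
      by (intro sum_mono *)
    finally show "norm ((norm (est S w))\<^sup>2) \<le> norm (\<Sum>j\<in>UNIV. 2 * (est S w $ j - \<beta> $ j)\<^sup>2 + 2 * (\<beta> $ j)\<^sup>2)"
      by simp
  qed
qed measurable

context
  fixes n :: nat and l d :: real
  assumes n: "n > 0" and l: "l > 0" and d: "d > 0"
begin

lemma thresholds: "0 \<le> l / real n" "l / real n \<le> (l + d) / real n" "0 \<le> (l + d) / real n"
  using n l d by (auto intro: divide_right_mono)

lemma h_diff_square_integrable:
  assumes iS: "i \<notin> S" and est2: "integrable M (\<lambda>w. (norm (est S w))\<^sup>2)"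
  shows "integrable M (\<lambda>w. (loss_gap (shrink_vec (l / real n) (est S w)) (shrink_vec ((l + d) / real n) (est S w)) (point i w))\<^sup>2)"
  by (rule loss_gap_square_integrable[OF iS est2 _ _ norm_shrink_vec_gap_le[OF thresholds(2)]
        norm_shrink_vec_sum_le[OF thresholds(1,3)]]) measurable

lemma h_diff_integrable:
  assumes iS: "i \<notin> S" and est2: "integrable M (\<lambda>w. (norm (est S w))\<^sup>2)"
  shows "integrable M (\<lambda>w. loss_gap (shrink_vec (l / real n) (est S w)) (shrink_vec ((l + d) / real n) (est S w)) (point i w))"
  by (rule square_integrable_imp_integrable[OF _ h_diff_square_integrable[OF assms]]) measurable

lemma cond_exp_test_h_diff:
  assumes est2: "integrable M (\<lambda>w. (norm (est (Some ` {1..n}) w))\<^sup>2)"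
  shows "AE w in M. cond_exp_test M Z n (h_diff n l d) w =
    (\<integral>w'. loss_gap (shrink_vec (l / real n) (est (Some ` {1..n}) w'))
       (shrink_vec ((l + d) / real n) (est (Some ` {1..n}) w')) (point (Some 0) w) \<partial>M)"
proof -
  let ?S = "Some ` {1..n}"
  let ?f = "\<lambda>z :: ((real ^ 'p) \<times> real) \<times> (real ^ 'p).
    loss_gap (shrink_vec (l / real n) (snd z)) (shrink_vec ((l + d) / real n) (snd z)) (fst z)"
  have 0: "Some 0 \<notin> ?S" by auto
  have Z0: "Z 0 = point (Some 0)" by (simp add: point_def)
  have *: "h_diff n l d (point (Some 0) w) (training_set n Z w) =
      loss_gap (shrink_vec (l / real n) (est ?S w)) (shrink_vec ((l + d) / real n) (est ?S w)) (point (Some 0) w)" for w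
    using ols_training_set[OF inj_Some, of n w]
    by (simp only: h_diff_eq_loss_gap Z_eq_point[symmetric])
  have "AE w in M. real_cond_exp M (vimage_algebra (space M) (point (Some 0)) borel)
      (\<lambda>w. ?f (point (Some 0) w, est ?S w)) w = (\<integral>w'. ?f (point (Some 0) w, est ?S w') \<partial>M)"
  proof (rule real_cond_exp_indep_rv[OF point_est_indep[OF 0]])
    show "?f \<in> borel_measurable (borel \<Otimes>\<^sub>M borel)" by measurable
    show "integrable M (\<lambda>w. ?f (point (Some 0) w, est ?S w))"
      using h_diff_integrable[OF 0 est2] by simp
  qed
  then show ?thesis unfolding cond_exp_test_def Z0 * fst_conv snd_conv .
qed

text \<open>The index map \<open>f\<close> lets one proof serve both the training set, with
  \<open>f = Some\<close>, and the perturbed one, where \<open>f\<close> sends 1 to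
  \<open>None\<close>.\<close>

lemma cond_exp_train_h_diff:
  assumes inj: "inj_on f {1..n}" and f0: "f 0 \<notin> f ` {1..n}"
    and est2: "integrable M (\<lambda>w. (norm (est (f ` {1..n}) w))\<^sup>2)"
  defines "u w \<equiv> shrink_vec (l / real n) (est (f ` {1..n}) w)"
    and "v w \<equiv> shrink_vec ((l + d) / real n) (est (f ` {1..n}) w)"
  shows "AE w in M. cond_exp_train M (\<lambda>i. point (f i)) n (h_diff n l d) w =
    2 * (\<beta> \<bullet> (v w - u w)) - ((norm (v w))\<^sup>2 - (norm (u w))\<^sup>2)"
proof -
  let ?S = "f ` {1..n}"
  let ?P = "PiM {1..n} (\<lambda>_. borel :: ((real ^ 'p) \<times> real) measure)"
  let ?T = "training_set n (\<lambda>i. point (f i))"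
  have ind: "indep_rv ?P ?T borel (point (f 0))"
  proof -
    have "indep_rv (PiM ?S (\<lambda>_. borel)) (\<lambda>w. \<lambda>i\<in>?S. point i w) borel (point (f 0))"
      by (rule indep_rv_restrict_single[OF point_indep]) (use f0 in auto)
    then have "indep_rv ?P (\<lambda>w. \<lambda>i\<in>{1..n}. (\<lambda>i\<in>?S. point i w) (f i)) borel (\<lambda>w. point (f 0) w)"
      by (rule indep_rv_compose) (intro measurable_restrict measurable_component_singleton measurable_ident_sets imageI refl, assumption?)+
    moreover have "(\<lambda>i\<in>{1..n}. (\<lambda>i\<in>?S. point i w) (f i)) = ?T w" for w
      by (auto simp: training_set_def)
    ultimately show ?thesis by simp
  qed
  have [measurable]: "ols n \<in> borel_measurable ?P"
    unfolding ols_eq_olsx[abs_def] by (rule olsx_points_measurable)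
  let ?h = "\<lambda>z. h_diff n l d (snd z) (fst z)"
  have *: "h_diff n l d (point (f 0) w') (?T w) = loss_gap (u w) (v w) (point (f 0) w')" for w w'
    by (simp add: h_diff_eq_loss_gap ols_training_set[OF inj] u_def v_def)
  have "AE w in M. real_cond_exp M (vimage_algebra (space M) ?T ?P) (\<lambda>w. ?h (?T w, point (f 0) w)) w
      = (\<integral>w'. ?h (?T w, point (f 0) w') \<partial>M)"
  proof (rule real_cond_exp_indep_rv[OF ind])
    show "?h \<in> borel_measurable (?P \<Otimes>\<^sub>M borel)"
      unfolding h_diff_eq_loss_gap by measurable
    show "integrable M (\<lambda>w. ?h (?T w, point (f 0) w))"
      using h_diff_integrable[OF f0 est2] by (simp add: * u_def v_def)
  qed
  then show ?thesis unfolding cond_exp_train_def by (simp add: * expectation_loss_gap)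
qed

end

end

section \<open>The limit of the variance\<close>

lemma sum_UNIV_Plus_Times:
  fixes f :: "'a::finite + 'b::finite \<times> 'c::finite \<Rightarrow> real"
  shows "(\<Sum>a\<in>UNIV. f a) = (\<Sum>j\<in>UNIV. f (Inl j)) + (\<Sum>j\<in>UNIV. \<Sum>k\<in>UNIV. f (Inr (j, k)))"
proof -
  have "(\<Sum>a\<in>UNIV. f a) = (\<Sum>j\<in>UNIV. f (Inl j)) + (\<Sum>jk\<in>UNIV. f (Inr jk))"
    by (subst UNIV_Plus_UNIV[symmetric], subst sum.Plus) auto
  also have "(\<Sum>jk\<in>UNIV. f (Inr jk)) = (\<Sum>j\<in>UNIV. \<Sum>k\<in>UNIV. f (Inr (j, k)))"
    by (subst UNIV_Times_UNIV[symmetric], subst sum.cartesian_product) (auto intro!: sum.cong)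
  finally show ?thesis .
qed

lemma (in prob_space) normal_odd_expectation:
  assumes N: "distributed M lborel N (normal_density 0 s)"
    and f [measurable]: "f \<in> borel_measurable borel" and odd: "\<And>x. f (- x) = - f x"
  shows "expectation (\<lambda>w. f (N w) :: real) = 0"
proof -
  let ?I = "\<integral>x. normal_density 0 s x * f x \<partial>lborel"
  have "?I = (\<integral>x. normal_density 0 s (- x) * f (- x) \<partial>lborel)"
    using lborel_integral_real_affine[of "-1" "\<lambda>x. normal_density 0 s x * f x" 0] by simp
  also have "\<dots> = - ?I" by (simp add: odd normal_density_def)
  finally have "?I = 0" by simp
  then show ?thesis using distributed_integral[OF N, of f] by simp
qed

context glm
begin

text \<open>Given an invertible design, a null coordinate is a centred normal variable, or is 0 if
  all its noise weights vanish. An odd function integrates to 0 in both cases.\<close>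

lemma expectation_odd_est:
  assumes S: "finite S" and inv: "AE w in M. invertible (gramx S (\<lambda>i. cov i w))" and b: "\<beta> $ j = 0"
    and f [measurable]: "f \<in> borel_measurable borel" and odd: "\<And>x. f (- x) = - f x"
    and bdd: "\<And>x. \<bar>f x\<bar> \<le> C"
  shows "expectation (\<lambda>w. f (est S w $ j) :: real) = 0"
proof -
  let ?P = "PiM S (\<lambda>_. borel :: (real ^ 'p) measure)" and ?Q = "PiM S (\<lambda>_. borel :: real measure)"
  let ?x = "\<lambda>w. \<lambda>i\<in>S. cov i w" and ?e = "\<lambda>w. \<lambda>i\<in>S. res i w"
  let ?o = "\<lambda>z. olsx S (fst z) (\<lambda>i. fst z i \<bullet> \<beta> + snd z i)"
  have o: "?o (?x w, ?e w') = olsx S (\<lambda>i. cov i w) (\<lambda>i. cov i w \<bullet> \<beta> + res i w')" for w w'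
    by (simp add: olsx_def gramx_def)
  have est: "est S w = ?o (?x w, ?e w)" for w
    unfolding o by (simp add: est_def point_eq)
  have "expectation (\<lambda>w. f (?o (?x w, ?e w) $ j)) = expectation (\<lambda>w. \<integral>w'. f (?o (?x w, ?e w') $ j) \<partial>M)"
  proof (rule integral_indep_rv[OF cov_res_indep, of "\<lambda>z. f (?o z $ j)", symmetric])
    show "(\<lambda>z. f (?o z $ j)) \<in> borel_measurable (?P \<Otimes>\<^sub>M ?Q)" by measurable
    show "integrable M (\<lambda>w. f (?o (?x w, ?e w) $ j))"
      unfolding est[symmetric] by (rule integrable_const_bound[of _ C]) (use bdd in auto)
  qed
  also have "\<dots> = expectation (\<lambda>w. 0)"
  proof (rule integral_cong_AE)
    show "AE w in M. (\<integral>w'. f (?o (?x w, ?e w') $ j) \<partial>M) = 0"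
      using inv
    proof eventually_elim
      case (elim w)
      let ?c = "\<lambda>i. cov i w \<bullet> gcol S (\<lambda>i. cov i w) j"
      have oj: "?o (?x w, ?e w') $ j = (\<Sum>i\<in>S. ?c i * res i w')" for w'
        unfolding o by (subst olsx_linear_model[OF elim]) (auto simp: b mult.commute)
      have f0: "f 0 = 0" using odd[of 0] by simp
      show ?case
      proof (cases "\<exists>i\<in>S. ?c i \<noteq> 0")
        case True
        show ?thesis unfolding oj
          by (rule normal_odd_expectation[OF distributed_normal_sum[OF S
                  indep_vars_subset[OF res_indep subset_UNIV] tau_pos res_distributed True] f odd])
      next
        case False
        then show ?thesis unfolding oj by (simp add: f0)
      qed
    qed
    have xm: "?x \<in> measurable M ?P" and em: "?e \<in> measurable M ?Q" by measurable
    have "(\<lambda>(w, w'). f (?o (?x w, ?e w') $ j)) \<in> borel_measurable (M \<Otimes>\<^sub>M M)"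
    proof -
      have h: "(\<lambda>z. f (?o z $ j)) \<in> borel_measurable (?P \<Otimes>\<^sub>M ?Q)" by measurable
      have g: "(\<lambda>z. (?x (fst z), ?e (snd z))) \<in> measurable (M \<Otimes>\<^sub>M M) (?P \<Otimes>\<^sub>M ?Q)"
        by (intro measurable_Pair measurable_compose[OF measurable_fst xm] measurable_compose[OF measurable_snd em])
      show ?thesis using measurable_compose[OF g h] by (simp add: split_def)
    qed
    then show "(\<lambda>w. \<integral>w'. f (?o (?x w, ?e w') $ j) \<partial>M) \<in> borel_measurable M"
      by (rule borel_measurable_lebesgue_integral)
  qed simp
  finally show ?thesis by (simp add: est)
qed

end

section \<open>Thresholds and the normalised gap\<close>

locale glm_seq = glm M X Y noise Z Zc \<beta> \<tau>
  for M :: "'w measure" and X :: "nat \<Rightarrow> 'w \<Rightarrow> real ^ 'p" and Y noise Z Zc \<beta> \<tau> +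
  fixes lam \<delta> :: "nat \<Rightarrow> real"
  assumes lam_pos: "lam n > 0" and delta_pos: "\<delta> n > 0"
    and lam_O: "lam \<in> O(\<lambda>n. sqrt (real n))" and delta_Theta: "\<delta> \<in> \<Theta>(\<lambda>_. 1)"
begin

definition train :: "nat \<Rightarrow> nat option set" where
  "train n = Some ` {1..n}"

definition thr1 :: "nat \<Rightarrow> real" where "thr1 n = lam n / real n"
definition thr2 :: "nat \<Rightarrow> real" where "thr2 n = (lam n + \<delta> n) / real n"

text \<open>The scaling by \<open>n / \<delta> n\<close> makes the difference of the two shrinkage
  maps a function with values in [-1, 1], equal to minus the sign beyond the larger
  threshold.\<close>

definition gap :: "nat \<Rightarrow> real \<Rightarrow> real" where
  "gap n t = real n / \<delta> n * (shrink (thr2 n) t - shrink (thr1 n) t)"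

lemma finite_train [simp]: "finite (train n)" by (simp add: train_def)

lemma lam_bound: obtains C where "C > 0" "\<forall>\<^sub>F n in sequentially. lam n \<le> C * sqrt (real n)"
proof -
  obtain C where "C > 0" "\<forall>\<^sub>F n in sequentially. norm (lam n) \<le> C * norm (sqrt (real n))"
    using landau_o.bigE[OF lam_O] by blast
  then have "C > 0" "\<forall>\<^sub>F n in sequentially. lam n \<le> C * sqrt (real n)"
    by (auto elim!: eventually_mono)
  then show ?thesis by (rule that)
qed

lemma delta_bounds:
  obtains a b where "a > 0" "b > 0" "\<forall>\<^sub>F n in sequentially. a \<le> \<delta> n \<and> \<delta> n \<le> b"
proof -
  have "\<delta> \<in> O(\<lambda>_. 1)" "\<delta> \<in> \<Omega>(\<lambda>_. 1)" using delta_Theta by (auto simp: bigtheta_def)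
  then obtain a b where ab: "a > 0" "b > 0"
    "\<forall>\<^sub>F n in sequentially. norm (\<delta> n) \<le> b * norm (1::real)"
    "\<forall>\<^sub>F n in sequentially. norm (\<delta> n) \<ge> a * norm (1::real)"
    by (elim landau_o.bigE landau_omega.bigE)
  from ab(3,4) have "\<forall>\<^sub>F n in sequentially. a \<le> \<delta> n \<and> \<delta> n \<le> b"
  proof eventually_elim
    case (elim n)
    then show ?case using delta_pos[of n] by simp
  qed
  with ab(1,2) show ?thesis by (rule that)
qed

lemma thr_nonneg: "0 \<le> thr1 n" "0 \<le> thr2 n" "thr1 n \<le> thr2 n"
  using lam_pos[of n] delta_pos[of n] by (auto simp: thr1_def thr2_def divide_right_mono)

lemma thr_diff: "n > 0 \<Longrightarrow> thr2 n - thr1 n = \<delta> n / real n"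
  by (simp add: thr1_def thr2_def add_divide_distrib)

lemma thr_tendsto: "thr1 \<longlonglongrightarrow> 0" "thr2 \<longlonglongrightarrow> 0"
proof -
  obtain C where C: "C > 0" "\<forall>\<^sub>F n in sequentially. lam n \<le> C * sqrt (real n)" by (rule lam_bound)
  obtain a b where b: "\<forall>\<^sub>F n in sequentially. a \<le> \<delta> n \<and> \<delta> n \<le> b" by (rule delta_bounds)
  have lim: "(\<lambda>n. (C * sqrt (real n) + b) / real n) \<longlonglongrightarrow> 0" by real_asymp
  have ev: "\<forall>\<^sub>F n in sequentially. thr2 n \<le> (C * sqrt (real n) + b) / real n"
    using C(2) b by eventually_elim (auto simp: thr2_def intro!: divide_right_mono)
  show "thr2 \<longlonglongrightarrow> 0"
    by (rule tendsto_sandwich[OF _ ev tendsto_const lim]) (simp add: thr_nonneg)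
  then show "thr1 \<longlonglongrightarrow> 0"
    by (rule tendsto_sandwich[rotated -1, OF _ _ _ tendsto_const]) (simp_all add: thr_nonneg)
qed

lemma gap_measurable [measurable]: "gap n \<in> borel_measurable borel"
  unfolding gap_def[abs_def] by measurable

lemma gap_odd: "gap n (- t) = - gap n t"
  by (simp add: gap_def shrink_minus algebra_simps)

lemma abs_gap_le: "\<bar>gap n t\<bar> \<le> 1"
proof (cases "n = 0")
  case False
  have "\<bar>gap n t\<bar> = real n / \<delta> n * \<bar>shrink (thr2 n) t - shrink (thr1 n) t\<bar>"
    using delta_pos[of n] by (simp add: gap_def abs_mult)
  also have "\<dots> \<le> real n / \<delta> n * (\<delta> n / real n)"
    using abs_shrink_shrink_le[OF thr_nonneg(3), of n t] delta_pos[of n] thr_diff[of n] False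
    by (intro mult_left_mono) auto
  finally have "\<bar>gap n t\<bar> \<le> real n / \<delta> n * (\<delta> n / real n)" .
  then show ?thesis using False delta_pos[of n] by simp
qed (simp add: gap_def)

lemma gap_large:
  assumes "n > 0" "thr2 n \<le> \<bar>t\<bar>" "t \<noteq> 0"
  shows "gap n t = - sgn t"
  using shrink_gap_large[OF thr_nonneg(3) assms(2,3)] thr_diff[OF assms(1)] assms(1) delta_pos[of n]
  by (simp add: gap_def)

text \<open>Close to \<open>b\<close> the left side is 0. Elsewhere it is at most 2, while (t - b)^2
  is at least b^2/4, which gives 8 = 2 * 4. In this form the mean square error bounds the deviation
  without a separate tail estimate.\<close>

lemma gap_near:
  assumes "n > 0" "b \<noteq> 0" "thr2 n \<le> \<bar>b\<bar> / 2"
  shows "\<bar>gap n t + sgn b\<bar> \<le> 8 / b\<^sup>2 * (t - b)\<^sup>2"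
proof (cases "\<bar>t - b\<bar> < \<bar>b\<bar> / 2")
  case True
  then have "sgn t = sgn b" "t \<noteq> 0" "\<bar>b\<bar> / 2 \<le> \<bar>t\<bar>" using assms(2) by (auto simp: sgn_if abs_if split: if_splits)
  then have "gap n t = - sgn b" using gap_large[of n t] assms by simp
  then show ?thesis by simp
next
  case False
  then have "(\<bar>b\<bar> / 2)\<^sup>2 \<le> \<bar>t - b\<bar>\<^sup>2" by (intro power_mono) auto
  then have "2 \<le> 8 / b\<^sup>2 * (t - b)\<^sup>2" using assms(2) by (simp add: power_divide field_simps)
  moreover have "\<bar>gap n t + sgn b\<bar> \<le> 2" using abs_gap_le[of n t] by (auto simp: sgn_if)
  ultimately show ?thesis by linarith
qed

lemma gap_integrable: "integrable M (\<lambda>w. gap n (est S w $ j))"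
  by (rule integrable_const_bound[of _ 1]) (use abs_gap_le in auto)

lemma expectation_gap_tendsto:
  "(\<lambda>n. expectation (\<lambda>w. gap n (est (train n) w $ j))) \<longlonglongrightarrow> - sgn (\<beta> $ j)"
proof -
  obtain K n0 where K: "K \<ge> 0" and inv: "\<And>n. n \<ge> n0 \<Longrightarrow> AE w in M. invertible (gramx (train n) (\<lambda>i. cov i w))"
    and int: "\<And>n j. n \<ge> n0 \<Longrightarrow> integrable M (\<lambda>w. (est (train n) w $ j - \<beta> $ j)\<^sup>2)"
    and le: "\<And>n j. n \<ge> n0 \<Longrightarrow> expectation (\<lambda>w. (est (train n) w $ j - \<beta> $ j)\<^sup>2) \<le> K / real n"
    using est_second_moment unfolding train_def by metis
  show ?thesis
  proof (cases "\<beta> $ j = 0")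
    case True
    have "\<forall>\<^sub>F n in sequentially. expectation (\<lambda>w. gap n (est (train n) w $ j)) = 0"
      using eventually_ge_at_top[of n0]
      by eventually_elim (rule expectation_odd_est[OF finite_train inv True gap_measurable gap_odd abs_gap_le])
    then show ?thesis using True by (simp add: tendsto_eventually)
  next
    case False
    let ?b = "\<beta> $ j"
    let ?D = "\<lambda>n. expectation (\<lambda>w. gap n (est (train n) w $ j)) - (- sgn ?b)"
    have "\<forall>\<^sub>F n in sequentially. thr2 n < \<bar>?b\<bar> / 2"
      by (rule order_tendstoD(2)[OF thr_tendsto(2)]) (use False in simp)
    then have "\<forall>\<^sub>F n in sequentially. norm (?D n) \<le> 8 / ?b\<^sup>2 * (K / real n)"
      using eventually_ge_at_top[of n0] eventually_gt_at_top[of 0]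
    proof eventually_elim
      case (elim n)
      have "?D n = expectation (\<lambda>w. gap n (est (train n) w $ j) + sgn ?b)"
        using gap_integrable by (simp add: prob_space)
      also have "\<bar>\<dots>\<bar> \<le> expectation (\<lambda>w. \<bar>gap n (est (train n) w $ j) + sgn ?b\<bar>)"
        by (rule integral_abs_bound)
      also have "\<dots> \<le> expectation (\<lambda>w. 8 / ?b\<^sup>2 * (est (train n) w $ j - ?b)\<^sup>2)"
        by (intro integral_mono integrable_abs Bochner_Integration.integrable_add gap_integrable
            integrable_mult_right int elim gap_near False less_imp_le[OF elim(1)]) auto
      also have "\<dots> \<le> 8 / ?b\<^sup>2 * (K / real n)"
        by (subst integral_mult_right_zero) (intro mult_left_mono le elim, simp)
      finally show ?case by simp
    qed
    moreover have "(\<lambda>n. 8 / ?b\<^sup>2 * (K / real n)) \<longlonglongrightarrow> 0" by real_asymp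
    ultimately have "?D \<longlonglongrightarrow> 0" by (rule Lim_null_comparison)
    then show ?thesis by (rule LIM_zero_cancel)
  qed
qed

lemma shrink_est_integrable:
  assumes "integrable M (\<lambda>w. est S w $ k)" "c \<ge> 0"
  shows "integrable M (\<lambda>w. shrink c (est S w $ k))"
  by (rule Bochner_Integration.integrable_bound[OF assms(1)]) (auto simp: abs_shrink_le assms(2))

lemma gap_shrink_integrable:
  assumes "integrable M (\<lambda>w. est S w $ k)" "c \<ge> 0"
  shows "integrable M (\<lambda>w. gap n (est S w $ j) * shrink c (est S w $ k))"
proof (rule Bochner_Integration.integrable_bound[OF shrink_est_integrable[OF assms]])
  show "AE w in M. norm (gap n (est S w $ j) * shrink c (est S w $ k)) \<le> norm (shrink c (est S w $ k))"
    by (intro AE_I2) (simp add: abs_mult mult_left_le_one_le abs_gap_le)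
qed measurable

text \<open>As the gap is bounded by 1, replacing the shrunken coordinate by
  \<open>\<beta> $ k\<close> costs at most \<open>c n\<close> plus the mean absolute error. The
  threshold \<open>c\<close> is left general because both thresholds occur.\<close>

lemma expectation_gap_shrink_tendsto:
  assumes c: "\<And>n. c n \<ge> 0" "c \<longlonglongrightarrow> 0"
  shows "(\<lambda>n. expectation (\<lambda>w. gap n (est (train n) w $ j) * shrink (c n) (est (train n) w $ k)))
    \<longlonglongrightarrow> - sgn (\<beta> $ j) * \<beta> $ k"
proof -
  obtain K n0 where K: "K \<ge> 0"
    and int: "\<And>n j. n \<ge> n0 \<Longrightarrow> integrable M (\<lambda>w. (est (train n) w $ j - \<beta> $ j)\<^sup>2)"
    and le: "\<And>n j. n \<ge> n0 \<Longrightarrow> expectation (\<lambda>w. (est (train n) w $ j - \<beta> $ j)\<^sup>2) \<le> K / real n"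
    using est_second_moment unfolding train_def by metis
  let ?D = "\<lambda>n. expectation (\<lambda>w. gap n (est (train n) w $ j) * shrink (c n) (est (train n) w $ k))
      - expectation (\<lambda>w. gap n (est (train n) w $ j)) * \<beta> $ k"
  have "\<forall>\<^sub>F n in sequentially. norm (?D n) \<le> c n + (K + 1) / sqrt (real n)"
    using eventually_ge_at_top[of n0] eventually_gt_at_top[of 0]
  proof eventually_elim
    case (elim n)
    let ?t = "\<lambda>w. est (train n) w $ k"
    have m: "(\<lambda>w. ?t w - \<beta> $ k) \<in> borel_measurable M" by measurable
    have n: "real n > 0" using elim by simp
    note e = expectation_abs_le[OF m int[OF elim(1)] le[OF elim(1)] n]
    have i1: "integrable M ?t" using Bochner_Integration.integrable_add[OF e(1), of "\<lambda>_. \<beta> $ k"] by simp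
    note i = shrink_est_integrable[OF i1 c(1)[of n]] gap_shrink_integrable[OF i1 c(1)[of n]]
    have i2: "integrable M (\<lambda>w. gap n (est (train n) w $ j) * (shrink (c n) (?t w) - \<beta> $ k))"
      using i(2)[of n j] gap_integrable by (simp add: right_diff_distrib)
    have "?D n = expectation (\<lambda>w. gap n (est (train n) w $ j) * (shrink (c n) (?t w) - \<beta> $ k))"
      using i(2)[of n j] gap_integrable by (simp add: right_diff_distrib)
    also have "\<bar>\<dots>\<bar> \<le> expectation (\<lambda>w. \<bar>gap n (est (train n) w $ j) * (shrink (c n) (?t w) - \<beta> $ k)\<bar>)"
      by (rule integral_abs_bound)
    also have "\<dots> \<le> expectation (\<lambda>w. c n + \<bar>?t w - \<beta> $ k\<bar>)"
    proof (intro integral_mono integrable_abs Bochner_Integration.integrable_add i2 e(1) integrable_const)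
      fix w
      have "\<bar>gap n (est (train n) w $ j) * (shrink (c n) (?t w) - \<beta> $ k)\<bar> \<le> \<bar>shrink (c n) (?t w) - \<beta> $ k\<bar>"
        by (simp add: abs_mult mult_left_le_one_le abs_gap_le)
      also have "\<dots> \<le> c n + \<bar>?t w - \<beta> $ k\<bar>"
        using abs_shrink_diff_le[OF c(1)[of n], of "?t w"] by linarith
      finally show "\<bar>gap n (est (train n) w $ j) * (shrink (c n) (?t w) - \<beta> $ k)\<bar> \<le> c n + \<bar>?t w - \<beta> $ k\<bar>" .
    qed
    also have "\<dots> \<le> c n + (K + 1) / sqrt (real n)"
      using e by (simp add: prob_space)
    finally show ?case by simp
  qed
  moreover have "(\<lambda>n. c n + (K + 1) / sqrt (real n)) \<longlonglongrightarrow> 0"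
  proof -
    have "(\<lambda>n. (K + 1) / sqrt (real n)) \<longlonglongrightarrow> 0" by real_asymp
    from tendsto_add[OF c(2) this] show ?thesis by simp
  qed
  ultimately have "?D \<longlonglongrightarrow> 0" by (rule Lim_null_comparison)
  from tendsto_add[OF this tendsto_mult[OF expectation_gap_tendsto[of j] tendsto_const[of "\<beta> $ k"]]]
  show ?thesis by simp
qed

text \<open>For a fixed estimator the loss difference is a linear combination of finitely many
  monomials of the test point: response times covariate (\<open>Inl\<close>) and products of two
  covariates (\<open>Inr\<close>).\<close>

definition feature :: "'p + 'p \<times> 'p \<Rightarrow> 'w \<Rightarrow> real" where
  "feature a w = (case a of Inl j \<Rightarrow> 2 * snd (point (Some 0) w) * cov (Some 0) w $ j
     | Inr (j, k) \<Rightarrow> - (cov (Some 0) w $ j * cov (Some 0) w $ k))"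

text \<open>The quadratic coefficients come from v_j v_k - u_j u_k = (v_j - u_j) v_k + (v_k - u_k)
  u_j, with u and v the estimates for the smaller and the larger threshold, so that each term
  carries a bounded gap factor.\<close>

definition coef :: "nat \<Rightarrow> real ^ 'p \<Rightarrow> 'p + 'p \<times> 'p \<Rightarrow> real" where
  "coef n t a = (case a of Inl j \<Rightarrow> gap n (t $ j)
     | Inr (j, k) \<Rightarrow> gap n (t $ j) * shrink (thr2 n) (t $ k) + gap n (t $ k) * shrink (thr1 n) (t $ j))"

lemma feature_measurable [measurable]: "feature a \<in> borel_measurable M"
  by (cases a) (auto simp: feature_def[abs_def] split: prod.split)

lemma feature_square_integrable: "integrable M (\<lambda>w. (feature a w)\<^sup>2)"
proof (cases a)
  case (Inl j)
  show ?thesis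
  proof (rule Bochner_Integration.integrable_bound)
    show "integrable M (\<lambda>w. 4 * ((norm (cov (Some 0) w))\<^sup>2 * (snd (point (Some 0) w))\<^sup>2))"
      by (intro integrable_mult_right cov_snd_point_integrable)
    show "AE w in M. norm ((feature a w)\<^sup>2) \<le> norm (4 * ((norm (cov (Some 0) w))\<^sup>2 * (snd (point (Some 0) w))\<^sup>2))"
      using mult_right_mono[OF component_square_le_norm, of "(snd (point (Some 0) _))\<^sup>2" "cov (Some 0) _" j]
      by (auto simp: Inl feature_def power_mult_distrib mult_ac)
  qed measurable
next
  case (Inr jk)
  obtain j k where jk: "jk = (j, k)" by (cases jk)
  show ?thesis
  proof (rule Bochner_Integration.integrable_bound[OF cov_norm_power_integrable[of "Some 0" 4]])
    show "AE w in M. norm ((feature a w)\<^sup>2) \<le> norm (norm (cov (Some 0) w) ^ 4)"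
    proof (rule AE_I2)
      fix w
      have "(cov (Some 0) w $ j)\<^sup>2 * (cov (Some 0) w $ k)\<^sup>2 \<le> (norm (cov (Some 0) w))\<^sup>2 * (norm (cov (Some 0) w))\<^sup>2"
        by (intro mult_mono component_square_le_norm) auto
      moreover have "norm ((feature a w)\<^sup>2) = (cov (Some 0) w $ j)\<^sup>2 * (cov (Some 0) w $ k)\<^sup>2"
        by (simp add: Inr jk feature_def power_mult_distrib)
      moreover have "norm (norm (cov (Some 0) w) ^ 4) = (norm (cov (Some 0) w))\<^sup>2 * (norm (cov (Some 0) w))\<^sup>2"
        by (simp add: power4_eq_xxxx power2_eq_square)
      ultimately show "norm ((feature a w)\<^sup>2) \<le> norm (norm (cov (Some 0) w) ^ 4)" by simp
    qed
  qed measurable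
qed

lemma loss_gap_features:
  assumes "n > 0"
  shows "loss_gap (shrink_vec (thr1 n) t) (shrink_vec (thr2 n) t) (point (Some 0) w) =
    \<delta> n / real n * (\<Sum>a\<in>UNIV. coef n t a * feature a w)"
proof -
  let ?x = "cov (Some 0) w" and ?y = "snd (point (Some 0) w)"
  let ?u = "shrink_vec (thr1 n) t" and ?v = "shrink_vec (thr2 n) t"
  have d: "?v $ j - ?u $ j = \<delta> n / real n * gap n (t $ j)" for j
    using assms delta_pos[of n] by (simp add: gap_def shrink_vec_def)
  have sq: "(?x \<bullet> r)\<^sup>2 = (\<Sum>j\<in>UNIV. \<Sum>k\<in>UNIV. ?x $ j * ?x $ k * (r $ j * r $ k))" for r
    by (simp add: inner_vec_def power2_eq_square sum_product mult_ac)
  have prod: "?v $ j * ?v $ k - ?u $ j * ?u $ k = \<delta> n / real n * coef n t (Inr (j, k))" for j k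
  proof -
    have "?v $ j * ?v $ k - ?u $ j * ?u $ k = (?v $ j - ?u $ j) * ?v $ k + (?v $ k - ?u $ k) * ?u $ j"
      by (simp add: algebra_simps)
    also have "\<dots> = \<delta> n / real n * coef n t (Inr (j, k))"
      unfolding d by (simp add: coef_def shrink_vec_def algebra_simps)
    finally show ?thesis .
  qed
  have "loss_gap ?u ?v (point (Some 0) w) = 2 * ?y * (?x \<bullet> (?v - ?u)) - ((?x \<bullet> ?v)\<^sup>2 - (?x \<bullet> ?u)\<^sup>2)"
    by (simp add: loss_gap_def cov_def inner_diff_right power2_eq_square algebra_simps)
  also have "2 * ?y * (?x \<bullet> (?v - ?u)) = (\<Sum>j\<in>UNIV. \<delta> n / real n * (coef n t (Inl j) * feature (Inl j) w))"
    by (simp add: inner_vec_def d sum_distrib_left coef_def feature_def mult_ac)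
  also have "(?x \<bullet> ?v)\<^sup>2 - (?x \<bullet> ?u)\<^sup>2 =
      (\<Sum>j\<in>UNIV. \<Sum>k\<in>UNIV. ?x $ j * ?x $ k * (?v $ j * ?v $ k - ?u $ j * ?u $ k))"
    unfolding sq by (simp add: sum_subtractf right_diff_distrib)
  also have "\<dots> = - (\<Sum>j\<in>UNIV. \<Sum>k\<in>UNIV. \<delta> n / real n * (coef n t (Inr (j, k)) * feature (Inr (j, k)) w))"
    unfolding prod sum_negf[symmetric] by (intro sum.cong refl) (simp add: feature_def)
  finally show ?thesis
    by (simp add: sum_UNIV_Plus_Times sum_distrib_left distrib_left)
qed

text \<open>Freezing the test point replaces every coefficient by its expectation. The variance then
  concerns a fixed finite family with deterministic coefficients, and its limit reduces to limits of
  numbers.\<close>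

lemma sigma_sq_features:
  "\<exists>n0. \<forall>n\<ge>n0. (\<forall>a. integrable M (\<lambda>w. coef n (est (train n) w) a)) \<and>
     (real n)\<^sup>2 / (\<delta> n)\<^sup>2 * sigma_sq M Z n (h_diff n (lam n) (\<delta> n)) =
     variance (\<lambda>w. \<Sum>a\<in>UNIV. expectation (\<lambda>w'. coef n (est (train n) w') a) * feature a w)"
proof -
  obtain n0 where int: "\<And>n j. n \<ge> n0 \<Longrightarrow> integrable M (\<lambda>w. (est (train n) w $ j - \<beta> $ j)\<^sup>2)"
    using est_second_moment unfolding train_def by metis
  show ?thesis
  proof (intro exI allI impI conjI)
    fix n assume n: "n \<ge> max n0 1"
    then have n0: "n \<ge> n0" and npos: "n > 0" by auto
    have i1: "integrable M (\<lambda>w. est (train n) w $ j)" for j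
    proof -
      have "integrable M (\<lambda>w. est (train n) w $ j - \<beta> $ j)"
        by (rule square_integrable_imp_integrable) (use int[OF n0] in auto)
      from Bochner_Integration.integrable_add[OF this, of "\<lambda>_. \<beta> $ j"] show ?thesis by simp
    qed
    show coef: "integrable M (\<lambda>w. coef n (est (train n) w) a)" for a
      by (cases a) (auto simp: coef_def split: prod.split intro!: gap_integrable Bochner_Integration.integrable_add
          gap_shrink_integrable i1 thr_nonneg)
    let ?c = "\<lambda>a. expectation (\<lambda>w'. coef n (est (train n) w') a)"
    have est2: "integrable M (\<lambda>w. (norm (est (Some ` {1..n}) w))\<^sup>2)"
      using norm_est_square_integrable[of "train n"] int[OF n0] by (simp add: train_def)
    have "AE w in M. cond_exp_test M Z n (h_diff n (lam n) (\<delta> n)) w =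
        \<delta> n / real n * (\<Sum>a\<in>UNIV. ?c a * feature a w)"
      using cond_exp_test_h_diff[OF npos lam_pos[of n] delta_pos[of n] est2]
    proof eventually_elim
      case (elim w)
      then have "cond_exp_test M Z n (h_diff n (lam n) (\<delta> n)) w =
          (\<integral>w'. \<delta> n / real n * (\<Sum>a\<in>UNIV. coef n (est (train n) w') a * feature a w) \<partial>M)"
        unfolding loss_gap_features[OF npos, symmetric] by (simp add: train_def thr1_def thr2_def)
      also have "\<dots> = \<delta> n / real n * (\<Sum>a\<in>UNIV. ?c a * feature a w)"
        using coef by (simp add: Bochner_Integration.integral_sum)
      finally show ?case .
    qed
    then have "sigma_sq M Z n (h_diff n (lam n) (\<delta> n)) =
        variance (\<lambda>w. \<delta> n / real n * (\<Sum>a\<in>UNIV. ?c a * feature a w))"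
      unfolding sigma_sq_def
      by (intro variance_cong_AE) (auto simp: cond_exp_test_def intro: borel_measurable_cond_exp2)
    then show "(real n)\<^sup>2 / (\<delta> n)\<^sup>2 * sigma_sq M Z n (h_diff n (lam n) (\<delta> n)) =
        variance (\<lambda>w. \<Sum>a\<in>UNIV. ?c a * feature a w)"
      using npos delta_pos[of n] unfolding variance_cmult by (simp add: power_divide)
  qed
qed

lemma sigma_sq_tendsto:
  "(\<lambda>n. (real n)\<^sup>2 / (\<delta> n)\<^sup>2 * sigma_sq M Z n (h_diff n (lam n) (\<delta> n)))
     \<longlonglongrightarrow> 4 * \<tau>\<^sup>2 * real (l0_norm \<beta>)"
proof -
  obtain n0 where coef: "\<And>n a. n \<ge> n0 \<Longrightarrow> integrable M (\<lambda>w. coef n (est (train n) w) a)"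
    and eq: "\<And>n. n \<ge> n0 \<Longrightarrow> (real n)\<^sup>2 / (\<delta> n)\<^sup>2 * sigma_sq M Z n (h_diff n (lam n) (\<delta> n)) =
     variance (\<lambda>w. \<Sum>a\<in>UNIV. expectation (\<lambda>w'. coef n (est (train n) w') a) * feature a w)"
    using sigma_sq_features by blast
  define v :: "real ^ 'p" where "v = (\<chi> j. - sgn (\<beta> $ j))"
  define c0 where "c0 a = (case a of Inl j \<Rightarrow> v $ j | Inr (j, k) \<Rightarrow> v $ j * \<beta> $ k + v $ k * \<beta> $ j)" for a
  have c: "(\<lambda>n. expectation (\<lambda>w'. coef n (est (train n) w') a)) \<longlonglongrightarrow> c0 a" for a
  proof (cases a)
    case (Inl j)
    then show ?thesis using expectation_gap_tendsto[of j] by (simp add: coef_def c0_def v_def)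
  next
    case (Inr jk)
    obtain j k where jk: "jk = (j, k)" by (cases jk)
    obtain n1 where int: "\<And>n j. n \<ge> n1 \<Longrightarrow> integrable M (\<lambda>w. (est (train n) w $ j - \<beta> $ j)\<^sup>2)"
      using est_second_moment unfolding train_def by metis
    have "\<forall>\<^sub>F n in sequentially. expectation (\<lambda>w. gap n (est (train n) w $ j) * shrink (thr2 n) (est (train n) w $ k))
        + expectation (\<lambda>w. gap n (est (train n) w $ k) * shrink (thr1 n) (est (train n) w $ j))
        = expectation (\<lambda>w'. coef n (est (train n) w') a)"
      using eventually_ge_at_top[of n1]
    proof eventually_elim
      case (elim n)
      have i1: "integrable M (\<lambda>w. est (train n) w $ j)" for j
      proof -
        have "integrable M (\<lambda>w. est (train n) w $ j - \<beta> $ j)"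
          by (rule square_integrable_imp_integrable) (use int[OF elim] in auto)
        from Bochner_Integration.integrable_add[OF this, of "\<lambda>_. \<beta> $ j"] show ?thesis by simp
      qed
      show ?case
        using gap_shrink_integrable[OF i1 thr_nonneg(2)] gap_shrink_integrable[OF i1 thr_nonneg(1)]
        by (simp add: coef_def Inr jk)
    qed
    moreover have "(\<lambda>n. expectation (\<lambda>w. gap n (est (train n) w $ j) * shrink (thr2 n) (est (train n) w $ k))
        + expectation (\<lambda>w. gap n (est (train n) w $ k) * shrink (thr1 n) (est (train n) w $ j))) \<longlonglongrightarrow> c0 a"
      using tendsto_add[OF expectation_gap_shrink_tendsto[OF thr_nonneg(2) thr_tendsto(2), of j k]
          expectation_gap_shrink_tendsto[OF thr_nonneg(1) thr_tendsto(1), of k j]]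
      by (simp add: c0_def v_def Inr jk)
    ultimately show ?thesis by (rule Lim_transform_eventually[rotated])
  qed
  have lim: "(\<lambda>n. variance (\<lambda>w. \<Sum>a\<in>UNIV. expectation (\<lambda>w'. coef n (est (train n) w') a) * feature a w))
      \<longlonglongrightarrow> variance (\<lambda>w. \<Sum>a\<in>UNIV. c0 a * feature a w)"
    by (rule variance_lincomb_tendsto) (use c feature_square_integrable in auto)
  \<comment> \<open>The signal cancels: with response x . \<beta> + e, the linear part is 2 (x .
    \<beta> + e)(x . v) and the quadratic part subtracts 2 (x . v)(x . \<beta>).\<close>
  have "(\<Sum>a\<in>UNIV. c0 a * feature a w) = 2 * (res (Some 0) w * (cov (Some 0) w \<bullet> v))" for w
  proof -
    let ?x = "cov (Some 0) w"
    have "(\<Sum>a\<in>UNIV. c0 a * feature a w) = 2 * snd (point (Some 0) w) * (?x \<bullet> v)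
        - (\<Sum>j\<in>UNIV. \<Sum>k\<in>UNIV. (v $ j * ?x $ j) * (\<beta> $ k * ?x $ k) + (\<beta> $ j * ?x $ j) * (v $ k * ?x $ k))"
    proof -
      have "(\<Sum>j\<in>UNIV. c0 (Inl j) * feature (Inl j) w) = 2 * snd (point (Some 0) w) * (?x \<bullet> v)"
        by (simp add: c0_def feature_def inner_vec_def sum_distrib_left mult_ac)
      moreover have "(\<Sum>j\<in>UNIV. \<Sum>k\<in>UNIV. c0 (Inr (j, k)) * feature (Inr (j, k)) w) =
          - (\<Sum>j\<in>UNIV. \<Sum>k\<in>UNIV. (v $ j * ?x $ j) * (\<beta> $ k * ?x $ k) + (\<beta> $ j * ?x $ j) * (v $ k * ?x $ k))"
        unfolding sum_negf[symmetric] by (intro sum.cong refl) (simp add: c0_def feature_def algebra_simps)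
      ultimately show ?thesis by (simp add: sum_UNIV_Plus_Times)
    qed
    also have "(\<Sum>j\<in>UNIV. \<Sum>k\<in>UNIV. (v $ j * ?x $ j) * (\<beta> $ k * ?x $ k) + (\<beta> $ j * ?x $ j) * (v $ k * ?x $ k))
        = 2 * ((?x \<bullet> v) * (?x \<bullet> \<beta>))"
    proof -
      have xv: "?x \<bullet> v = (\<Sum>j\<in>UNIV. v $ j * ?x $ j)" "?x \<bullet> \<beta> = (\<Sum>j\<in>UNIV. \<beta> $ j * ?x $ j)"
        by (simp_all add: inner_vec_def mult.commute)
      show ?thesis unfolding sum.distrib sum_product[symmetric] xv[symmetric] by (simp add: mult.commute)
    qed
    finally show ?thesis by (simp add: point_eq algebra_simps)
  qed
  moreover have "variance (\<lambda>w. 2 * (res (Some 0) w * (cov (Some 0) w \<bullet> v))) = 4 * \<tau>\<^sup>2 * real (l0_norm \<beta>)"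
  proof -
    have "expectation (\<lambda>w. res (Some 0) w * (cov (Some 0) w \<bullet> v)) = 0"
      using res_cov_product(2)[of "\<lambda>x. x \<bullet> v" "Some 0"] cov_inner_integrable[of "Some 0" v] by simp
    moreover have "expectation (\<lambda>w. (cov (Some 0) w \<bullet> v)\<^sup>2 * (res (Some 0) w)\<^sup>2) = (norm v)\<^sup>2 * \<tau>\<^sup>2"
      using integral_mult_indep_rv[OF cov_res_single_indep, of "\<lambda>x. (x \<bullet> v)\<^sup>2" "\<lambda>e. e\<^sup>2" "Some 0"]
        cov_inner_second_moment[of "Some 0" v] res_power_integrable[of "Some 0" 2] res_second_moment[of "Some 0"]
      by simp
    moreover have "(norm v)\<^sup>2 = real (l0_norm \<beta>)"
    proof -
      have "(norm v)\<^sup>2 = (\<Sum>j\<in>UNIV. (v $ j)\<^sup>2)" by (simp add: norm_vec_def L2_set_def sum_nonneg)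
      also have "\<dots> = (\<Sum>j\<in>UNIV. if \<beta> $ j \<noteq> 0 then 1 else 0)"
        by (intro sum.cong refl) (auto simp: v_def sgn_if)
      finally show ?thesis by (simp add: l0_norm_def sum.If_cases)
    qed
    ultimately show ?thesis
      by (simp add: variance_cmult power_mult_distrib mult_ac)
  qed
  ultimately have "(\<lambda>n. variance (\<lambda>w. \<Sum>a\<in>UNIV. expectation (\<lambda>w'. coef n (est (train n) w') a) * feature a w))
      \<longlonglongrightarrow> 4 * \<tau>\<^sup>2 * real (l0_norm \<beta>)" using lim by simp
  moreover have "\<forall>\<^sub>F n in sequentially.
      variance (\<lambda>w. \<Sum>a\<in>UNIV. expectation (\<lambda>w'. coef n (est (train n) w') a) * feature a w) =
      (real n)\<^sup>2 / (\<delta> n)\<^sup>2 * sigma_sq M Z n (h_diff n (lam n) (\<delta> n))"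
    using eventually_ge_at_top[of n0] by eventually_elim (simp only: eq)
  ultimately show ?thesis by (rule Lim_transform_eventually)
qed

end

section \<open>Leave-one-out perturbation\<close>

text \<open>A covariate near the unit vector moves coordinate \<open>j\<close> in the direction of
  the prediction error. The prediction error differs from the noise by at most 5/4, and the factor
  12 = 4 * 3 combines the bounds \<open>q \<le> 4\<close> and
  \<open>z $ j \<ge> 1 / (3 * ?N)\<close>.\<close>

lemma olsx_insert_push:
  fixes x :: "'i \<Rightarrow> real ^ 'p"
  assumes S: "finite S" "a \<notin> S" and wc: "well_conditioned S x" and pos: "card S > 0"
    and near: "norm (x a - axis j 1) \<le> 1 / 4" and y: "y a = x a \<bullet> b + e"
    and t: "norm (olsx S x y - b) \<le> 1" and K: "K \<ge> 5 / 4"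
  shows "e \<ge> K \<Longrightarrow> olsx (insert a S) x y $ j \<ge> olsx S x y $ j + (K - 5 / 4) / 12 / real (card S)"
    and "e \<le> - K \<Longrightarrow> olsx (insert a S) x y $ j \<le> olsx S x y $ j - (K - 5 / 4) / 12 / real (card S)"
proof -
  let ?N = "real (card S)" and ?t = "olsx S x y"
  define z where "z = matrix_inv (gramx S x) *v x a"
  define m where "m = x a \<bullet> (?t - b)"
  define q where "q = 1 + x a \<bullet> z"
  have N: "?N \<ge> 1" using pos by simp
  have xn: "norm (x a) \<le> 5 / 4"
    using norm_triangle_ineq[of "x a - axis j 1" "axis j (1::real)"] near by (simp add: norm_axis_1)
  have xj: "x a $ j \<ge> 3 / 4"
    using component_le_norm_cart[of "x a - axis j 1" j] near by (simp add: axis_def abs_le_iff)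
  note inv = well_conditioned_inverse[OF wc pos, of "x a", folded z_def]
  \<comment> \<open>3/4 - (5/4)/3 = 1/3.\<close>
  have zj: "?N * z $ j \<ge> 1 / 3"
    using component_le_norm_cart[of "?N *\<^sub>R z - x a" j] inv(3) xn xj by (simp add: abs_le_iff)
  \<comment> \<open>1 + (5/4)(5/3) = 37/12, which is below 4.\<close>
  have q: "1 \<le> q" "q \<le> 4"
  proof -
    show "1 \<le> q" using olsx_insert(2)[OF S well_conditioned_invertible[OF wc pos]] by (simp add: q_def z_def)
    have "norm z \<le> ?N * norm z" using N by (simp add: mult_le_cancel_right1)
    also have "\<dots> \<le> 5 / 3" using inv(1) xn by linarith
    finally have "norm (x a) * norm z \<le> 5 / 4 * (5 / 3)" using xn by (intro mult_mono) auto
    then show "q \<le> 4" using norm_cauchy_schwarz[of "x a" z] by (simp add: q_def)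
  qed
  have m: "\<bar>m\<bar> \<le> 5 / 4"
  proof -
    have "\<bar>m\<bar> \<le> norm (x a) * norm (?t - b)" unfolding m_def by (rule Cauchy_Schwarz_ineq2)
    also have "\<dots> \<le> 5 / 4 * 1" using xn t by (intro mult_mono) auto
    finally show ?thesis by simp
  qed
  have eq: "olsx (insert a S) x y $ j = ?t $ j + (e - m) / q * z $ j"
    unfolding olsx_insert(1)[OF S well_conditioned_invertible[OF wc pos]] z_def[symmetric]
    by (simp add: y q_def m_def inner_diff_right)
  have zj': "z $ j \<ge> 1 / (3 * ?N)"
    using zj N by (simp add: field_simps)
  have push: "r / q * z $ j \<ge> (K - 5 / 4) / 12 / ?N" if "r \<ge> K - 5 / 4" for r
  proof -
    have "(K - 5 / 4) / 4 \<le> r / q"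
      using that q K by (intro frac_le) auto
    then have "(K - 5 / 4) / 4 * (1 / (3 * ?N)) \<le> r / q * z $ j"
      using zj' K q that by (intro mult_mono) auto
    then show ?thesis by simp
  qed
  show "olsx (insert a S) x y $ j \<ge> ?t $ j + (K - 5 / 4) / 12 / ?N" if "e \<ge> K"
    unfolding eq using push[of "e - m"] m that by auto
  show "olsx (insert a S) x y $ j \<le> ?t $ j - (K - 5 / 4) / 12 / ?N" if "e \<le> - K"
  proof -
    have "(m - e) / q * z $ j = - ((e - m) / q * z $ j)" by (simp add: minus_divide_left algebra_simps)
    moreover have "m - e \<ge> K - 5 / 4" using m that by linarith
    then have "(K - 5 / 4) / 12 / ?N \<le> (m - e) / q * z $ j" by (rule push)
    ultimately show ?thesis unfolding eq by linarith
  qed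
qed

text \<open>12/25 = (3/4)(4/5)^2, from the lower bounds on the quadratic form and on the norm of the
  column. It keeps the conditional variance from being too small, which would push the threshold
  into the Gaussian tail.\<close>

lemma gcol_ge:
  assumes wc: "well_conditioned S x" and pos: "card S > 0"
  shows "gcol S x j $ j \<ge> 12 / (25 * real (card S))"
proof -
  let ?N = "real (card S)" and ?y = "gcol S x j"
  have N: "?N > 0" using pos by simp
  have "4 / 5 * norm (axis j 1 :: real ^ 'b) \<le> ?N * norm ?y"
    using well_conditioned_inverse(2)[OF wc pos, of "axis j 1"] by (simp add: gcol_def)
  then have "4 / 5 \<le> ?N * norm ?y" by (simp add: norm_axis_1)
  then have "(4 / 5)\<^sup>2 \<le> (?N * norm ?y)\<^sup>2" by (intro power_mono) auto
  then have "16 / 25 \<le> ?N * (?N * (norm ?y)\<^sup>2)" by (simp add: power2_eq_square mult_ac)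
  moreover have "3 / 4 * (?N * (norm ?y)\<^sup>2) \<le> ?y $ j"
    using well_conditioned_quad[OF wc, of ?y] sum_gcol_square[OF well_conditioned_invertible[OF wc pos], of j] by simp
  then have "?N * (3 / 4 * (?N * (norm ?y)\<^sup>2)) \<le> ?N * ?y $ j" using N by (intro mult_left_mono) auto
  ultimately have "12 / 25 \<le> ?y $ j * ?N" by (simp add: mult.commute)
  then show ?thesis using N by (simp add: divide_le_eq pos_divide_le_eq mult.commute mult.left_commute)
qed

section \<open>Lower bounds for Gaussian probabilities\<close>

context prob_space
begin

text \<open>A centred normal density is smallest on the interval at the endpoint farthest from
  0.\<close>

lemma normal_interval:
  assumes N: "distributed M lborel N (normal_density 0 s)" and s: "s > 0" and uv: "u \<le> v"
  shows "prob {w\<in>space M. N w \<in> {u..v}} \<ge> (v - u) * normal_density 0 s (max \<bar>u\<bar> \<bar>v\<bar>)"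
proof -
  let ?d = "normal_density 0 s (max \<bar>u\<bar> \<bar>v\<bar>)"
  have le: "?d \<le> normal_density 0 s t" if "t \<in> {u..v}" for t
  proof -
    have "\<bar>t\<bar> \<le> max \<bar>u\<bar> \<bar>v\<bar>" using that by auto
    then have "t\<^sup>2 \<le> (max \<bar>u\<bar> \<bar>v\<bar>)\<^sup>2" by (metis abs_ge_zero power2_abs power_mono)
    then show ?thesis using s by (simp add: normal_density_def divide_right_mono)
  qed
  have "ennreal ((v - u) * ?d) = (\<integral>\<^sup>+t. ennreal ?d * indicator {u..v} t \<partial>lborel)"
    using uv by (subst nn_integral_cmult_indicator) (auto simp: ennreal_mult mult.commute)
  also have "\<dots> \<le> (\<integral>\<^sup>+t. ennreal (normal_density 0 s t) * indicator {u..v} t \<partial>lborel)"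
    by (intro nn_integral_mono) (auto simp: indicator_def intro!: ennreal_leI le)
  also have "\<dots> = emeasure M (N -` {u..v} \<inter> space M)"
    by (rule distributed_emeasure[OF N, symmetric]) simp
  also have "N -` {u..v} \<inter> space M = {w\<in>space M. N w \<in> {u..v}}" by auto
  finally show ?thesis by (simp add: emeasure_eq_measure)
qed

lemma normal_interval_pos:
  assumes N: "distributed M lborel N (normal_density 0 s)" and s: "s > 0" and uv: "u < v"
  shows "prob {w\<in>space M. N w \<in> {u..v}} > 0"
  using normal_interval[OF N s less_imp_le[OF uv]] normal_density_pos[OF s, of 0 "max \<bar>u\<bar> \<bar>v\<bar>"] uv
  by (meson diff_gt_0_iff_gt less_le_trans mult_pos_pos)

lemma gaussian_ball_pos:
  fixes U :: "'a \<Rightarrow> real ^ 'p"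
  assumes U: "distributed M lborel U (\<lambda>x. ennreal (std_gaussian_density x))" and r: "r > 0"
  shows "prob {w\<in>space M. norm (U w - a) \<le> r} > 0"
proof -
  \<comment> \<open>The coordinate box of this half-width lies in the ball, because the norm is at
    most the sum of the absolute coordinates.\<close>
  let ?h = "r / real CARD('p)"
  have h: "?h > 0" using r by simp
  have [measurable]: "U \<in> borel_measurable M" using distributed_measurable[OF U] by simp
  have "0 < (\<Prod>j\<in>UNIV. prob {w\<in>space M. U w $ j \<in> {a $ j - ?h..a $ j + ?h}})"
    by (intro prod_pos ballI normal_interval_pos[OF gaussian_component[OF U]]) (use h in auto)
  also have "\<dots> = (\<Prod>j\<in>UNIV. prob ((\<lambda>w. U w $ j) -` {a $ j - ?h..a $ j + ?h} \<inter> space M))"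
    by (intro prod.cong refl arg_cong[where f = prob]) auto
  also have "\<dots> = prob (\<Inter>j\<in>UNIV. (\<lambda>w. U w $ j) -` {a $ j - ?h..a $ j + ?h} \<inter> space M)"
    by (rule indep_varsD_finite[OF gaussian_components_indep[OF U], symmetric]) auto
  also have "\<dots> \<le> prob {w\<in>space M. norm (U w - a) \<le> r}"
  proof (rule finite_measure_mono)
    show "(\<Inter>j\<in>UNIV. (\<lambda>w. U w $ j) -` {a $ j - ?h..a $ j + ?h} \<inter> space M) \<subseteq> {w\<in>space M. norm (U w - a) \<le> r}"
    proof
      fix w assume w: "w \<in> (\<Inter>j\<in>UNIV. (\<lambda>w. U w $ j) -` {a $ j - ?h..a $ j + ?h} \<inter> space M)"
      have "norm (U w - a) \<le> (\<Sum>j\<in>UNIV. \<bar>(U w - a) $ j\<bar>)" by (rule norm_le_l1_cart)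
      also have "\<dots> \<le> (\<Sum>j\<in>(UNIV :: 'p set). ?h)"
        by (intro sum_mono) (use w in \<open>auto simp: abs_le_iff algebra_simps\<close>)
      finally show "w \<in> {w\<in>space M. norm (U w - a) \<le> r}" using w by auto
    qed
  qed measurable
  finally show ?thesis .
qed

lemma prob_indep_rv:
  assumes ind: "indep_rv S U T V" and [measurable]: "Measurable.pred S P" "Measurable.pred T Q"
  shows "prob {w\<in>space M. P (U w) \<and> Q (V w)} = prob {w\<in>space M. P (U w)} * prob {w\<in>space M. Q (V w)}"
proof -
  have U: "U -` {x\<in>space S. P x} \<inter> space M = {w\<in>space M. P (U w)}"
    using measurable_space[OF indep_rv_measurable(1)[OF ind]] by auto
  have V: "V -` {x\<in>space T. Q x} \<inter> space M = {w\<in>space M. Q (V w)}"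
    using measurable_space[OF indep_rv_measurable(2)[OF ind]] by auto
  have "prob ((U -` {x\<in>space S. P x} \<inter> space M) \<inter> (V -` {x\<in>space T. Q x} \<inter> space M)) =
      prob (U -` {x\<in>space S. P x} \<inter> space M) * prob (V -` {x\<in>space T. Q x} \<inter> space M)"
  proof -
    have "{x\<in>space S. P x} \<in> sets S" "{x\<in>space T. Q x} \<in> sets T" by measurable
    then show ?thesis using ind unfolding indep_rv_def by blast
  qed
  moreover have "{w\<in>space M. P (U w)} \<inter> {w\<in>space M. Q (V w)} = {w\<in>space M. P (U w) \<and> Q (V w)}" by auto
  ultimately show ?thesis unfolding U V by simp
qed

end

lemma divide_sqrt_eq:
  fixes n k :: real
  assumes "n > 0"
  shows "k / sqrt n = 1 / n * (sqrt n * k)"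
proof -
  have "n = sqrt n * sqrt n" using assms by simp
  then have "1 / n * (sqrt n * k) = 1 / (sqrt n * sqrt n) * (sqrt n * k)" by (rule arg_cong)
  also have "\<dots> = k / sqrt n" using assms by (simp del: real_sqrt_mult_self)
  finally show ?thesis ..
qed

text \<open>Deviation and argument are both of order 1/sqrt n: the prefactor is then of order sqrt n
  and the exponent stays bounded. The exponent 25 C / (24 \<tau>^2) is C divided by twice the lower
  variance constant 12 \<tau>^2 / 25.\<close>

lemma normal_density_ge:
  fixes s \<tau> C n v :: real
  assumes \<tau>: "\<tau> > 0" and n: "n > 0" and s: "s > 0" and s2: "s\<^sup>2 \<le> \<tau>\<^sup>2 * (8 / (3 * n))" "s\<^sup>2 \<ge> \<tau>\<^sup>2 * (12 / (25 * n))"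
    and v: "v\<^sup>2 \<le> C / n"
  shows "normal_density 0 s v \<ge> sqrt n * (1 / sqrt (2 * pi * (\<tau>\<^sup>2 * (8 / 3))) * exp (- (25 * C) / (24 * \<tau>\<^sup>2)))"
proof -
  have C: "C \<ge> 0" using v n zero_le_power2[of v] by (metis divide_neg_pos not_le order_trans)
  have e: "v\<^sup>2 / (2 * s\<^sup>2) \<le> (25 * C) / (24 * \<tau>\<^sup>2)"
  proof -
    have "v\<^sup>2 / (2 * s\<^sup>2) \<le> (C / n) / (2 * (\<tau>\<^sup>2 * (12 / (25 * n))))"
      using v s2(2) \<tau> n C by (intro frac_le) auto
    also have "\<dots> = (25 * C) / (24 * \<tau>\<^sup>2)" using n \<tau> by (simp add: field_simps)
    finally show ?thesis .
  qed
  have "sqrt (2 * pi * s\<^sup>2) \<le> sqrt (2 * pi * (\<tau>\<^sup>2 * (8 / (3 * n))))"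
    by (intro real_sqrt_le_mono mult_left_mono s2(1)) simp
  also have "\<dots> = sqrt (2 * pi * (\<tau>\<^sup>2 * (8 / 3))) / sqrt n"
    by (subst real_sqrt_divide[symmetric]) simp
  finally have "1 / (sqrt (2 * pi * (\<tau>\<^sup>2 * (8 / 3))) / sqrt n) \<le> 1 / sqrt (2 * pi * s\<^sup>2)"
    using s \<tau> n by (intro divide_left_mono) auto
  then have "sqrt n * (1 / sqrt (2 * pi * (\<tau>\<^sup>2 * (8 / 3)))) \<le> 1 / sqrt (2 * pi * s\<^sup>2)" by simp
  moreover have "exp (- (25 * C) / (24 * \<tau>\<^sup>2)) \<le> exp (- v\<^sup>2 / (2 * s\<^sup>2))"
    using e by simp
  ultimately have "sqrt n * (1 / sqrt (2 * pi * (\<tau>\<^sup>2 * (8 / 3)))) * exp (- (25 * C) / (24 * \<tau>\<^sup>2))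
      \<le> 1 / sqrt (2 * pi * s\<^sup>2) * exp (- v\<^sup>2 / (2 * s\<^sup>2))"
    using n \<tau> by (intro mult_mono) auto
  then show ?thesis by (simp add: normal_density_def mult.assoc)
qed

context glm
begin

lemma res_comb_second_moment:
  assumes "finite S"
  shows "integrable M (\<lambda>w. (\<Sum>i\<in>S. c i * res i w)\<^sup>2)"
    and "expectation (\<lambda>w. (\<Sum>i\<in>S. c i * res i w)\<^sup>2) = \<tau>\<^sup>2 * (\<Sum>i\<in>S. (c i)\<^sup>2)"
proof -
  show i: "integrable M (\<lambda>w. (\<Sum>i\<in>S. c i * res i w)\<^sup>2)"
    by (rule integrableI_nonneg) (auto simp: nn_integral_res_comb[OF assms])
  have "ennreal (expectation (\<lambda>w. (\<Sum>i\<in>S. c i * res i w)\<^sup>2)) = ennreal (\<tau>\<^sup>2 * (\<Sum>i\<in>S. (c i)\<^sup>2))"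
    using nn_integral_res_comb[OF assms, of c] by (subst (asm) nn_integral_eq_integral[OF i]) auto
  then show "expectation (\<lambda>w. (\<Sum>i\<in>S. c i * res i w)\<^sup>2) = \<tau>\<^sup>2 * (\<Sum>i\<in>S. (c i)\<^sup>2)"
    by (subst (asm) ennreal_inj) (auto intro!: mult_nonneg_nonneg sum_nonneg)
qed

text \<open>Conditionally on a well-conditioned design, the \<open>j\<close>-th least squares coordinate is
  a centred normal variable of standard deviation of order \<open>1 / sqrt n\<close>.\<close>

lemma cond_window_prob:
  assumes S: "finite S" and wc: "well_conditioned S (\<lambda>i. cov i w)" and n: "card S + 1 = n" "n \<ge> 2"
    and b: "\<beta> $ j = 0" and u: "0 \<le> u" "(u + 1 / real n)\<^sup>2 \<le> C / real n"
  defines "t w' \<equiv> olsx S (\<lambda>i. cov i w) (\<lambda>i. cov i w \<bullet> \<beta> + res i w')"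
  shows "prob {w'\<in>space M. t w' $ j \<in> {u..u + 1 / real n} \<and> norm (t w' - \<beta>) \<le> 1} \<ge>
    (1 / sqrt (2 * pi * (\<tau>\<^sup>2 * (8 / 3))) * exp (- (25 * C) / (24 * \<tau>\<^sup>2))) / sqrt (real n)
      - real CARD('p) * (\<tau>\<^sup>2 * (8 / 3)) / real n"
proof -
  let ?x = "\<lambda>i. cov i w" and ?N = "real (card S)" and ?n = "real n"
  let ?a = "\<lambda>k i. ?x i \<bullet> gcol S ?x k"
  have pos: "card S > 0" using n by linarith
  note inv = well_conditioned_invertible[OF wc pos]
  have N: "?N > 0" "?N \<le> ?n" "?n \<le> 2 * ?N" using n by auto
  have n0: "?n > 0" using n by simp
  have t: "t w' $ k = \<beta> $ k + (\<Sum>i\<in>S. ?a k i * res i w')" for k w'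
    unfolding t_def by (subst olsx_linear_model[OF inv]) (auto simp: mult.commute)
  have [measurable]: "t \<in> borel_measurable M" unfolding t_def by measurable
  \<comment> \<open>One observation is left out, and \<open>n \<ge> 2\<close> gives
    \<open>card S \<ge> n / 2\<close>; this turns 4/3 into 8/3.\<close>
  have ub: "gcol S ?x k $ k \<le> 8 / (3 * ?n)" for k
  proof -
    have "gcol S ?x k $ k \<le> 4 / (3 * ?N)" using gcol_le_subset[OF wc pos subset_refl S, of k] .
    also have "\<dots> \<le> 4 / (3 * (?n / 2))" using N n0 by (intro divide_left_mono) auto
    finally show ?thesis by simp
  qed
  have lb: "gcol S ?x k $ k \<ge> 12 / (25 * ?n)" for k
  proof -
    have "12 / (25 * ?n) \<le> 12 / (25 * ?N)" using N by (intro divide_left_mono) auto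
    also have "\<dots> \<le> gcol S ?x k $ k" by (rule gcol_ge[OF wc pos])
    finally show ?thesis .
  qed
  let ?s = "\<tau> * sqrt (gcol S ?x j $ j)"
  have yj: "gcol S ?x j $ j > 0" using lb[of j] n0 by (smt (verit) divide_pos_pos)
  have ex: "\<exists>i\<in>S. ?a j i \<noteq> 0"
  proof (rule ccontr)
    assume "\<not> ?thesis"
    then have "(\<Sum>i\<in>S. (?a j i)\<^sup>2) = 0" by simp
    then show False using sum_gcol_square[OF inv, of j] yj by simp
  qed
  have dist: "distributed M lborel (\<lambda>w'. t w' $ j) (normal_density 0 ?s)"
    using distributed_normal_sum[OF S indep_vars_subset[OF res_indep subset_UNIV] tau_pos res_distributed ex]
    unfolding t b by (simp add: sum_gcol_square[OF inv])
  have s: "?s > 0" using tau_pos yj by simp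
  let ?\<kappa> = "1 / sqrt (2 * pi * (\<tau>\<^sup>2 * (8 / 3))) * exp (- (25 * C) / (24 * \<tau>\<^sup>2))"
  have "?\<kappa> / sqrt ?n = 1 / ?n * (sqrt ?n * ?\<kappa>)"
    by (rule divide_sqrt_eq[OF n0])
  also have "\<dots> \<le> 1 / ?n * normal_density 0 ?s (u + 1 / ?n)"
  proof (intro mult_left_mono normal_density_ge[OF tau_pos n0 s])
    have s2: "?s\<^sup>2 = \<tau>\<^sup>2 * gcol S ?x j $ j" using yj by (simp add: power_mult_distrib)
    show "?s\<^sup>2 \<le> \<tau>\<^sup>2 * (8 / (3 * ?n))" unfolding s2 by (intro mult_left_mono ub) simp
    show "?s\<^sup>2 \<ge> \<tau>\<^sup>2 * (12 / (25 * ?n))" unfolding s2 by (intro mult_left_mono lb) simp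
  qed (use u n0 in auto)
  also have "\<dots> \<le> prob {w'\<in>space M. t w' $ j \<in> {u..u + 1 / ?n}}"
    using normal_interval[OF dist s, of u "u + 1 / ?n"] u n0 by (simp add: max_absorb2)
  finally have p1: "?\<kappa> / sqrt ?n \<le> prob {w'\<in>space M. t w' $ j \<in> {u..u + 1 / ?n}}" .
  \<comment> \<open>Leaving the unit ball around \<open>\<beta>\<close> has conditional probability
    O(1/n) by Chebyshev, of lower order than the window probability 1/sqrt n.\<close>
  have p2: "prob {w'\<in>space M. 1 \<le> norm (t w' - \<beta>)} \<le> real CARD('p) * (\<tau>\<^sup>2 * (8 / 3)) / ?n"
  proof -
    have sq: "(norm (t w' - \<beta>))\<^sup>2 = (\<Sum>k\<in>UNIV. (\<Sum>i\<in>S. ?a k i * res i w')\<^sup>2)" for w'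
      by (simp add: norm_vec_def L2_set_def sum_nonneg t)
    note m = res_comb_second_moment[OF S]
    have "prob {w'\<in>space M. \<bar>norm (t w' - \<beta>)\<bar> \<ge> 1} \<le> expectation (\<lambda>w'. (norm (t w' - \<beta>))\<^sup>2) / 1\<^sup>2"
      by (rule second_moment_method) (auto simp: sq intro: m)
    also have "\<dots> = (\<Sum>k\<in>UNIV. \<tau>\<^sup>2 * (gcol S ?x k $ k))"
      unfolding sq by (simp add: Bochner_Integration.integral_sum m sum_gcol_square[OF inv])
    also have "\<dots> \<le> (\<Sum>k\<in>(UNIV :: 'p set). \<tau>\<^sup>2 * (8 / (3 * ?n)))"
      by (intro sum_mono mult_left_mono ub) auto
    finally show ?thesis by simp
  qed
  have "prob {w'\<in>space M. t w' $ j \<in> {u..u + 1 / ?n}} \<le>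
      prob ({w'\<in>space M. t w' $ j \<in> {u..u + 1 / ?n} \<and> norm (t w' - \<beta>) \<le> 1} \<union> {w'\<in>space M. 1 \<le> norm (t w' - \<beta>)})"
    by (rule finite_measure_mono) auto
  also have "\<dots> \<le> prob {w'\<in>space M. t w' $ j \<in> {u..u + 1 / ?n} \<and> norm (t w' - \<beta>) \<le> 1} + prob {w'\<in>space M. 1 \<le> norm (t w' - \<beta>)}"
    by (rule measure_Un_le) auto
  finally show ?thesis using p1 p2 by linarith
qed

end

section \<open>Lower bound for the loss stability\<close>

context glm
begin

lemma gaussian_push_event_pos:
  assumes "u < v"
  shows "prob {w\<in>space M. norm (cov i w - a) \<le> 1 / 4 \<and> res i w \<in> {u..v}} > 0"
proof -
  have "prob {w\<in>space M. norm (cov i w - a) \<le> 1 / 4 \<and> res i w \<in> {u..v}} =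
      prob {w\<in>space M. norm (cov i w - a) \<le> 1 / 4} * prob {w\<in>space M. res i w \<in> {u..v}}"
    by (rule prob_indep_rv[OF cov_res_single_indep, of "\<lambda>x. norm (x - a) \<le> 1 / 4" "\<lambda>e. e \<in> {u..v}"]) measurable
  then show ?thesis
    using gaussian_ball_pos[OF cov_distributed, of "1/4"] normal_interval_pos[OF res_distributed tau_pos assms] by simp
qed

text \<open>Both estimators are the same function of the common points and of one further
  independent point with the same law. This carries the second moment bound over to the perturbed
  training set.\<close>

lemma nn_integral_est_copy:
  assumes a: "a \<notin> B" "b \<notin> B" and F [measurable]: "F \<in> borel_measurable borel"
    and distr: "distr M borel (point a) = distr M borel (point b)"
  shows "(\<integral>\<^sup>+w. F (est (insert a B) w) \<partial>M) = (\<integral>\<^sup>+w. F (est (insert b B) w) \<partial>M)"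
proof -
  let ?P = "PiM B (\<lambda>_. borel :: ((real ^ 'p) \<times> real) measure)"
  let ?r = "\<lambda>w. \<lambda>i\<in>B. point i w"
  \<comment> \<open>Least squares with the point in slot \<open>a\<close> supplied as a separate
    argument, so that \<open>a\<close> and \<open>b\<close> can be fed into the same map.\<close>
  define \<Phi> where "\<Phi> y = olsx (insert a B) (\<lambda>i. if i = a then fst (snd y) else fst (fst y i))
      (\<lambda>i. if i = a then snd (snd y) else snd (fst y i))"
    for y :: "(nat option \<Rightarrow> (real ^ 'p) \<times> real) \<times> ((real ^ 'p) \<times> real)"
  have m: "\<Phi> \<in> borel_measurable (?P \<Otimes>\<^sub>M borel)"
  proof -
    have z: "(\<lambda>y. fst (snd y)) \<in> borel_measurable (?P \<Otimes>\<^sub>M (borel :: ((real ^ 'p) \<times> real) measure))"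
      "(\<lambda>y. snd (snd y)) \<in> borel_measurable (?P \<Otimes>\<^sub>M (borel :: ((real ^ 'p) \<times> real) measure))"
      by (rule measurable_compose[OF measurable_snd fst_snd_measurable(1)],
          rule measurable_compose[OF measurable_snd fst_snd_measurable(2)])
    have comp: "(\<lambda>y. if i = a then fst (snd y) else fst (fst y i)) \<in> borel_measurable (?P \<Otimes>\<^sub>M (borel :: ((real ^ 'p) \<times> real) measure))"
      "(\<lambda>y. if i = a then snd (snd y) else snd (fst y i)) \<in> borel_measurable (?P \<Otimes>\<^sub>M (borel :: ((real ^ 'p) \<times> real) measure))"
      if i: "i \<in> insert a B" for i
    proof -
      have f: "(\<lambda>y. fst (fst y i)) \<in> borel_measurable (?P \<Otimes>\<^sub>M (borel :: ((real ^ 'p) \<times> real) measure))"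
        "(\<lambda>y. snd (fst y i)) \<in> borel_measurable (?P \<Otimes>\<^sub>M (borel :: ((real ^ 'p) \<times> real) measure))"
        if "i \<in> B"
        by (rule measurable_compose[OF measurable_fst points_fst_snd_measurable(1)[OF that]],
            rule measurable_compose[OF measurable_fst points_fst_snd_measurable(2)[OF that]])
      show "(\<lambda>y. if i = a then fst (snd y) else fst (fst y i)) \<in> borel_measurable (?P \<Otimes>\<^sub>M (borel :: ((real ^ 'p) \<times> real) measure))"
        using i z(1) f(1) by (cases "i = a") simp_all
      show "(\<lambda>y. if i = a then snd (snd y) else snd (fst y i)) \<in> borel_measurable (?P \<Otimes>\<^sub>M (borel :: ((real ^ 'p) \<times> real) measure))"
        using i z(2) f(2) by (cases "i = a") simp_all
    qed
    show ?thesis unfolding \<Phi>_def[abs_def] by (intro borel_measurable_olsx comp)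
  qed
  have law: "(\<integral>\<^sup>+w. F (est (insert c B) w) \<partial>M) = (\<integral>\<^sup>+w. \<integral>\<^sup>+z. F (\<Phi> (?r w, z)) \<partial>distr M borel (point c) \<partial>M)"
    if c: "c \<notin> B" for c
  proof -
    have ind: "indep_rv ?P ?r borel (point c)"
      by (rule indep_rv_restrict_single[OF point_indep]) (use c in auto)
    have e: "est (insert c B) w = \<Phi> (?r w, point c w)" for w
    proof -
      have "insert c B = (\<lambda>i. if i = a then c else i) ` insert a B" using a c by auto
      moreover have "inj_on (\<lambda>i. if i = a then c else i) (insert a B)" using a c by (auto simp: inj_on_def)
      ultimately have "est (insert c B) w = olsx (insert a B) (\<lambda>i. cov (if i = a then c else i) w)
          (\<lambda>i. snd (point (if i = a then c else i) w))"
        by (simp only: est_def olsx_reindex)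
      also have "\<dots> = \<Phi> (?r w, point c w)"
        unfolding \<Phi>_def olsx_def gramx_def using a
        by (intro arg_cong2[where f = "(*v)"] arg_cong[where f = matrix_inv])
          (auto simp: vec_eq_iff cov_def intro!: sum.cong)
      finally show ?thesis .
    qed
    have FP: "(\<lambda>y. F (\<Phi> y)) \<in> borel_measurable (?P \<Otimes>\<^sub>M borel)" using m by measurable
    have rm: "?r w \<in> space ?P" if "w \<in> space M" for w
      using measurable_space[OF indep_rv_measurable(1)[OF ind] that] .
    have "(\<integral>\<^sup>+w. F (est (insert c B) w) \<partial>M) = (\<integral>\<^sup>+w. \<integral>\<^sup>+w'. F (\<Phi> (?r w, point c w')) \<partial>M \<partial>M)"
      unfolding e by (rule nn_integral_indep_rv[OF ind FP])
    also have "\<dots> = (\<integral>\<^sup>+w. \<integral>\<^sup>+z. F (\<Phi> (?r w, z)) \<partial>distr M borel (point c) \<partial>M)"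
    proof (rule nn_integral_cong)
      fix w assume "w \<in> space M"
      then show "(\<integral>\<^sup>+w'. F (\<Phi> (?r w, point c w')) \<partial>M) = (\<integral>\<^sup>+z. F (\<Phi> (?r w, z)) \<partial>distr M borel (point c))"
        using measurable_Pair2[OF FP rm] by (subst nn_integral_distr) simp_all
    qed
    finally show ?thesis .
  qed
  show ?thesis unfolding law[OF a(1)] law[OF a(2)] distr ..
qed

lemma cov_triple_integrable:
  "integrable M (\<lambda>w. (cov i w \<bullet> a) * ((cov i w \<bullet> b) * (cov i w \<bullet> c)))"
proof (rule Bochner_Integration.integrable_bound)
  show "integrable M (\<lambda>w. norm a * norm b * norm c * norm (cov i w) ^ 3)"
    by (intro integrable_mult_right cov_norm_power_integrable)
  show "AE w in M. norm ((cov i w \<bullet> a) * ((cov i w \<bullet> b) * (cov i w \<bullet> c))) \<le>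
      norm (norm a * norm b * norm c * norm (cov i w) ^ 3)"
  proof (rule AE_I2)
    fix w
    let ?x = "cov i w"
    have "\<bar>(?x \<bullet> a) * ((?x \<bullet> b) * (?x \<bullet> c))\<bar> \<le> (norm ?x * norm a) * ((norm ?x * norm b) * (norm ?x * norm c))"
      unfolding abs_mult by (intro mult_mono Cauchy_Schwarz_ineq2) auto
    then show "norm ((?x \<bullet> a) * ((?x \<bullet> b) * (?x \<bullet> c))) \<le> norm (norm a * norm b * norm c * norm ?x ^ 3)"
      by (simp add: power3_eq_cube mult_ac)
  qed
qed measurable

text \<open>The noise of the test point is independent of its covariate, so the term that is linear in
  the noise contributes to the second moment separately.\<close>

lemma loss_gap_difference_second_moment:
  fixes u v u' v' :: "real ^ 'p" and k :: real
  defines "e \<equiv> (v - u) - (v' - u')"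
  shows "ennreal (4 * \<tau>\<^sup>2 * (norm e)\<^sup>2) \<le>
    (\<integral>\<^sup>+w. ennreal ((loss_gap u v (point i w) - loss_gap u' v' (point i w) - k)\<^sup>2) \<partial>M)"
proof -
  \<comment> \<open>The constant \<open>k\<close> will be the difference of the two conditional
    means, fixed once the training points are frozen; it joins the part free of noise.\<close>
  define q where "q x = 2 * ((x \<bullet> \<beta>) * (x \<bullet> e)) - ((x \<bullet> v) * (x \<bullet> v) - (x \<bullet> u) * (x \<bullet> u))
      + ((x \<bullet> v') * (x \<bullet> v') - (x \<bullet> u') * (x \<bullet> u')) - k" for x
  have dec: "loss_gap u v (point i w) - loss_gap u' v' (point i w) - k = 2 * (res i w * (cov i w \<bullet> e)) + q (cov i w)" for w
    unfolding loss_gap_point q_def e_def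
    by (simp add: inner_diff_right power2_eq_square algebra_simps)
  have aq: "integrable M (\<lambda>w. (cov i w \<bullet> e) * q (cov i w))"
  proof -
    have "(x \<bullet> e) * q x = 2 * ((x \<bullet> e) * ((x \<bullet> \<beta>) * (x \<bullet> e))) - ((x \<bullet> e) * ((x \<bullet> v) * (x \<bullet> v)) - (x \<bullet> e) * ((x \<bullet> u) * (x \<bullet> u)))
      + ((x \<bullet> e) * ((x \<bullet> v') * (x \<bullet> v')) - (x \<bullet> e) * ((x \<bullet> u') * (x \<bullet> u'))) - k * (x \<bullet> e)" for x
      by (simp add: q_def algebra_simps)
    then show ?thesis
      by (simp only:, intro Bochner_Integration.integrable_add Bochner_Integration.integrable_diff
        integrable_mult_right cov_triple_integrable cov_inner_integrable)
  qed
  have qm [measurable]: "q \<in> borel_measurable borel" unfolding q_def by measurable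
  note r1 = res_cov_product[of "\<lambda>x. (x \<bullet> e) * q x" i, OF _ aq]
  have r2: "integrable M (\<lambda>w. (cov i w \<bullet> e)\<^sup>2 * (res i w)\<^sup>2)"
    "expectation (\<lambda>w. (cov i w \<bullet> e)\<^sup>2 * (res i w)\<^sup>2) = (norm e)\<^sup>2 * \<tau>\<^sup>2"
    using integral_mult_indep_rv[OF cov_res_single_indep, of "\<lambda>x. (x \<bullet> e)\<^sup>2" "\<lambda>t. t\<^sup>2" i]
      integrable_mult_indep_rv[OF cov_res_single_indep, of "\<lambda>x. (x \<bullet> e)\<^sup>2" "\<lambda>t. t\<^sup>2" i]
      cov_inner_second_moment[of i e] res_power_integrable[of i 2] res_second_moment[of i] by auto
  \<comment> \<open>The square with its \<open>q\<close>-squared term dropped. The cross term has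
    mean 0, which leaves the claimed value; since \<open>?g\<close> may be negative,
    \<open>max 0\<close> provides the passage to a nonnegative integral.\<close>
  let ?g = "\<lambda>w. 4 * ((cov i w \<bullet> e)\<^sup>2 * (res i w)\<^sup>2) + 4 * (res i w * ((cov i w \<bullet> e) * q (cov i w)))"
  have gi: "integrable M ?g"
    by (intro Bochner_Integration.integrable_add integrable_mult_right r2 r1) measurable
  have mi: "integrable M (\<lambda>w. max 0 (?g w))"
    by (rule integrable_max[OF integrable_const gi])
  have E: "4 * \<tau>\<^sup>2 * (norm e)\<^sup>2 = expectation ?g"
    using r1 r2 by (simp add: mult_ac)
  have "ennreal (4 * \<tau>\<^sup>2 * (norm e)\<^sup>2) \<le> ennreal (expectation (\<lambda>w. max 0 (?g w)))"
    unfolding E by (intro ennreal_leI integral_mono gi mi) auto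
  also have "\<dots> = (\<integral>\<^sup>+w. ennreal (max 0 (?g w)) \<partial>M)"
    by (rule nn_integral_eq_integral[OF mi, symmetric]) (intro AE_I2 max.cobounded1)
  also have "\<dots> \<le> (\<integral>\<^sup>+w. ennreal ((loss_gap u v (point i w) - loss_gap u' v' (point i w) - k)\<^sup>2) \<partial>M)"
  proof (intro nn_integral_mono ennreal_leI)
    fix w
    have sq: "(2 * (r * s) + t)\<^sup>2 = 4 * (s\<^sup>2 * r\<^sup>2) + 4 * (r * (s * t)) + t\<^sup>2" for r s t :: real
      by algebra
    have "?g w \<le> (2 * (res i w * (cov i w \<bullet> e)) + q (cov i w))\<^sup>2"
      unfolding sq by simp
    then show "max 0 (?g w) \<le> (loss_gap u v (point i w) - loss_gap u' v' (point i w) - k)\<^sup>2"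
      unfolding dec by simp
  qed
  finally show ?thesis .
qed

end

section \<open>The leave-one-out window and the separation of the two estimates\<close>

context glm_seq
begin

definition base :: "nat \<Rightarrow> nat option set" where
  "base n = Some ` {2..n}"

lemma base: "finite (base n)" "card (base n) = n - 1" "None \<notin> base n" "Some 1 \<notin> base n" "Some 0 \<notin> base n"
  by (auto simp: base_def card_image)

lemma train_eq_insert: "n \<ge> 1 \<Longrightarrow> train n = insert (Some 1) (base n)"
  by (auto simp: train_def base_def image_iff)

text \<open>All three conditions involve only the points common to both training sets; the first two
  are what \<open>olsx_insert_push\<close> requires.\<close>

definition in_window :: "nat \<Rightarrow> 'p \<Rightarrow> 'w \<Rightarrow> bool" where
  "in_window n j w \<longleftrightarrow> well_conditioned (base n) (\<lambda>i. cov i w) \<and> norm (est (base n) w - \<beta>) \<le> 1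
     \<and> est (base n) w $ j \<in> {thr1 n..thr1 n + 1 / real n}"

text \<open>Given a well-conditioned design the window has probability at least \<kappa>/sqrt n -
  D/n, hence eventually \<kappa>/(2 sqrt n). Such designs have probability at least 1/2 for large
  \<open>n\<close>, which leaves \<kappa>/(4 sqrt n).\<close>

lemma prob_in_window:
  assumes b: "\<beta> $ j = 0"
  shows "\<exists>c>0. \<forall>\<^sub>F n in sequentially. prob {w\<in>space M. in_window n j w} \<ge> c / sqrt (real n)"
proof -
  obtain C where C: "C > 0" "\<forall>\<^sub>F n in sequentially. lam n \<le> C * sqrt (real n)" by (rule lam_bound)
  obtain K where K: "K \<ge> 0" "\<And>S. finite S \<Longrightarrow> card S > 0 \<Longrightarrow>
     prob {w\<in>space M. \<not> well_conditioned S (\<lambda>i. cov i w)} \<le> K / real (card S)"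
    using prob_not_well_conditioned by blast
  define \<kappa> where "\<kappa> = 1 / sqrt (2 * pi * (\<tau>\<^sup>2 * (8 / 3))) * exp (- (25 * (C + 1)\<^sup>2) / (24 * \<tau>\<^sup>2))"
  define D where "D = real CARD('p) * (\<tau>\<^sup>2 * (8 / 3))"
  have \<kappa>: "\<kappa> > 0" unfolding \<kappa>_def using tau_pos by simp
  have ev1: "\<forall>\<^sub>F n in sequentially. D / real n \<le> \<kappa> / (2 * sqrt (real n))"
    using \<kappa> by real_asymp
  have ev2: "\<forall>\<^sub>F n in sequentially. K / (real n - 1) \<le> 1 / 2" by real_asymp
  have "\<forall>\<^sub>F n in sequentially. prob {w\<in>space M. in_window n j w} \<ge> (\<kappa> / 4) / sqrt (real n)"
    using ev1 ev2 C(2) eventually_ge_at_top[of 2]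
  proof eventually_elim
    case (elim n)
    let ?S = "base n" and ?n = "real n"
    let ?x = "\<lambda>w. \<lambda>i\<in>?S. cov i w"
    let ?E = "\<lambda>t. norm (t - \<beta>) \<le> 1 \<and> t $ j \<in> {thr1 n..thr1 n + 1 / ?n}"
    let ?F = "\<lambda>t g. indicator {y. well_conditioned ?S (snd y) \<and> ?E (fst y)} (t, g) :: ennreal"
    have n2: "n \<ge> 2" and n0: "?n > 0" using elim by auto
    have cS: "card ?S + 1 = n" using n2 by (simp add: base)
    have wc: "well_conditioned ?S (?x w) = well_conditioned ?S (\<lambda>i. cov i w)" for w
      by (simp add: well_conditioned_def gramx_def)
    have wcm [measurable]: "Measurable.pred M (\<lambda>w. well_conditioned ?S (\<lambda>i. cov i w))" by measurable
    have iwm [measurable]: "Measurable.pred M (in_window n j)"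
      unfolding in_window_def[abs_def] by measurable
    have Fm: "(\<lambda>z. ?F (fst z) (snd z)) \<in> borel_measurable (borel \<Otimes>\<^sub>M PiM ?S (\<lambda>_. borel))"
      unfolding prod.collapse by measurable
    \<comment> \<open>The far end of the window is (lam n + 1)/n, at most (C + 1)/sqrt n: a bounded
      number of conditional standard deviations away from 0.\<close>
    have u: "(thr1 n + 1 / ?n)\<^sup>2 \<le> (C + 1)\<^sup>2 / ?n"
    proof -
      have "1 \<le> sqrt ?n" using n2 by simp
      with elim(3) have "lam n + 1 \<le> C * sqrt ?n + sqrt ?n" by linarith
      then have "lam n + 1 \<le> (C + 1) * sqrt ?n" by (simp add: distrib_right)
      then have "(lam n + 1)\<^sup>2 \<le> ((C + 1) * sqrt ?n)\<^sup>2" using lam_pos[of n] by (intro power_mono) auto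
      then have "(lam n + 1)\<^sup>2 / ?n\<^sup>2 \<le> ((C + 1)\<^sup>2 * ?n) / ?n\<^sup>2"
        by (intro divide_right_mono) (simp_all add: power_mult_distrib)
      moreover have "thr1 n + 1 / ?n = (lam n + 1) / ?n" by (simp add: thr1_def add_divide_distrib)
      moreover have "((C + 1)\<^sup>2 * ?n) / ?n\<^sup>2 = (C + 1)\<^sup>2 / ?n" by (simp add: power2_eq_square)
      ultimately show ?thesis by (simp only: power_divide)
    qed
    have "ennreal (1 / 2) * ennreal (\<kappa> / (2 * sqrt ?n)) \<le>
        emeasure M {w\<in>space M. well_conditioned ?S (\<lambda>i. cov i w)} * ennreal (\<kappa> / (2 * sqrt ?n))"
    proof (rule mult_right_mono)
      have "prob {w\<in>space M. \<not> well_conditioned ?S (\<lambda>i. cov i w)} \<le> 1 / 2"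
      proof -
        have "real (card ?S) = ?n - 1" "card ?S > 0" using n2 by (simp_all add: base of_nat_diff)
        then have "prob {w\<in>space M. \<not> well_conditioned ?S (\<lambda>i. cov i w)} \<le> K / (?n - 1)"
          using K(2)[OF base(1), of n] by simp
        also have "\<dots> \<le> 1 / 2" by (rule elim(2))
        finally show ?thesis .
      qed
      moreover have "prob {w\<in>space M. \<not> well_conditioned ?S (\<lambda>i. cov i w)} =
          1 - prob {w\<in>space M. well_conditioned ?S (\<lambda>i. cov i w)}"
        by (rule prob_neg) measurable
      ultimately show "ennreal (1 / 2) \<le> emeasure M {w\<in>space M. well_conditioned ?S (\<lambda>i. cov i w)}"
        unfolding emeasure_eq_measure by (intro ennreal_leI) linarith
    qed simp
    also have "\<dots> = (\<integral>\<^sup>+w. ennreal (\<kappa> / (2 * sqrt ?n)) * indicator {w\<in>space M. well_conditioned ?S (\<lambda>i. cov i w)} w \<partial>M)"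
      by (simp add: nn_integral_cmult_indicator mult.commute)
    also have "\<dots> \<le> (\<integral>\<^sup>+w. \<integral>\<^sup>+w'. ?F (olsx ?S (\<lambda>i. cov i w) (\<lambda>i. cov i w \<bullet> \<beta> + res i w')) (?x w) \<partial>M \<partial>M)"
    proof (rule nn_integral_mono)
      fix w assume w: "w \<in> space M"
      let ?t = "\<lambda>w'. olsx ?S (\<lambda>i. cov i w) (\<lambda>i. cov i w \<bullet> \<beta> + res i w')"
      show "ennreal (\<kappa> / (2 * sqrt ?n)) * indicator {w\<in>space M. well_conditioned ?S (\<lambda>i. cov i w)} w
          \<le> (\<integral>\<^sup>+w'. ?F (?t w') (?x w) \<partial>M)"
      proof (cases "well_conditioned ?S (\<lambda>i. cov i w)")
        case True
        have [measurable]: "?t \<in> borel_measurable M" by measurable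
        have "\<kappa> / sqrt ?n - D / ?n \<le> prob {w'\<in>space M. ?t w' $ j \<in> {thr1 n..thr1 n + 1 / ?n} \<and> norm (?t w' - \<beta>) \<le> 1}"
          using cond_window_prob[OF base(1) True cS n2 b thr_nonneg(1) u] by (simp add: \<kappa>_def D_def)
        moreover have "\<kappa> / sqrt ?n = 2 * (\<kappa> / (2 * sqrt ?n))" by simp
        ultimately have "\<kappa> / (2 * sqrt ?n) \<le> prob {w'\<in>space M. ?t w' $ j \<in> {thr1 n..thr1 n + 1 / ?n} \<and> norm (?t w' - \<beta>) \<le> 1}"
          using elim(1) by linarith
        then have "ennreal (\<kappa> / (2 * sqrt ?n)) \<le> emeasure M {w'\<in>space M. ?t w' $ j \<in> {thr1 n..thr1 n + 1 / ?n} \<and> norm (?t w' - \<beta>) \<le> 1}"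
          unfolding emeasure_eq_measure by (rule ennreal_leI)
        also have "\<dots> = (\<integral>\<^sup>+w'. indicator {w'\<in>space M. ?t w' $ j \<in> {thr1 n..thr1 n + 1 / ?n} \<and> norm (?t w' - \<beta>) \<le> 1} w' \<partial>M)"
          by (rule nn_integral_indicator[symmetric]) measurable
        also have "\<dots> = (\<integral>\<^sup>+w'. ?F (?t w') (?x w) \<partial>M)"
          by (intro nn_integral_cong) (use True in \<open>auto simp: indicator_def wc\<close>)
        finally show ?thesis using True w by simp
      qed simp
    qed
    also have "\<dots> = (\<integral>\<^sup>+w. ?F (est ?S w) (?x w) \<partial>M)"
      by (rule est_decouple[OF base(1) Fm, symmetric])
    also have "\<dots> = (\<integral>\<^sup>+w. indicator {w\<in>space M. in_window n j w} w \<partial>M)"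
      by (intro nn_integral_cong) (auto simp: indicator_def wc in_window_def)
    also have "\<dots> = emeasure M {w\<in>space M. in_window n j w}"
      by (rule nn_integral_indicator) measurable
    finally have "ennreal (1 / 2) * ennreal (\<kappa> / (2 * sqrt ?n)) \<le> ennreal (prob {w\<in>space M. in_window n j w})"
      unfolding emeasure_eq_measure .
    moreover have "ennreal (1 / 2) * ennreal (\<kappa> / (2 * sqrt ?n)) = ennreal ((\<kappa> / 4) / sqrt ?n)"
      by (subst ennreal_mult[symmetric]) (use \<kappa> in simp_all)
    ultimately have "ennreal ((\<kappa> / 4) / sqrt ?n) \<le> ennreal (prob {w\<in>space M. in_window n j w})" by simp
    then show ?case by (subst (asm) ennreal_le_iff) auto
  qed
  then show ?thesis using \<kappa> by (intro exI[of _ "\<kappa> / 4"]) auto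
qed

definition copy :: "nat \<Rightarrow> nat option set" where
  "copy n = insert None (base n)"

lemma gap_nonneg: "t \<le> thr1 n \<Longrightarrow> gap n t \<ge> 0"
  using shrink_gap_nonneg[OF thr_nonneg(1,3), of t n] delta_pos[of n] by (simp add: gap_def)

text \<open>With probability of order \<open>1 / sqrt n\<close> the leave-one-out estimate lies within \<open>1 / n\<close> of the
  threshold; independently of that, the point \<open>Z 1\<close> pushes it above the transition zone of
  width \<open>\<delta> n / n\<close> and \<open>Zc\<close> pushes it below.\<close>

lemma gap_separation:
  assumes b0: "\<beta> $ j = 0"
  shows "\<exists>c>0. \<forall>\<^sub>F n in sequentially. c / sqrt (real n) \<le> prob {w\<in>space M.
    gap n (est (train n) w $ j) = - 1 \<and> thr2 n \<le> est (train n) w $ j \<and> 0 \<le> gap n (est (copy n) w $ j)}"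
proof -
  obtain c where c: "c > 0" "\<forall>\<^sub>F n in sequentially. prob {w\<in>space M. in_window n j w} \<ge> c / sqrt (real n)"
    using prob_in_window[OF b0] by blast
  obtain a b where ab: "a > 0" "b > 0" "\<forall>\<^sub>F n in sequentially. a \<le> \<delta> n \<and> \<delta> n \<le> b"
    by (rule delta_bounds)
  \<comment> \<open>Chosen so that either push has length at least (b + 1)/(n - 1). Upwards this
    exceeds the width of the transition zone, at most b/n; downwards it exceeds the width 1/n of the
    window.\<close>
  define K where "K = 12 * (b + 1) + 5 / 4"
  have K: "(K - 5 / 4) / 12 = b + 1" "K \<ge> 5 / 4" using ab by (auto simp: K_def)
  let ?push = "\<lambda>i u v w. norm (cov i w - axis j 1) \<le> 1 / 4 \<and> res i w \<in> {u..v}"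
  define p where "p = prob {w\<in>space M. ?push (Some 1) K (K + 1) w} * prob {w\<in>space M. ?push None (- K - 1) (- K) w}"
  have p: "p > 0" unfolding p_def by (intro mult_pos_pos gaussian_push_event_pos) auto
  have "\<forall>\<^sub>F n in sequentially. (c * p) / sqrt (real n) \<le> prob {w\<in>space M.
    gap n (est (train n) w $ j) = - 1 \<and> thr2 n \<le> est (train n) w $ j \<and> 0 \<le> gap n (est (copy n) w $ j)}"
    using c(2) ab(3) eventually_ge_at_top[of 2]
  proof eventually_elim
    case (elim n)
    let ?S = "base n" and ?T = "{Some 1, None} :: nat option set"
    have n0: "real n > 0" and n1: "n \<ge> 1" using elim by auto
    have N: "card ?S > 0" "real (card ?S) \<le> real n" using elim by (auto simp: base)
    let ?U = "\<lambda>w. \<lambda>i\<in>?S. point i w" and ?V = "\<lambda>w. \<lambda>i\<in>?T. point i w"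
    let ?o = "\<lambda>g :: nat option \<Rightarrow> (real ^ 'p) \<times> real. olsx ?S (\<lambda>i. fst (g i)) (\<lambda>i. snd (g i))"
    let ?Pu = "\<lambda>g :: nat option \<Rightarrow> (real ^ 'p) \<times> real. well_conditioned ?S (\<lambda>i. fst (g i)) \<and>
      norm (?o g - \<beta>) \<le> 1 \<and> ?o g $ j \<in> {thr1 n..thr1 n + 1 / real n}"
    let ?R = "\<lambda>u v z :: (real ^ 'p) \<times> real. norm (fst z - axis j 1) \<le> 1 / 4 \<and> snd z - fst z \<bullet> \<beta> \<in> {u..v}"
    have [measurable]: "Measurable.pred borel (?R u v)" for u v by measurable
    have win: "in_window n j w = ?Pu (?U w)" for w
      unfolding in_window_def est_eq_restrict by (simp add: well_conditioned_def gramx_def cov_def)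
    have push: "?push i u v w = ?R u v (point i w)" for i u v w
      by (simp add: cov_def res_def)
    note [measurable] = points_fst_snd_measurable[of _ ?S]
    have mPu: "Measurable.pred (PiM ?S (\<lambda>_. borel)) ?Pu"
      using olsx_points_measurable[of ?S] by measurable
    have "prob {w\<in>space M. ?Pu (?U w) \<and> (?R K (K + 1) (?V w (Some 1)) \<and> ?R (- K - 1) (- K) (?V w None))} =
        prob {w\<in>space M. ?Pu (?U w)} * prob {w\<in>space M. ?R K (K + 1) (?V w (Some 1)) \<and> ?R (- K - 1) (- K) (?V w None)}"
    proof (rule prob_indep_rv[OF indep_rv_restrict[OF point_indep] mPu,
          of ?T "\<lambda>g. ?R K (K + 1) (g (Some 1)) \<and> ?R (- K - 1) (- K) (g None)"])
      have "(\<lambda>g. g (Some 1)) \<in> measurable (PiM ?T (\<lambda>_. borel :: ((real ^ 'p) \<times> real) measure)) borel"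
        "(\<lambda>g. g None) \<in> measurable (PiM ?T (\<lambda>_. borel :: ((real ^ 'p) \<times> real) measure)) borel"
        by (rule measurable_component_singleton, simp)+
      then show "Measurable.pred (PiM ?T (\<lambda>_. borel)) (\<lambda>g. ?R K (K + 1) (g (Some 1)) \<and> ?R (- K - 1) (- K) (g None))"
        using measurable_compose[of _ _ borel "?R K (K + 1)"] measurable_compose[of _ _ borel "?R (- K - 1) (- K)"]
        by (intro pred_intros_logic) auto
    qed (use base(3,4) in auto)
    also have "prob {w\<in>space M. ?R K (K + 1) (?V w (Some 1)) \<and> ?R (- K - 1) (- K) (?V w None)} = p"
      using prob_indep_rv[OF indep_rv_pair[OF point_indep UNIV_I UNIV_I, of "Some 1" None], of "?R K (K + 1)" "?R (- K - 1) (- K)"]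
      unfolding p_def push by simp
    finally have eq: "prob {w\<in>space M. in_window n j w \<and> ?push (Some 1) K (K + 1) w \<and> ?push None (- K - 1) (- K) w} =
        prob {w\<in>space M. in_window n j w} * p"
      unfolding win push by simp
    have "(c * p) / sqrt (real n) = c / sqrt (real n) * p" by simp
    also have "\<dots> \<le> prob {w\<in>space M. in_window n j w} * p"
      by (rule mult_right_mono[OF elim(1)]) (use p in simp)
    also have "\<dots> \<le> prob {w\<in>space M. gap n (est (train n) w $ j) = - 1 \<and> thr2 n \<le> est (train n) w $ j
        \<and> 0 \<le> gap n (est (copy n) w $ j)}"
      unfolding eq[symmetric]
    proof (rule finite_measure_mono)
      show "{w\<in>space M. in_window n j w \<and> ?push (Some 1) K (K + 1) w \<and> ?push None (- K - 1) (- K) w} \<subseteq>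
          {w\<in>space M. gap n (est (train n) w $ j) = - 1 \<and> thr2 n \<le> est (train n) w $ j \<and> 0 \<le> gap n (est (copy n) w $ j)}"
      proof safe
        fix w assume w: "in_window n j w" and near: "norm (cov (Some 1) w - axis j 1) \<le> 1 / 4" "norm (cov None w - axis j 1) \<le> 1 / 4"
          and e: "res (Some 1) w \<in> {K..K + 1}" "res None w \<in> {- K - 1..- K}"
        have wc: "well_conditioned ?S (\<lambda>i. cov i w)" and t: "norm (olsx ?S (\<lambda>i. cov i w) (\<lambda>i. snd (point i w)) - \<beta>) \<le> 1"
          and tj: "thr1 n \<le> est ?S w $ j" "est ?S w $ j \<le> thr1 n + 1 / real n"
          using w by (auto simp: in_window_def est_def)
        have y: "snd (point i w) = cov i w \<bullet> \<beta> + res i w" for i by (simp add: point_eq)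
        have frac: "x / real n \<le> x / real (card ?S)" if "x \<ge> 0" for x
          using that N n0 by (intro divide_left_mono) auto
        have up: "thr2 n \<le> est (train n) w $ j"
        proof -
          have "est ?S w $ j + (b + 1) / real (card ?S) \<le> est (train n) w $ j"
            using olsx_insert_push(1)[OF base(1,4) wc N(1) near(1) y t K(2)] e
            by (simp add: est_def train_eq_insert[OF n1] K(1))
          moreover have "\<delta> n / real n \<le> (b + 1) / real (card ?S)"
            using frac[of "\<delta> n"] divide_right_mono[of "\<delta> n" "b + 1" "real (card ?S)"] elim(2) delta_pos[of n] by simp
          ultimately show ?thesis using tj thr_diff[of n] n1 by simp
        qed
        moreover have pos: "thr2 n > 0" using lam_pos[of n] delta_pos[of n] n0 by (simp add: thr2_def)
        ultimately show "gap n (est (train n) w $ j) = - 1"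
          using gap_large[of n "est (train n) w $ j"] n1 by simp
        show "thr2 n \<le> est (train n) w $ j" by (rule up)
        have "est (copy n) w $ j \<le> est ?S w $ j - (b + 1) / real (card ?S)"
          using olsx_insert_push(2)[OF base(1,3) wc N(1) near(2) y t K(2)] e
          by (simp add: est_def copy_def K(1))
        moreover have "1 / real n \<le> (b + 1) / real (card ?S)"
          using frac[of 1] divide_right_mono[of 1 "b + 1" "real (card ?S)"] ab(2) by simp
        ultimately show "0 \<le> gap n (est (copy n) w $ j)"
          using tj by (intro gap_nonneg) linarith
      qed
    qed measurable
    finally show ?case .
  qed
  then show ?thesis using c(1) p by (intro exI[of _ "c * p"]) auto
qed

lemma est_pair_indep:
  assumes "i \<notin> S" "i \<notin> S'"
  shows "indep_rv (borel \<Otimes>\<^sub>M borel) (\<lambda>w. (est S w, est S' w)) borel (point i)"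
proof -
  let ?r = "\<lambda>w. \<lambda>l\<in>S \<union> S'. point l w"
  let ?o = "\<lambda>S g. olsx S (\<lambda>i. fst (g i)) (\<lambda>i. snd (g i)) :: real ^ 'p"
  have "indep_rv (PiM (S \<union> S') (\<lambda>_. borel)) ?r borel (point i)"
    by (rule indep_rv_restrict_single[OF point_indep]) (use assms in auto)
  then have "indep_rv (borel \<Otimes>\<^sub>M borel) (\<lambda>w. (?o S (?r w), ?o S' (?r w))) borel (\<lambda>w. point i w)"
    by (rule indep_rv_compose) (intro measurable_Pair olsx_points_measurable_subset, auto)
  moreover have "?o S (?r w) = est S w" "?o S' (?r w) = est S' w" for w
    by (simp_all add: est_def olsx_def gramx_def cov_def)
  ultimately show ?thesis by simp
qed

text \<open>The mean of the loss difference over a fresh test point when the estimate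
  \<open>t\<close> is held fixed, in the closed form given by
  \<open>expectation_loss_gap\<close>.\<close>

definition mean_gap :: "nat \<Rightarrow> real ^ 'p \<Rightarrow> real" where
  "mean_gap n t = 2 * (\<beta> \<bullet> (shrink_vec (thr2 n) t - shrink_vec (thr1 n) t))
     - ((norm (shrink_vec (thr2 n) t))\<^sup>2 - (norm (shrink_vec (thr1 n) t))\<^sup>2)"

lemma mean_gap_measurable [measurable]: "mean_gap n \<in> borel_measurable borel"
  unfolding mean_gap_def[abs_def] by measurable

lemma mean_gap_square_integrable:
  assumes "integrable M (\<lambda>w. (norm (est S w))\<^sup>2)"
  shows "integrable M (\<lambda>w. (mean_gap n (est S w))\<^sup>2)"
proof (rule Bochner_Integration.integrable_bound)
  let ?D = "real CARD('p) * (thr2 n - thr1 n)"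
  have D: "?D \<ge> 0" using thr_nonneg(3)[of n] by simp
  show "integrable M (\<lambda>w. ?D\<^sup>2 * (8 * (norm \<beta>)\<^sup>2 + 8 * (norm (est S w))\<^sup>2))"
    by (intro integrable_mult_right Bochner_Integration.integrable_add integrable_const assms)
  show "AE w in M. norm ((mean_gap n (est S w))\<^sup>2) \<le> norm (?D\<^sup>2 * (8 * (norm \<beta>)\<^sup>2 + 8 * (norm (est S w))\<^sup>2))"
  proof (rule AE_I2)
    fix w
    let ?t = "est S w"
    let ?u = "shrink_vec (thr1 n) ?t" and ?v = "shrink_vec (thr2 n) ?t"
    have "mean_gap n ?t = (?v - ?u) \<bullet> (2 *\<^sub>R \<beta> - (?u + ?v))"
      by (simp add: mean_gap_def power2_norm_eq_inner inner_diff_right inner_diff_left inner_add_right inner_commute)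
    also have "\<bar>\<dots>\<bar> \<le> norm (?v - ?u) * norm (2 *\<^sub>R \<beta> - (?u + ?v))" by (rule Cauchy_Schwarz_ineq2)
    also have "\<dots> \<le> ?D * (2 * norm \<beta> + 2 * norm ?t)"
    proof (intro mult_mono norm_shrink_vec_gap_le thr_nonneg(3) D)
      have "norm (2 *\<^sub>R \<beta> - (?u + ?v)) \<le> norm (2 *\<^sub>R \<beta>) + norm (?u + ?v)" by (rule norm_triangle_ineq4)
      then show "norm (2 *\<^sub>R \<beta> - (?u + ?v)) \<le> 2 * norm \<beta> + 2 * norm ?t"
        using norm_shrink_vec_sum_le[OF thr_nonneg(1)[of n] thr_nonneg(2)[of n], of ?t] by simp
    qed simp
    finally have "(mean_gap n ?t)\<^sup>2 \<le> (?D * (2 * norm \<beta> + 2 * norm ?t))\<^sup>2"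
      by (intro abs_le_square_iff[THEN iffD1]) (use D in \<open>simp add: abs_of_nonneg\<close>)
    also have "\<dots> \<le> ?D\<^sup>2 * (8 * (norm \<beta>)\<^sup>2 + 8 * (norm ?t)\<^sup>2)"
    proof -
      have "(2 * x + 2 * y)\<^sup>2 \<le> 8 * x\<^sup>2 + 8 * y\<^sup>2" for x y :: real
        using zero_le_power2[of "2 * x - 2 * y"] by (simp add: power2_eq_square algebra_simps)
      then show ?thesis unfolding power_mult_distrib by (intro mult_left_mono) auto
    qed
    finally show "norm ((mean_gap n ?t)\<^sup>2) \<le> norm (?D\<^sup>2 * (8 * (norm \<beta>)\<^sup>2 + 8 * (norm ?t)\<^sup>2))" by simp
  qed
qed measurable

lemma distr_copy: "distr M borel (point (Some 1)) = distr M borel (point None)"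
  using copy_distr by (simp add: point_def)

text \<open>With both estimates frozen, the centred loss differences form a function of the
  independent test point, whose second moment is bounded below through its noise. On the separating
  event the two gaps in coordinate \<open>j\<close> differ by at least 1.\<close>

lemma loss_stability_ge:
  "\<exists>n0. \<forall>n\<ge>n0. \<forall>j. loss_stability M Z Zc n (h_diff n (lam n) (\<delta> n)) \<ge>
     4 * \<tau>\<^sup>2 * (\<delta> n / real n)\<^sup>2 * prob {w\<in>space M. gap n (est (train n) w $ j) = - 1 \<and>
       thr2 n \<le> est (train n) w $ j \<and> 0 \<le> gap n (est (copy n) w $ j)}"
proof -
  obtain n0 where int: "\<And>n j. n \<ge> n0 \<Longrightarrow> integrable M (\<lambda>w. (est (train n) w $ j - \<beta> $ j)\<^sup>2)"
    using est_second_moment unfolding train_def by metis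
  show ?thesis
  proof (intro exI allI impI)
    fix n j assume n: "n \<ge> max n0 1"
    then have nn0: "n \<ge> n0" and n1: "n \<ge> 1" and npos: "n > 0" by auto
    let ?S = "train n" and ?S' = "copy n" and ?P = "point (Some 0)"
    let ?f = "\<lambda>i. if i = 1 then None else Some i :: nat option"
    let ?u = "shrink_vec (thr1 n) :: real ^ 'p \<Rightarrow> real ^ 'p" and ?v = "shrink_vec (thr2 n) :: real ^ 'p \<Rightarrow> real ^ 'p"
    have fi: "inj_on ?f {1..n}" by (auto simp: inj_on_def split: if_splits)
    have fS: "?f ` {1..n} = ?S'" using n1 by (auto simp: copy_def base_def image_iff Bex_def)
    have 0: "Some 0 \<notin> ?S" "Some 0 \<notin> ?S'" by (auto simp: train_def copy_def base)
    have est2: "integrable M (\<lambda>w. (norm (est ?S w))\<^sup>2)"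
      by (rule norm_est_square_integrable) (rule int[OF nn0])
    have est2': "integrable M (\<lambda>w. (norm (est ?S' w))\<^sup>2)"
    proof (rule integrableI_nonneg)
      have "(\<integral>\<^sup>+w. ennreal ((norm (est ?S' w))\<^sup>2) \<partial>M) = (\<integral>\<^sup>+w. ennreal ((norm (est ?S w))\<^sup>2) \<partial>M)"
        unfolding copy_def train_eq_insert[OF n1]
        by (rule nn_integral_est_copy[OF base(3,4), of "\<lambda>t. ennreal ((norm t)\<^sup>2)", OF _ distr_copy[symmetric]]) measurable
      also have "\<dots> < \<infinity>" using nn_integral_eq_integral[OF est2] by simp
      finally show "(\<integral>\<^sup>+w. ennreal ((norm (est ?S' w))\<^sup>2) \<partial>M) < \<infinity>" .
    qed auto
    define L where "L t z = loss_gap (?u t) (?v t) z" for t z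
    define D where "D w = L (est ?S w) (?P w) - mean_gap n (est ?S w) - (L (est ?S' w) (?P w) - mean_gap n (est ?S' w))" for w
    have Lm [measurable]: "(\<lambda>y. L (fst y) (snd y)) \<in> borel_measurable (borel \<Otimes>\<^sub>M borel)"
      unfolding L_def by measurable
    have [measurable]: "(\<lambda>w. L (est S w) (?P w)) \<in> borel_measurable M" for S unfolding L_def by measurable
    have Dm [measurable]: "D \<in> borel_measurable M" unfolding D_def by measurable
    have "loss_stability M Z Zc n (h_diff n (lam n) (\<delta> n)) = expectation (\<lambda>w. (D w)\<^sup>2)"
      unfolding loss_stability_def Let_def
    proof (rule integral_cong_AE)
      let ?h = "h_diff n (lam n) (\<delta> n) :: (real ^ 'p) \<times> real \<Rightarrow> _"
      have Z0: "Z 0 = ?P" by (simp add: point_def)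
      have h1: "?h (?P w) (training_set n Z w) = L (est ?S w) (?P w)" for w
        using ols_training_set[OF inj_Some, of n w]
        by (simp only: h_diff_eq_loss_gap Z_eq_point[symmetric] L_def train_def thr1_def thr2_def)
      have h2: "?h (?P w) (training_set n (Z(1 := Zc)) w) = L (est ?S' w) (?P w)" for w
        using ols_training_set[OF fi, of w]
        by (simp only: h_diff_eq_loss_gap Z_copy_eq_point[symmetric] L_def fS thr1_def thr2_def)
      have c1: "AE w in M. cond_exp_train M Z n ?h w = mean_gap n (est ?S w)"
        using cond_exp_train_h_diff[OF npos lam_pos[of n] delta_pos[of n] inj_Some
            0(1)[unfolded train_def] est2[unfolded train_def]]
        by (simp only: Z_eq_point[symmetric] mean_gap_def train_def thr1_def thr2_def)
      have c2: "AE w in M. cond_exp_train M (Z(1 := Zc)) n ?h w = mean_gap n (est ?S' w)"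
        using cond_exp_train_h_diff[OF npos lam_pos[of n] delta_pos[of n] fi] 0(2) est2'
        unfolding fS Z_copy_eq_point[symmetric] by (simp add: mean_gap_def thr1_def thr2_def)
      show "AE w in M. (?h (Z 0 w) (training_set n Z w) - cond_exp_train M Z n ?h w -
          (?h (Z 0 w) (training_set n (Z(1 := Zc)) w) - cond_exp_train M (Z(1 := Zc)) n ?h w))\<^sup>2 = (D w)\<^sup>2"
        using c1 c2
      proof eventually_elim
        case (elim w)
        then show ?case unfolding Z0 h1 h2 D_def by (simp only:)
      qed
      show "(\<lambda>w. (?h (Z 0 w) (training_set n Z w) - cond_exp_train M Z n ?h w -
          (?h (Z 0 w) (training_set n (Z(1 := Zc)) w) - cond_exp_train M (Z(1 := Zc)) n ?h w))\<^sup>2) \<in> borel_measurable M"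
        unfolding Z0 h1 h2 cond_exp_train_def by measurable
    qed measurable
    \<comment> \<open>The lower bound is proved for a nonnegative integral. It passes to the
      Lebesgue integral in \<open>loss_stability\<close> only for an integrable square, since the
      latter is 0 by default otherwise.\<close>
    moreover have D2: "integrable M (\<lambda>w. (D w)\<^sup>2)"
    proof (rule Bochner_Integration.integrable_bound)
      have Li: "integrable M (\<lambda>w. (L (est S w) (?P w))\<^sup>2)" if "Some 0 \<notin> S" "integrable M (\<lambda>w. (norm (est S w))\<^sup>2)" for S
        using h_diff_square_integrable[OF npos lam_pos[of n] delta_pos[of n] that]
        by (simp add: L_def thr1_def thr2_def)
      show "integrable M (\<lambda>w. 4 * ((L (est ?S w) (?P w))\<^sup>2 + (mean_gap n (est ?S w))\<^sup>2
          + ((L (est ?S' w) (?P w))\<^sup>2 + (mean_gap n (est ?S' w))\<^sup>2)))"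
        by (intro integrable_mult_right Bochner_Integration.integrable_add Li mean_gap_square_integrable 0 est2 est2')
      have "(a - b - (c - d))\<^sup>2 \<le> 4 * (a\<^sup>2 + b\<^sup>2 + (c\<^sup>2 + d\<^sup>2))" for a b c d :: real
      proof -
        have sq: "(x - y)\<^sup>2 \<le> 2 * x\<^sup>2 + 2 * y\<^sup>2" for x y :: real
          using zero_le_power2[of "x + y"] by (simp add: power2_sum power2_diff del: zero_le_power2)
        have "(a - b - (c - d))\<^sup>2 \<le> 2 * (a - b)\<^sup>2 + 2 * (c - d)\<^sup>2" by (rule sq)
        also have "\<dots> \<le> 2 * (2 * a\<^sup>2 + 2 * b\<^sup>2) + 2 * (2 * c\<^sup>2 + 2 * d\<^sup>2)"
          by (intro add_mono mult_left_mono sq) auto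
        finally show ?thesis by simp
      qed
      then show "AE w in M. norm ((D w)\<^sup>2) \<le> norm (4 * ((L (est ?S w) (?P w))\<^sup>2 + (mean_gap n (est ?S w))\<^sup>2
          + ((L (est ?S' w) (?P w))\<^sup>2 + (mean_gap n (est ?S' w))\<^sup>2)))"
        unfolding D_def by (intro AE_I2) (simp add: abs_of_nonneg)
    qed measurable
    moreover have "ennreal (4 * \<tau>\<^sup>2 * (\<delta> n / real n)\<^sup>2 * prob {w\<in>space M. gap n (est ?S w $ j) = - 1 \<and>
       thr2 n \<le> est ?S w $ j \<and> 0 \<le> gap n (est ?S' w $ j)}) \<le> (\<integral>\<^sup>+w. ennreal ((D w)\<^sup>2) \<partial>M)"
    proof -
      let ?A = "{w\<in>space M. gap n (est ?S w $ j) = - 1 \<and> thr2 n \<le> est ?S w $ j \<and> 0 \<le> gap n (est ?S' w $ j)}"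
      let ?k = "4 * \<tau>\<^sup>2 * (\<delta> n / real n)\<^sup>2"
      let ?G = "\<lambda>y. ennreal ((L (fst (fst y)) (snd y) - mean_gap n (fst (fst y))
        - (L (snd (fst y)) (snd y) - mean_gap n (snd (fst y))))\<^sup>2)"
      have A: "?A \<in> sets M" by measurable
      have "ennreal (?k * prob ?A) = (\<integral>\<^sup>+w. ennreal ?k * indicator ?A w \<partial>M)"
        using A by (simp add: nn_integral_cmult_indicator emeasure_eq_measure ennreal_mult)
      also have "\<dots> \<le> (\<integral>\<^sup>+w. \<integral>\<^sup>+w'. ?G ((est ?S w, est ?S' w), ?P w') \<partial>M \<partial>M)"
      proof (rule nn_integral_mono)
        fix w
        let ?e = "(?v (est ?S w) - ?u (est ?S w)) - (?v (est ?S' w) - ?u (est ?S' w))"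
        show "ennreal ?k * indicator ?A w \<le> (\<integral>\<^sup>+w'. ?G ((est ?S w, est ?S' w), ?P w') \<partial>M)"
        proof (cases "w \<in> ?A")
          case True
          have "?e $ j = \<delta> n / real n * (gap n (est ?S w $ j) - gap n (est ?S' w $ j))"
          proof -
            have "shrink (thr2 n) t - shrink (thr1 n) t = \<delta> n / real n * gap n t" for t
              using npos delta_pos[of n] by (simp add: gap_def)
            then show ?thesis
              by (simp only: shrink_vec_def vector_minus_component vec_lambda_beta right_diff_distrib)
          qed
          then have "(?e $ j)\<^sup>2 = (\<delta> n / real n)\<^sup>2 * (gap n (est ?S w $ j) - gap n (est ?S' w $ j))\<^sup>2"
            by (simp only: power_mult_distrib)
          moreover have "1\<^sup>2 \<le> (gap n (est ?S' w $ j) - gap n (est ?S w $ j))\<^sup>2"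
            using True by (intro power_mono) auto
          then have "(\<delta> n / real n)\<^sup>2 * 1 \<le> (\<delta> n / real n)\<^sup>2 * (gap n (est ?S w $ j) - gap n (est ?S' w $ j))\<^sup>2"
            by (intro mult_left_mono) (auto simp: power2_commute)
          ultimately have "(\<delta> n / real n)\<^sup>2 \<le> (norm ?e)\<^sup>2"
            using component_square_le_norm[of ?e j] by linarith
          then have "ennreal ?k \<le> ennreal (4 * \<tau>\<^sup>2 * (norm ?e)\<^sup>2)"
            by (intro ennreal_leI mult_left_mono) auto
          also have "\<dots> \<le> (\<integral>\<^sup>+w'. ennreal ((loss_gap (?u (est ?S w)) (?v (est ?S w)) (?P w')
              - loss_gap (?u (est ?S' w)) (?v (est ?S' w)) (?P w') - (mean_gap n (est ?S w) - mean_gap n (est ?S' w)))\<^sup>2) \<partial>M)"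
            by (rule loss_gap_difference_second_moment)
          also have "\<dots> = (\<integral>\<^sup>+w'. ?G ((est ?S w, est ?S' w), ?P w') \<partial>M)"
            by (intro nn_integral_cong) (simp add: L_def algebra_simps)
          finally show ?thesis using True by simp
        qed simp
      qed
      also have "\<dots> = (\<integral>\<^sup>+w. ?G ((est ?S w, est ?S' w), ?P w) \<partial>M)"
      proof (rule nn_integral_indep_rv[OF est_pair_indep[OF 0], symmetric])
        show "?G \<in> borel_measurable ((borel \<Otimes>\<^sub>M borel) \<Otimes>\<^sub>M borel)"
          unfolding L_def by measurable
      qed
      finally show ?thesis unfolding D_def by simp
    qed
    ultimately show "4 * \<tau>\<^sup>2 * (\<delta> n / real n)\<^sup>2 * prob {w\<in>space M. gap n (est ?S w $ j) = - 1 \<and>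
       thr2 n \<le> est ?S w $ j \<and> 0 \<le> gap n (est ?S' w $ j)} \<le> loss_stability M Z Zc n (h_diff n (lam n) (\<delta> n))"
      by (simp add: nn_integral_eq_integral)
  qed
qed

end

section \<open>Conclusion\<close>

lemma zero_less_mult_nonnegD:
  fixes x y :: real
  assumes "0 \<le> x" "0 < x * y"
  shows "0 < y"
  using assms by (simp add: zero_less_mult_iff)

context glm_seq
begin

text \<open>The variance limit is 0 here and yields no positivity. By symmetry the linear
  coefficients have mean 0, so the conditional expectation is a multiple of \<open>- q\<close> for a
  quadratic form \<open>q\<close> in the test covariate, whose mean is the trace of its
  coefficients. This trace is negative. A zero variance would make \<open>q\<close> almost surely
  equal to it, yet \<open>q\<close> is small near the origin, where a Gaussian vector lies with
  positive probability.\<close>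

lemma sigma_sq_pos_if_zero:
  assumes b0: "\<beta> = 0"
  shows "\<forall>\<^sub>F n in sequentially. sigma_sq M Z n (h_diff n (lam n) (\<delta> n)) > 0"
proof -
  obtain n0 where coef: "\<And>n a. n \<ge> n0 \<Longrightarrow> integrable M (\<lambda>w. coef n (est (train n) w) a)"
    and sig: "\<And>n. n \<ge> n0 \<Longrightarrow> (real n)\<^sup>2 / (\<delta> n)\<^sup>2 * sigma_sq M Z n (h_diff n (lam n) (\<delta> n)) =
     variance (\<lambda>w. \<Sum>a\<in>UNIV. expectation (\<lambda>w'. coef n (est (train n) w') a) * feature a w)"
    using sigma_sq_features by blast
  obtain n1 where inv: "\<And>n. n \<ge> n1 \<Longrightarrow> AE w in M. invertible (gramx (train n) (\<lambda>i. cov i w))"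
    using est_second_moment unfolding train_def by metis
  \<comment> \<open>Every coordinate is null, so any one can be used to make the trace strictly
    negative.\<close>
  fix j :: 'p
  have "\<beta> $ j = 0" using b0 by simp
  from gap_separation[OF this] obtain c where c: "c > 0"
    "\<forall>\<^sub>F n in sequentially. c / sqrt (real n) \<le> prob {w\<in>space M.
      gap n (est (train n) w $ j) = - 1 \<and> thr2 n \<le> est (train n) w $ j \<and> 0 \<le> gap n (est (copy n) w $ j)}"
    by blast
  show ?thesis
    using c(2) eventually_ge_at_top[of n0] eventually_ge_at_top[of n1] eventually_gt_at_top[of 0]
  proof eventually_elim
    case (elim n)
    let ?t = "\<lambda>w. est (train n) w"
    define A where "A k l = expectation (\<lambda>w. coef n (?t w) (Inr (k, l)))" for k l
    define q where "q x = (\<Sum>k\<in>UNIV. \<Sum>l\<in>UNIV. A k l * (x $ k * x $ l))" for x :: "real ^ 'p"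
    have npos: "real n > 0" using elim by simp
    \<comment> \<open>A diagonal coefficient is, up to a positive factor, the square of the stronger
      shrinkage minus the square of the weaker one, hence never positive.\<close>
    let ?g = "\<lambda>t. gap n t * (shrink (thr2 n) t + shrink (thr1 n) t)"
    have gle: "?g t \<le> 0" for t
    proof -
      have "?g t = real n / \<delta> n * ((shrink (thr2 n) t)\<^sup>2 - (shrink (thr1 n) t)\<^sup>2)"
      proof -
        have "r * (x - y) * (x + y) = r * (x\<^sup>2 - y\<^sup>2)" for r x y :: real
          by (simp add: power2_eq_square algebra_simps)
        then show ?thesis unfolding gap_def .
      qed
      moreover have "\<bar>shrink (thr2 n) t\<bar>\<^sup>2 \<le> \<bar>shrink (thr1 n) t\<bar>\<^sup>2"
        by (intro power_mono abs_shrink_antimono thr_nonneg) auto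
      then have "real n / \<delta> n * ((shrink (thr2 n) t)\<^sup>2 - (shrink (thr1 n) t)\<^sup>2) \<le> 0"
        using delta_pos[of n] by (intro mult_nonneg_nonpos) auto
      ultimately show ?thesis by simp
    qed
    have Ag: "A k k = expectation (\<lambda>w. ?g (?t w $ k))" for k
      by (simp add: A_def coef_def distrib_left)
    have gi: "integrable M (\<lambda>w. ?g (?t w $ k))" for k
      using coef[OF elim(2), of "Inr (k, k)"] by (simp add: coef_def distrib_left)
    have Ale: "A k k \<le> 0" for k
      unfolding Ag using integral_mono[OF gi[of k], of "\<lambda>_. 0"] gle by simp
    \<comment> \<open>Strictness needs an event of positive probability on which the coordinate lies
      beyond the larger threshold: there the gap is -1 and the weaker shrinkage is strictly
      positive. The separating event supplies it.\<close>
    have Aj: "A j j < 0"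
    proof (rule ccontr)
      assume "\<not> ?thesis"
      then have "expectation (\<lambda>w. - ?g (?t w $ j)) = 0" using Ale[of j] gi[of j] by (simp add: Ag)
      then have "AE w in M. - ?g (?t w $ j) = 0"
        using integral_nonneg_eq_0_iff_AE[of M "\<lambda>w. - ?g (?t w $ j)"] gi[of j] gle by simp
      then have "AE w in M. w \<notin> {w\<in>space M. gap n (?t w $ j) = - 1 \<and> thr2 n \<le> ?t w $ j \<and> 0 \<le> gap n (est (copy n) w $ j)}"
      proof eventually_elim
        case (elim w)
        show ?case
        proof
          assume w: "w \<in> {w\<in>space M. gap n (?t w $ j) = - 1 \<and> thr2 n \<le> ?t w $ j \<and> 0 \<le> gap n (est (copy n) w $ j)}"
          have "thr1 n < thr2 n" using thr_diff[of n] delta_pos[of n] npos by (simp add: algebra_simps)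
          then have "shrink (thr1 n) (?t w $ j) > 0" "shrink (thr2 n) (?t w $ j) \<ge> 0"
            using w thr_nonneg[of n] by (auto simp: shrink_def sgn_if)
          then show False using elim w by simp
        qed
      qed
      then have "prob {w\<in>space M. gap n (?t w $ j) = - 1 \<and> thr2 n \<le> ?t w $ j \<and> 0 \<le> gap n (est (copy n) w $ j)} = 0"
        by (intro prob_eq_0[THEN iffD2]) auto
      moreover have "c / sqrt (real n) > 0" using c(1) npos by simp
      ultimately show False using elim(1) by linarith
    qed
    have tr: "(\<Sum>k\<in>UNIV. A k k) < 0"
    proof -
      have "(\<Sum>k\<in>UNIV. A k k) = A j j + (\<Sum>k\<in>UNIV - {j}. A k k)" by (rule sum.remove) auto
      moreover have "(\<Sum>k\<in>UNIV - {j}. A k k) \<le> 0" by (intro sum_nonpos Ale)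
      ultimately show ?thesis using Aj by linarith
    qed
    let ?q = "\<lambda>w. q (cov (Some 0) w)"
    have qi: "integrable M ?q" and Eq: "expectation ?q = (\<Sum>k\<in>UNIV. A k k)"
    proof -
      show "integrable M ?q" unfolding q_def
        by (intro Bochner_Integration.integrable_sum integrable_mult_right cov_product_integrable)
      have d: "A k l * (if k = l then 1 else 0) = (if l = k then A k l else 0)" for k l by simp
      have "expectation ?q = (\<Sum>k\<in>UNIV. \<Sum>l\<in>UNIV. if l = k then A k l else 0)"
        unfolding q_def
        by (simp add: Bochner_Integration.integral_sum Bochner_Integration.integrable_sum cov_product_integrable cov_product_expectation d)
      then show "expectation ?q = (\<Sum>k\<in>UNIV. A k k)" by simp
    qed
    have feat: "(\<Sum>a\<in>UNIV. expectation (\<lambda>w'. coef n (?t w') a) * feature a w) = - 1 * ?q w" for w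
    proof -
      have "expectation (\<lambda>w'. coef n (?t w') (Inl k)) = 0" for k
        unfolding coef_def using expectation_odd_est[OF finite_train inv[OF elim(3)] _ gap_measurable gap_odd abs_gap_le] b0
        by simp
      then show ?thesis
        by (simp add: sum_UNIV_Plus_Times q_def A_def feature_def sum_negf)
    qed
    define C where "C = (\<Sum>k\<in>UNIV. \<Sum>l\<in>UNIV. \<bar>A k l\<bar>)"
    have C: "C \<ge> 0" by (simp add: C_def sum_nonneg)
    have qle: "\<bar>q x\<bar> \<le> C * (norm x)\<^sup>2" for x
    proof -
      have "\<bar>q x\<bar> \<le> (\<Sum>k\<in>UNIV. \<Sum>l\<in>UNIV. \<bar>A k l * (x $ k * x $ l)\<bar>)"
        unfolding q_def by (intro order_trans[OF sum_abs] sum_mono sum_abs)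
      also have "\<dots> \<le> (\<Sum>k\<in>UNIV. \<Sum>l\<in>UNIV. \<bar>A k l\<bar> * (norm x * norm x))"
        unfolding abs_mult by (intro sum_mono mult_left_mono mult_mono component_le_norm_cart) auto
      finally show ?thesis by (simp add: C_def sum_distrib_right power2_eq_square)
    qed
    have qm [measurable]: "q \<in> borel_measurable borel" unfolding q_def by measurable
    have q2: "integrable M (\<lambda>w. (?q w)\<^sup>2)"
    proof (rule Bochner_Integration.integrable_bound)
      show "integrable M (\<lambda>w. C\<^sup>2 * norm (cov (Some 0) w) ^ 4)"
        by (intro integrable_mult_right cov_norm_power_integrable)
      show "AE w in M. norm ((?q w)\<^sup>2) \<le> norm (C\<^sup>2 * norm (cov (Some 0) w) ^ 4)"
      proof (rule AE_I2)
        fix w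
        have "\<bar>?q w\<bar>\<^sup>2 \<le> (C * (norm (cov (Some 0) w))\<^sup>2)\<^sup>2" by (intro power_mono qle) auto
        then show "norm ((?q w)\<^sup>2) \<le> norm (C\<^sup>2 * norm (cov (Some 0) w) ^ 4)"
          by (simp add: power_mult_distrib power_mult[symmetric])
      qed
    qed measurable
    have var: "variance ?q > 0"
    proof (rule ccontr)
      assume "\<not> ?thesis"
      moreover have "variance ?q \<ge> 0" by simp
      ultimately have "variance ?q = 0" by linarith
      moreover have "integrable M (\<lambda>w. (?q w - expectation ?q)\<^sup>2)"
        using qi q2 by (simp add: power2_diff)
      ultimately have "AE w in M. (?q w - expectation ?q)\<^sup>2 = 0"
        by (subst (asm) integral_nonneg_eq_0_iff_AE) auto
      then have ae: "AE w in M. ?q w = (\<Sum>k\<in>UNIV. A k k)" by (simp add: Eq)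
      \<comment> \<open>On the ball of radius \<open>r\<close> the bound \<open>qle\<close> keeps
        |q| at most half the absolute value of the trace. Using \<open>C + 1\<close> makes the
        denominator positive without a case distinction.\<close>
      define r where "r = sqrt (- (\<Sum>k\<in>UNIV. A k k) / (2 * (C + 1)))"
      have "- (\<Sum>k\<in>UNIV. A k k) / (2 * (C + 1)) > 0" using tr C by (intro divide_pos_pos) auto
      then have r: "r > 0" and r2: "r\<^sup>2 = - (\<Sum>k\<in>UNIV. A k k) / (2 * (C + 1))" by (simp_all add: r_def)
      have "AE w in M. w \<notin> {w\<in>space M. norm (cov (Some 0) w - 0) \<le> r}"
        using ae
      proof eventually_elim
        case (elim w)
        show ?case
        proof
          assume "w \<in> {w\<in>space M. norm (cov (Some 0) w - 0) \<le> r}"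
          then have "(norm (cov (Some 0) w))\<^sup>2 \<le> r\<^sup>2" by (intro power_mono) auto
          then have "C * (norm (cov (Some 0) w))\<^sup>2 \<le> (C + 1) * r\<^sup>2" using C by (intro mult_mono) auto
          also have "\<dots> = - (\<Sum>k\<in>UNIV. A k k) / 2" using C unfolding r2 by (simp add: divide_simps)
          finally show False using qle[of "cov (Some 0) w"] elim tr by linarith
        qed
      qed
      then have "prob {w\<in>space M. norm (cov (Some 0) w - 0) \<le> r} = 0"
        by (intro prob_eq_0[THEN iffD2]) auto
      then show False using gaussian_ball_pos[OF cov_distributed r, of "Some 0" 0] by simp
    qed
    have "(real n)\<^sup>2 / (\<delta> n)\<^sup>2 * sigma_sq M Z n (h_diff n (lam n) (\<delta> n)) = (- 1)\<^sup>2 * variance ?q"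
      unfolding sig[OF elim(2)] feat by (rule variance_cmult)
    then have "(real n)\<^sup>2 / (\<delta> n)\<^sup>2 * sigma_sq M Z n (h_diff n (lam n) (\<delta> n)) > 0"
      using var by simp
    then show ?case by (rule zero_less_mult_nonnegD[rotated]) simp
  qed
qed

lemma sigma_sq_pos: "\<forall>\<^sub>F n in sequentially. sigma_sq M Z n (h_diff n (lam n) (\<delta> n)) > 0"
proof (cases "l0_norm \<beta> = 0")
  case True
  then have "\<beta> = 0" by (simp add: l0_norm_def vec_eq_iff)
  then show ?thesis by (rule sigma_sq_pos_if_zero)
next
  case False
  then have "4 * \<tau>\<^sup>2 * real (l0_norm \<beta>) > 0" using tau_pos by simp
  then have "\<forall>\<^sub>F n in sequentially. 0 < (real n)\<^sup>2 / (\<delta> n)\<^sup>2 * sigma_sq M Z n (h_diff n (lam n) (\<delta> n))"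
    by (rule order_tendstoD(1)[OF sigma_sq_tendsto])
  then show ?thesis
  proof eventually_elim
    case (elim n)
    show ?case by (rule zero_less_mult_nonnegD[OF _ elim]) simp
  qed
qed

lemma loss_stability_lower_bound:
  assumes "l0_norm \<beta> < CARD('p)"
  shows "\<exists>\<kappa>>0. \<forall>\<^sub>F n in sequentially.
    \<kappa> / ((real n)\<^sup>2 * sqrt (real n)) \<le> loss_stability M Z Zc n (h_diff n (lam n) (\<delta> n))"
proof -
  have "{j. \<beta> $ j \<noteq> 0} \<noteq> UNIV" using assms by (auto simp: l0_norm_def)
  then obtain j where j: "\<beta> $ j = 0" by auto
  let ?A = "\<lambda>n. {w\<in>space M. gap n (est (train n) w $ j) = - 1 \<and> thr2 n \<le> est (train n) w $ j
    \<and> 0 \<le> gap n (est (copy n) w $ j)}"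
  obtain c where c: "c > 0" "\<forall>\<^sub>F n in sequentially. c / sqrt (real n) \<le> prob (?A n)"
    using gap_separation[OF j] by blast
  obtain a b where ab: "a > 0" "\<forall>\<^sub>F n in sequentially. a \<le> \<delta> n \<and> \<delta> n \<le> b"
    using delta_bounds by blast
  obtain n0 where n0: "\<And>n. n \<ge> n0 \<Longrightarrow> loss_stability M Z Zc n (h_diff n (lam n) (\<delta> n)) \<ge>
     4 * \<tau>\<^sup>2 * (\<delta> n / real n)\<^sup>2 * prob (?A n)"
    using loss_stability_ge by blast
  have "\<forall>\<^sub>F n in sequentially. (4 * \<tau>\<^sup>2 * a\<^sup>2 * c) / ((real n)\<^sup>2 * sqrt (real n))
      \<le> loss_stability M Z Zc n (h_diff n (lam n) (\<delta> n))"
    using c(2) ab(2) eventually_ge_at_top[of n0]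
  proof eventually_elim
    case (elim n)
    have "(4 * \<tau>\<^sup>2 * a\<^sup>2 * c) / ((real n)\<^sup>2 * sqrt (real n)) = 4 * \<tau>\<^sup>2 * (a / real n)\<^sup>2 * (c / sqrt (real n))"
      by (simp add: power_divide)
    also have "\<dots> \<le> 4 * \<tau>\<^sup>2 * (\<delta> n / real n)\<^sup>2 * prob (?A n)"
      using elim(1,2) ab(1) c(1) by (intro mult_mono mult_left_mono power_mono divide_right_mono) auto
    also have "\<dots> \<le> loss_stability M Z Zc n (h_diff n (lam n) (\<delta> n))" by (rule n0[OF elim(3)])
    finally show ?case .
  qed
  then show ?thesis using c(1) ab(1) tau_pos by (intro exI[of _ "4 * \<tau>\<^sup>2 * a\<^sup>2 * c"]) auto
qed

text \<open>The orders combine to n * n^(-5/2) / n^(-2) = sqrt n. An upper bound on the variance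
  suffices once its eventual positivity permits the division.\<close>

lemma rel_loss_stability_lower_bound:
  assumes "l0_norm \<beta> < CARD('p)"
  shows "\<exists>\<kappa>>0. \<forall>\<^sub>F n in sequentially.
    \<kappa> * sqrt (real n) \<le> rel_loss_stability M Z Zc n (h_diff n (lam n) (\<delta> n))"
proof -
  let ?\<gamma> = "\<lambda>n. loss_stability M Z Zc n (h_diff n (lam n) (\<delta> n))"
  let ?\<sigma> = "\<lambda>n. sigma_sq M Z n (h_diff n (lam n) (\<delta> n))"
  obtain k where k: "k > 0" "\<forall>\<^sub>F n in sequentially. k / ((real n)\<^sup>2 * sqrt (real n)) \<le> ?\<gamma> n"
    using loss_stability_lower_bound[OF assms] by blast
  obtain a b where ab: "b > 0" "\<forall>\<^sub>F n in sequentially. a \<le> \<delta> n \<and> \<delta> n \<le> b"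
    using delta_bounds by blast
  \<comment> \<open>The added 1 leaves room above the limit and keeps \<open>B\<close> positive when
    \<open>\<beta>\<close> is zero.\<close>
  define B where "B = (4 * \<tau>\<^sup>2 * real (l0_norm \<beta>) + 1) * b\<^sup>2"
  have B: "B > 0" using ab(1) by (auto simp: B_def intro!: mult_pos_pos add_nonneg_pos)
  have "\<forall>\<^sub>F n in sequentially. (real n)\<^sup>2 / (\<delta> n)\<^sup>2 * ?\<sigma> n < 4 * \<tau>\<^sup>2 * real (l0_norm \<beta>) + 1"
    by (rule order_tendstoD(2)[OF sigma_sq_tendsto]) simp
  then have "\<forall>\<^sub>F n in sequentially. k / B * sqrt (real n) \<le> rel_loss_stability M Z Zc n (h_diff n (lam n) (\<delta> n))"
    using k(2) ab(2) sigma_sq_pos eventually_gt_at_top[of 0]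
  proof eventually_elim
    case (elim n)
    have n: "real n > 0" using elim by simp
    have "(real n)\<^sup>2 * ?\<sigma> n = (real n)\<^sup>2 / (\<delta> n)\<^sup>2 * ?\<sigma> n * (\<delta> n)\<^sup>2"
      using delta_pos[of n] by simp
    also have "\<dots> \<le> (4 * \<tau>\<^sup>2 * real (l0_norm \<beta>) + 1) * b\<^sup>2"
      using elim(1,3) delta_pos[of n] by (intro mult_mono power_mono) auto
    finally have s: "(real n)\<^sup>2 * ?\<sigma> n \<le> B" by (simp add: B_def)
    have "k / B * sqrt (real n) \<le> k / ((real n)\<^sup>2 * ?\<sigma> n) * sqrt (real n)"
      using s k(1) B n elim(4) by (intro mult_right_mono divide_left_mono mult_pos_pos) auto
    also have "\<dots> = real n * (k / ((real n)\<^sup>2 * sqrt (real n))) / ?\<sigma> n"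
    proof -
      have "sqrt (real n) = real n / sqrt (real n)" by (simp add: real_div_sqrt)
      then have "k / ((real n)\<^sup>2 * ?\<sigma> n) * sqrt (real n) = k / ((real n)\<^sup>2 * ?\<sigma> n) * (real n / sqrt (real n))"
        by (rule arg_cong)
      then show ?thesis by (simp add: mult_ac)
    qed
    also have "\<dots> \<le> real n * ?\<gamma> n / ?\<sigma> n"
      using elim(2,4) n by (intro divide_right_mono mult_left_mono) auto
    finally show ?case by (simp add: rel_loss_stability_def)
  qed
  then show ?thesis using k(1) B by (intro exI[of _ "k / B"]) auto
qed

end

theorem theorem3p1:
  fixes M :: "'w measure"
    and X :: "nat \<Rightarrow> 'w \<Rightarrow> real ^ 'p"
    and Y noise :: "nat \<Rightarrow> 'w \<Rightarrow> real"
    and Z :: "nat \<Rightarrow> 'w \<Rightarrow> (real ^ 'p) \<times> real"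
    and Zc :: "'w \<Rightarrow> (real ^ 'p) \<times> real"
    and \<beta> :: "real ^ 'p"
    and \<tau> :: real
    and lam \<delta> :: "nat \<Rightarrow> real"
  assumes "\<tau> > 0"
    and "gaussian_linear_model M X Y noise Z Zc \<beta> \<tau>"
    and "l0_norm \<beta> < CARD('p)"
    and "\<And>n. lam n > 0" and "\<And>n. \<delta> n > 0"
    and "lam \<in> O(\<lambda>n. sqrt (real n))"
    and "lam \<in> \<omega>(\<lambda>_. 1)"
    and "\<delta> \<in> \<Theta>(\<lambda>_. 1)"
  shows "(\<lambda>n. (real n)\<^sup>2 / (\<delta> n)\<^sup>2 * sigma_sq M Z n (h_diff n (lam n) (\<delta> n)))
           \<longlonglongrightarrow> 4 * \<tau>\<^sup>2 * real (l0_norm \<beta>)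
       \<and> (\<lambda>n. loss_stability M Z Zc n (h_diff n (lam n) (\<delta> n)))
           \<in> \<Omega>(\<lambda>n. 1 / ((real n)\<^sup>2 * sqrt (real n)))
       \<and> (\<lambda>n. rel_loss_stability M Z Zc n (h_diff n (lam n) (\<delta> n)))
           \<in> \<Omega>(\<lambda>n. sqrt (real n))
       \<and> (\<lambda>n. rel_loss_stability M Z Zc n (h_diff n (lam n) (\<delta> n))) \<notin> o(\<lambda>_. 1)"
proof -
  interpret gaussian_linear_model M X Y noise Z Zc \<beta> \<tau> by (rule assms(2))
  interpret glm_seq M X Y noise Z Zc \<beta> \<tau> lam \<delta>
    by unfold_locales (use assms in auto)
  let ?\<gamma> = "\<lambda>n. loss_stability M Z Zc n (h_diff n (lam n) (\<delta> n))"
  let ?r = "\<lambda>n. rel_loss_stability M Z Zc n (h_diff n (lam n) (\<delta> n))"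
  obtain k where k: "k > 0" "\<forall>\<^sub>F n in sequentially. k / ((real n)\<^sup>2 * sqrt (real n)) \<le> ?\<gamma> n"
    using loss_stability_lower_bound[OF assms(3)] by blast
  have g: "?\<gamma> \<in> \<Omega>(\<lambda>n. 1 / ((real n)\<^sup>2 * sqrt (real n)))"
  proof (rule landau_omega.bigI[OF k(1)])
    show "\<forall>\<^sub>F n in sequentially. k * norm (1 / ((real n)\<^sup>2 * sqrt (real n))) \<le> norm (?\<gamma> n)"
      using k(2) by eventually_elim (simp add: abs_mult)
  qed
  obtain c where c: "c > 0" "\<forall>\<^sub>F n in sequentially. c * sqrt (real n) \<le> ?r n"
    using rel_loss_stability_lower_bound[OF assms(3)] by blast
  have r: "?r \<in> \<Omega>(\<lambda>n. sqrt (real n))"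
  proof (rule landau_omega.bigI[OF c(1)])
    show "\<forall>\<^sub>F n in sequentially. c * norm (sqrt (real n)) \<le> norm (?r n)"
      using c(2) by eventually_elim simp
  qed
  have "?r \<notin> o(\<lambda>_. 1)"
  proof
    assume "?r \<in> o(\<lambda>_. 1)"
    then have "\<forall>\<^sub>F n in sequentially. norm (?r n) \<le> c / 2 * norm (1 :: real)"
      using c(1) by (intro landau_o.smallD) auto
    then have "\<forall>\<^sub>F n :: nat in sequentially. False"
      using c(2) eventually_ge_at_top[of 1]
    proof eventually_elim
      case (elim n)
      have "c * 1 \<le> c * sqrt (real n)" using c(1) elim(3) by (intro mult_left_mono) auto
      moreover have "norm (?r n) \<le> c / 2" using elim(1) by (simp only: norm_one mult_1_right)
      moreover have "?r n \<le> norm (?r n)" by simp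
      ultimately show ?case using elim(2) c(1) by linarith
    qed
    then show False by simp
  qed
  with sigma_sq_tendsto g r show ?thesis by blast
qed

end
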